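(* Let $\nu,\mu\in\mathbb{C}$ with $\nu+\mu\notin-\mathbb{N}_0$ and $2\nu\notin\mathbb{Z}$. If $\pm\operatorname{Im}x>0$ (upper signs throughout when $\operatorname{Im}x>0$, lower signs throughout when $\operatorname{Im}x<0$), then $$\mathsf{Q}_\nu^\mu(x)=2^\nu e^{\mp\pi i(\nu+1)}\left(\cos(\pi\mu)\mp i\frac{\sin(\pi(\mu-\nu))}{2\cos(\pi\nu)}\right)\frac{\Gamma(\nu+1)\Gamma(\nu+\mu+1)}{\Gamma(2\nu+2)}(1+x)^{\frac12\mu}(1-x)^{-\nu-\frac12\mu-1}{}_2F_1\!\left(\nu+\mu+1,\nu+1;2\nu+2;\frac{2}{1-x}\right)$$ $$\pm\, i\pi\,2^{-\nu-2}e^{\pm\pi i\nu}\sec(\pi\nu)\frac{\Gamma(-\nu)}{\Gamma(-2\nu)\Gamma(\nu-\mu+1)}(1+x)^{\frac12\mu}(1-x)^{\nu-\frac12\mu}{}_2F_1\!\left(-\nu,\mu-\nu;-2\nu;\frac{2}{1-x}\right).$$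
   Context: $\mathbb{N}=\{1,2,3,\dots\}$, $-\mathbb{N}=\{-1,-2,\dots\}$, $-\mathbb{N}_0=\{0,-1,-2,\dots\}$. $D_1=\mathbb{C}\setminus((-\infty,-1]\cup[1,\infty))$, $D_2=\mathbb{C}\setminus(-\infty,1]$. Complex powers are principal values. ${}_2F_1(a,b;c;w)$ is the Gauss hypergeometric function, principal branch on $\mathbb{C}\setminus[1,\infty)$ (the analytic continuation of $\sum_{n\ge0}\frac{(a)_n(b)_n}{(c)_n}\frac{w^n}{n!}$). $1/\Gamma$ is read as the entire function (zero at the poles of $\Gamma$). Associated Legendre function of the second kind: for $z\in D_2$, $\nu+\mu\in\mathbb{C}\setminus-\mathbb{N}$, $$Q_\nu^\mu(z)=\frac{\sqrt{\pi}\,e^{i\pi\mu}\Gamma(\nu+\mu+1)(z^2-1)^{\frac12\mu}}{2^{\nu+1}\Gamma(\nu+\frac32)z^{\nu+\mu+1}}\,{}_2F_1\!\left(\tfrac{\nu+\mu+2}{2},\tfrac{\nu+\mu+1}{2};\nu+\tfrac32;\tfrac1{z^2}\right),$$ where $(z^2-1)^\alpha:=(z+1)^\alpha(z-1)^\alpha$. Ferrers function of the second kind: for $x\in(-1,1)$, $$\mathsf{Q}_\nu^\mu(x)=\tfrac12\big[e^{-\frac12 i\pi\mu}\,e^{-i\pi\mu}Q_\nu^\mu(x+i0)+e^{\frac12 i\pi\mu}\,e^{-i\pi\mu}Q_\nu^\mu(x-i0)\big],$$ where $x\pm i0$ denotes the limit from the upper/lower half-plane, and $\mathsf{Q}_\nu^\mu$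 is extended analytically to $D_1$. *)

theory Defs
  imports "HOL-Complex_Analysis.Complex_Analysis"
begin

(* Principal branch on the plane cut along [1,oo). That domain is connected, so the holomorphic
   continuation of the series from the unit disc is unique there; on the cut the value is
   unspecified. Meaningful only if c is not a non-positive integer. *)
definition hyp2F1 :: "complex \<Rightarrow> complex \<Rightarrow> complex \<Rightarrow> complex \<Rightarrow> complex" where
  "hyp2F1 a b c =
     (SOME F. F holomorphic_on - complex_of_real ` {1..} \<and>
        (\<forall>w. norm w < 1 \<longrightarrow> F w = eval_fps (fps_hypergeo [a, b] [c] 1) w))"

(* Intended for z outside (-oo,1], nu + mu not a negative integer, and nu + 3/2 not a non-positive
   integer: in that last case the product of rGamma and hyp2F1 would have to be read as a limit.
   The power of z^2 - 1 is split so that each factor is a principal power. *)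
definition legendre_Q :: "complex \<Rightarrow> complex \<Rightarrow> complex \<Rightarrow> complex" where
  "legendre_Q \<nu> \<mu> z =
     of_real (sqrt pi) * exp (\<i> * of_real pi * \<mu>) * Gamma (\<nu> + \<mu> + 1) *
     ((z + 1) powr (\<mu> / 2) * (z - 1) powr (\<mu> / 2)) /
     (2 powr (\<nu> + 1) * z powr (\<nu> + \<mu> + 1)) * rGamma (\<nu> + 3 / 2) *
     hyp2F1 ((\<nu> + \<mu> + 2) / 2) ((\<nu> + \<mu> + 1) / 2) (\<nu> + 3 / 2) (1 / z\<^sup>2)"

definition ferrers_Q_real :: "complex \<Rightarrow> complex \<Rightarrow> real \<Rightarrow> complex" where
  "ferrers_Q_real \<nu> \<mu> x =
     (exp (- \<i> * of_real pi * \<mu> / 2) * exp (- \<i> * of_real pi * \<mu>) *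
        Lim (at (of_real x) within {z. Im z > 0}) (legendre_Q \<nu> \<mu>) +
      exp (\<i> * of_real pi * \<mu> / 2) * exp (- \<i> * of_real pi * \<mu>) *
        Lim (at (of_real x) within {z. Im z < 0}) (legendre_Q \<nu> \<mu>)) / 2"

(* The continuation from (-1,1) to the doubly cut plane, unique by the identity theorem;
   unspecified on the cuts. *)
definition ferrers_Q :: "complex \<Rightarrow> complex \<Rightarrow> complex \<Rightarrow> complex" where
  "ferrers_Q \<nu> \<mu> =
     (SOME F. F holomorphic_on - complex_of_real ` ({..-1} \<union> {1..}) \<and>
        (\<forall>x. -1 < x \<and> x < 1 \<longrightarrow> F (of_real x) = ferrers_Q_real \<nu> \<mu> x))"

end

theory Submission
  imports Defs
begin

text \<open>
  Off the real axis \<open>legendre_Q\<close> is, up to elementary factors, the solution recessive at infinity of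
  Legendre's equation. The even and odd solutions at the regular point 0 are holomorphic on the whole
  doubly cut plane, so expanding the recessive solution in them, separately in the upper and in the lower
  half plane, yields the boundary values on \<open>(-1, 1)\<close> and at the same time the continuation defining
  \<open>ferrers_Q\<close>. The connection coefficients are the limits of the recessive solution and of its derivative
  along the imaginary axis towards 0; Pfaff's transformation turns them into values of hypergeometric
  series at 1, given by Gauss's theorem. Within one half plane the even and the odd solution are then
  re-expressed through the recessive solution and the one with \<open>\<nu>\<close> replaced by \<open>- \<nu> - 1\<close>, and a
  quadratic transformation changes the variable from \<open>1 / x\<^sup>2\<close> to \<open>2 / (1 - x)\<close>.
\<close>

subsection \<open>Power series solutions at a regular singular point\<close>

text \<open>Both \<open>hyp2F1\<close> and \<open>ferrers_Q\<close> are defined by choice, so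
  nothing is known about them until a continuation has been exhibited. For \<open>hyp2F1\<close> it
  must exist for arbitrary complex upper parameters, which Euler's integral does not give directly;
  hence the route through the differential equation and its power series solutions. For
  \<open>ferrers_Q\<close> the origin is the natural base point: it is a regular point of Legendre's
  equation in the closure of both half planes, so one basis serves the two boundary values, and
  their mean is again a combination of that basis. The theorem then amounts to two scalar
  identities, one for the even and one for the odd coefficient. The condition that 2 \<nu> is not an
  integer keeps the lower parameters \<nu> + 3/2, 1/2 - \<nu>, 2 \<nu> + 2 and -2 \<nu> away from
  the non-positive integers and cos(\<pi> \<nu>) away from 0. The sign of Im x is carried as a
  number 1 or -1, so that each statement is proved once for both half planes.\<close>

lemma frobenius_recurrence:
  fixes H P Q :: "complex \<Rightarrow> complex"
  assumes H: "H has_fps_expansion h" and P: "P has_fps_expansion p" and Q: "Q has_fps_expansion q"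
    and ode: "eventually (\<lambda>u. u * deriv (deriv H) u + P u * deriv H u + Q u * H u = 0) (nhds 0)"
  shows "of_nat (Suc n) * (of_nat n + fps_nth p 0) * fps_nth h (Suc n) =
      - (\<Sum>k<n. fps_nth p (n - k) * (of_nat (Suc k) * fps_nth h (Suc k)))
      - (\<Sum>k\<le>n. fps_nth q (n - k) * fps_nth h k)"
proof -
  have "(\<lambda>u. u * deriv (deriv H) u + P u * deriv H u + Q u * H u)
      has_fps_expansion (fps_X * fps_deriv (fps_deriv h) + p * fps_deriv h + q * h)"
    by (intro fps_expansion_intros H P Q)
  moreover have "(\<lambda>u. u * deriv (deriv H) u + P u * deriv H u + Q u * H u) has_fps_expansion 0"
    using ode by (simp add: has_fps_expansion_0_iff)
  ultimately have "fps_X * fps_deriv (fps_deriv h) + p * fps_deriv h + q * h = 0"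
    by (rule fps_expansion_unique_complex)
  hence "fps_nth (fps_X * fps_deriv (fps_deriv h) + fps_deriv h * p + h * q) n = 0"
    by (simp add: mult.commute)
  moreover have "fps_nth (fps_X * fps_deriv (fps_deriv h)) n = of_nat n * (of_nat (Suc n) * fps_nth h (Suc n))"
    by (cases n) (simp_all add: algebra_simps)
  \<comment> \<open>The summand k = n carries the unknown coefficient; joined with the contribution
    of u H'' it yields the indicial factor n + p_0.\<close>
  moreover have "fps_nth (fps_deriv h * p) n =
      (\<Sum>k<n. fps_nth p (n - k) * (of_nat (Suc k) * fps_nth h (Suc k)))
      + of_nat (Suc n) * fps_nth h (Suc n) * fps_nth p 0"
    unfolding fps_mult_nth atLeast0AtMost lessThan_Suc_atMost [symmetric]
    by (simp add: mult_ac del: of_nat_Suc)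
  moreover have "fps_nth (h * q) n = (\<Sum>k\<le>n. fps_nth q (n - k) * fps_nth h k)"
    unfolding fps_mult_nth atLeast0AtMost by (simp add: mult_ac)
  ultimately show ?thesis
    unfolding fps_add_nth by algebra
qed

text \<open>The recurrence determines coefficient n + 1 from its predecessors as soon as n + p_0 is
  nonzero, so only the first N + 1 coefficients are free data. \<open>N = 1\<close> serves regular
  points, where p_0 = 0 and value and derivative are prescribed; \<open>N = 0\<close> serves
  singular points without resonance.\<close>

lemma frobenius_unique:
  fixes H P Q :: "complex \<Rightarrow> complex"
  assumes H: "H has_fps_expansion h" and P: "P has_fps_expansion p" and Q: "Q has_fps_expansion q"
    and ode: "eventually (\<lambda>u. u * deriv (deriv H) u + P u * deriv H u + Q u * H u = 0) (nhds 0)"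
    and nz: "\<And>n. n \<ge> N \<Longrightarrow> of_nat n + fps_nth p 0 \<noteq> 0"
    and init: "\<And>k. k \<le> N \<Longrightarrow> fps_nth h k = 0"
  shows "h = 0"
proof -
  have "fps_nth h n = 0" for n
  proof (induction n rule: less_induct)
    case (less n)
    show ?case
    proof (cases "n \<le> N")
      case False
      then obtain m where m: "n = Suc m" "m \<ge> N" by (cases n) auto
      have "of_nat (Suc m) * (of_nat m + fps_nth p 0) * fps_nth h (Suc m) = 0"
        using less m by (subst frobenius_recurrence[OF H P Q ode]) simp
      thus ?thesis using nz[OF m(2)] m by (simp del: of_nat_Suc)
    qed (use init in auto)
  qed
  thus ?thesis by (simp add: fps_eq_iff)
qed

lemma fps_nth_bound_conv_radius:
  fixes p :: "complex fps"
  assumes "0 < r" "ereal r < fps_conv_radius p"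
  obtains M where "M \<ge> 0" "\<And>k. norm (fps_nth p k) \<le> M * (1 / r) ^ k"
proof -
  have "summable (\<lambda>k. fps_nth p k * of_real r ^ k)"
    using assms by (intro summable_fps) auto
  hence "Bseq (\<lambda>k. fps_nth p k * of_real r ^ k)"
    using convergent_imp_Bseq summable_LIMSEQ_zero convergentI by blast
  then obtain M where M: "M > 0" "\<And>k. norm (fps_nth p k * of_real r ^ k) \<le> M"
    by (auto simp: Bseq_def)
  show thesis
  proof (rule that[of M])
    fix k
    show "norm (fps_nth p k) \<le> M * (1 / r) ^ k"
      using M(2)[of k] assms(1) by (simp add: norm_mult norm_power field_simps)
  qed (use M in auto)
qed

lemma sum_geometric_reverse_le:
  fixes x :: real
  assumes "0 \<le> x" "x < 1" "A \<subseteq> {..n}"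
  shows "(\<Sum>k\<in>A. x ^ (n - k)) \<le> 1 / (1 - x)"
proof -
  have "(\<Sum>k\<in>A. x ^ (n - k)) \<le> (\<Sum>k\<le>n. x ^ (n - k))"
    using assms by (intro sum_mono2) auto
  also have "\<dots> = (\<Sum>k\<le>n. x ^ k)"
    using sum.nat_diff_reindex[of "\<lambda>k. x ^ k" "Suc n"] by (simp add: lessThan_Suc_atMost)
  also have "\<dots> \<le> (\<Sum>k. x ^ k)"
    using assms by (intro sum_le_suminf summable_geometric) auto
  also have "\<dots> = 1 / (1 - x)"
    using assms by (intro suminf_geometric) auto
  finally show ?thesis .
qed

text \<open>Induction on a running maximum: with x_n = |h_n| \<rho>^n, a bound K for all indices up
  to n passes to n + 1 once n is large. The left factor grows like n^2 while the right side is only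
  O(n) K \<rho>^(-n-1), because the coefficients of \<open>p\<close> and \<open>q\<close> decay
  geometrically at the rate of the larger radius r.\<close>

lemma frobenius_bounded:
  fixes h p q :: "complex fps"
  assumes rec: "\<And>n. of_nat (Suc n) * (of_nat n + fps_nth p 0) * fps_nth h (Suc n) =
      - (\<Sum>k<n. fps_nth p (n - k) * (of_nat (Suc k) * fps_nth h (Suc k)))
      - (\<Sum>k\<le>n. fps_nth q (n - k) * fps_nth h k)"
    and r: "0 < \<rho>" "\<rho> < r" "ereal r < fps_conv_radius p" "ereal r < fps_conv_radius q"
  shows "\<exists>K. \<forall>n. norm (fps_nth h n) * \<rho> ^ n \<le> K"
proof -
  from r have r0: "r > 0" by simp
  obtain M1 where M1: "M1 \<ge> 0" "\<And>k. norm (fps_nth p k) \<le> M1 * (1 / r) ^ k"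
    using fps_nth_bound_conv_radius[OF r0 r(3)] by blast
  obtain M2 where M2: "M2 \<ge> 0" "\<And>k. norm (fps_nth q k) \<le> M2 * (1 / r) ^ k"
    using fps_nth_bound_conv_radius[OF r0 r(4)] by blast
  define M where "M = max M1 M2"
  have M: "M \<ge> 0" "norm (fps_nth p k) \<le> M * (1 / r) ^ k" "norm (fps_nth q k) \<le> M * (1 / r) ^ k" for k
    using M1(1) M1(2)[of k] M2(2)[of k] r0
    by (auto simp: M_def intro: order.trans[OF _ mult_right_mono])
  define S where "S = 1 / (1 - \<rho> / r)"
  have S: "S > 0" using r r0 by (simp add: S_def)
  define x where "x n = norm (fps_nth h n) * \<rho> ^ n" for n
  have x0: "x n \<ge> 0" for n using r by (simp add: x_def)
  \<comment> \<open>The first bound gives |n + p_0| >= n / 2 for n >= N; the second lets n absorb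
    the constant left over when the two convolution estimates are added.\<close>
  obtain N :: nat where N: "real N \<ge> 2 * norm (fps_nth p 0) + 1" "real N \<ge> 2 * M * S * (1 + \<rho>)"
    using real_arch_simple[of "max (2 * norm (fps_nth p 0) + 1) (2 * M * S * (1 + \<rho>))"] by auto
  have step: "x (Suc n) \<le> K" if n: "n \<ge> N" and K: "\<And>k. k \<le> n \<Longrightarrow> x k \<le> K" for n K
  proof -
    have n1: "real n \<ge> 2 * norm (fps_nth p 0) + 1" "real n \<ge> 2 * M * S * (1 + \<rho>)"
      using N n by linarith+
    have n0: "real n \<ge> 1" using n1(1) norm_ge_zero[of "fps_nth p 0"] by linarith
    have K0: "K \<ge> 0" using x0[of 0] K[of 0] by simp
    have hK: "norm (fps_nth h k) \<le> K * (1 / \<rho>) ^ k" if "k \<le> n" for k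
      using K[OF that] r(1) by (simp add: x_def field_simps)
    \<comment> \<open>Everything is measured against \<rho>; the surplus (\<rho> / r)^(n - k) is
      summable because \<rho> < r.\<close>
    have pw: "(1 / r) ^ (n - k) * (1 / \<rho>) ^ k = (1 / \<rho>) ^ n * (\<rho> / r) ^ (n - k)" if "k \<le> n" for k
    proof -
      have "(1 / \<rho>) ^ n = (1 / \<rho>) ^ (n - k) * (1 / \<rho>) ^ k"
        using that by (simp flip: power_add)
      thus ?thesis using r by (simp add: field_simps)
    qed
    have "norm (\<Sum>k<n. fps_nth p (n - k) * (of_nat (Suc k) * fps_nth h (Suc k)))
        \<le> (\<Sum>k<n. M * (1 / r) ^ (n - k) * (n * (K * (1 / \<rho>) ^ Suc k)))"
    proof (rule sum_norm_le)
      fix k assume "k \<in> {..<n}"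
      hence k: "Suc k \<le> n" by simp
      have "norm (fps_nth p (n - k)) * (real (Suc k) * norm (fps_nth h (Suc k)))
          \<le> M * (1 / r) ^ (n - k) * (real n * (K * (1 / \<rho>) ^ Suc k))"
        using k M(1) K0 r r0 by (intro mult_mono M hK mult_nonneg_nonneg) auto
      thus "norm (fps_nth p (n - k) * (of_nat (Suc k) * fps_nth h (Suc k)))
          \<le> M * (1 / r) ^ (n - k) * (n * (K * (1 / \<rho>) ^ Suc k))"
        by (simp only: norm_mult norm_of_nat)
    qed
    also have "\<dots> = M * n * K * (1 / \<rho>) ^ Suc n * (\<Sum>k<n. (\<rho> / r) ^ (n - k))"
      unfolding sum_distrib_left
    proof (intro sum.cong refl, goal_cases)
      case (1 k)
      have "M * (1 / r) ^ (n - k) * (n * (K * (1 / \<rho>) ^ Suc k))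
         = M * n * K * (1 / \<rho>) * ((1 / r) ^ (n - k) * (1 / \<rho>) ^ k)" by simp
      also have "\<dots> = M * n * K * (1 / \<rho>) * ((1 / \<rho>) ^ n * (\<rho> / r) ^ (n - k))"
        using 1 by (subst pw) auto
      finally show ?case by simp
    qed
    also have "\<dots> \<le> M * n * K * (1 / \<rho>) ^ Suc n * S"
      unfolding S_def using r r0 M(1) K0
      by (intro mult_left_mono sum_geometric_reverse_le mult_nonneg_nonneg) auto
    finally have b1: "norm (\<Sum>k<n. fps_nth p (n - k) * (of_nat (Suc k) * fps_nth h (Suc k)))
       \<le> M * n * K * (1 / \<rho>) ^ Suc n * S" .
    have "norm (\<Sum>k\<le>n. fps_nth q (n - k) * fps_nth h k)
        \<le> (\<Sum>k\<le>n. M * (1 / r) ^ (n - k) * (K * (1 / \<rho>) ^ k))"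
      unfolding norm_mult using M(1) K0 r r0
      by (intro sum_norm_le, unfold norm_mult) (intro mult_mono M hK mult_nonneg_nonneg; auto)
    also have "\<dots> = M * K * (1 / \<rho>) ^ n * (\<Sum>k\<le>n. (\<rho> / r) ^ (n - k))"
      unfolding sum_distrib_left
    proof (intro sum.cong refl, goal_cases)
      case (1 k)
      have "M * (1 / r) ^ (n - k) * (K * (1 / \<rho>) ^ k)
         = M * K * ((1 / r) ^ (n - k) * (1 / \<rho>) ^ k)" by simp
      also have "\<dots> = M * K * ((1 / \<rho>) ^ n * (\<rho> / r) ^ (n - k))"
        using 1 by (subst pw) auto
      finally show ?case by simp
    qed
    also have "\<dots> \<le> M * K * (1 / \<rho>) ^ n * S"
      unfolding S_def using r r0 M(1) K0
      by (intro mult_left_mono sum_geometric_reverse_le mult_nonneg_nonneg) auto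
    also have "\<dots> = M * K * (1 / \<rho>) ^ Suc n * S * \<rho>" using r by simp
    also have "\<dots> \<le> M * K * (1 / \<rho>) ^ Suc n * S * (\<rho> * n)"
      using r r0 M(1) K0 S n0 by (intro mult_left_mono mult_nonneg_nonneg) auto
    finally have b2: "norm (\<Sum>k\<le>n. fps_nth q (n - k) * fps_nth h k)
       \<le> M * K * (1 / \<rho>) ^ Suc n * S * (\<rho> * n)" .
    have "real n / 2 \<le> norm (of_nat n + fps_nth p 0)"
      using norm_diff_ineq[of "of_nat n :: complex" "fps_nth p 0"] n1(1) by simp
    hence "real (Suc n) * (real n / 2) * norm (fps_nth h (Suc n))
        \<le> real (Suc n) * norm (of_nat n + fps_nth p 0) * norm (fps_nth h (Suc n))"
      by (intro mult_right_mono mult_left_mono) auto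
    also have "\<dots> = norm (of_nat (Suc n) * (of_nat n + fps_nth p 0) * fps_nth h (Suc n))"
      by (simp only: norm_mult norm_of_nat)
    also have "\<dots> \<le> M * n * K * (1 / \<rho>) ^ Suc n * S + M * K * (1 / \<rho>) ^ Suc n * S * (\<rho> * n)"
      unfolding rec using b1 b2 norm_triangle_ineq4[of
         "- (\<Sum>k<n. fps_nth p (n - k) * (of_nat (Suc k) * fps_nth h (Suc k)))"
         "\<Sum>k\<le>n. fps_nth q (n - k) * fps_nth h k"] unfolding norm_minus_cancel by linarith
    also have "\<dots> = (2 * M * S * (1 + \<rho>)) * (K * (1 / \<rho>) ^ Suc n * (n / 2))"
      by (simp add: algebra_simps)
    also have "\<dots> \<le> real n * (K * (1 / \<rho>) ^ Suc n * (n / 2))"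
      using n1(2) K0 r by (intro mult_right_mono mult_nonneg_nonneg) auto
    also have "\<dots> \<le> real (Suc n) * (K * (1 / \<rho>) ^ Suc n * (n / 2))"
      using n1(2) K0 r by (intro mult_right_mono mult_nonneg_nonneg) auto
    finally have "(real (Suc n) * (real n / 2)) * norm (fps_nth h (Suc n))
        \<le> (real (Suc n) * (real n / 2)) * (K * (1 / \<rho>) ^ Suc n)" by (simp only: mult_ac)
    hence "norm (fps_nth h (Suc n)) \<le> K * (1 / \<rho>) ^ Suc n"
      using n0 by (subst (asm) mult_le_cancel_left_pos) auto
    thus ?thesis using r(1) unfolding x_def by (simp add: field_simps)
  qed
  define K where "K = Max (x ` {..N})"
  have "x n \<le> K" for n
  proof (induction n rule: less_induct)
    case (less n)
    show ?case
    proof (cases "n \<le> N")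
      case True
      thus ?thesis by (auto simp: K_def)
    next
      case False
      then obtain m where m: "n = Suc m" "m \<ge> N" by (cases n) auto
      show ?thesis unfolding m(1) using less m by (intro step) auto
    qed
  qed
  thus ?thesis by (auto simp: x_def)
qed

text \<open>Three radii s < \<rho> < r below R: bounds on \<open>p\<close> and \<open>q\<close> at r
  give boundedness of the terms of \<open>h\<close> at \<rho>, and Abel's lemma gives convergence at
  s. The germ \<open>H\<close> is given, so the finitely many indices at which the indicial factor
  is small or zero only enlarge the constant.\<close>

lemma frobenius_conv_radius:
  fixes H P Q :: "complex \<Rightarrow> complex"
  assumes H: "H has_fps_expansion h" and P: "P has_fps_expansion p" and Q: "Q has_fps_expansion q"
    and ode: "eventually (\<lambda>u. u * deriv (deriv H) u + P u * deriv H u + Q u * H u = 0) (nhds 0)"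
    and R: "R \<le> fps_conv_radius p" "R \<le> fps_conv_radius q"
  shows "R \<le> fps_conv_radius h"
  unfolding fps_conv_radius_def
proof (rule conv_radius_geI_ex')
  fix s :: real assume s: "0 < s" "ereal s < R"
  obtain \<rho> where \<rho>: "s < \<rho>" "ereal \<rho> < R" using ereal_dense2[OF s(2)] by auto
  obtain r where r: "\<rho> < r" "ereal r < R" using ereal_dense2[OF \<rho>(2)] by auto
  have "\<exists>K. \<forall>n. norm (fps_nth h n) * \<rho> ^ n \<le> K"
    using frobenius_recurrence[OF H P Q ode] s \<rho> r R
    by (intro frobenius_bounded[of p h q \<rho> r]) (auto intro: less_le_trans)
  then obtain K where K: "\<And>n. norm (fps_nth h n) * \<rho> ^ n \<le> K" by blast
  have "summable (\<lambda>n. norm (fps_nth h n) * s ^ n)"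
    using s \<rho> K by (intro Abel_lemma[of s \<rho> "fps_nth h" K]) auto
  thus "summable (\<lambda>n. fps_nth h n * of_real s ^ n)"
    using s by (intro summable_norm_cancel[of "\<lambda>n. fps_nth h n * of_real s ^ n"]) (simp add: norm_mult norm_power)
qed

subsection \<open>The hypergeometric function on the slit plane\<close>

definition slit_plane :: "complex set" where "slit_plane = - complex_of_real ` {1..}"

lemma slit_plane_iff: "w \<in> slit_plane \<longleftrightarrow> Im w \<noteq> 0 \<or> Re w < 1"
proof -
  have "w \<in> complex_of_real ` {1..} \<longleftrightarrow> Im w = 0 \<and> Re w \<ge> 1"
    by (auto simp: complex_eq_iff intro!: image_eqI[of _ _ "Re w"])
  thus ?thesis by (auto simp: slit_plane_def)
qed

text \<open>This form fits the principal branch: it is what makes \<open>csqrt (1 - w)\<close> and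
  the powers of \<open>1 - w\<close> holomorphic on the slit plane.\<close>

lemma slit_plane_alt: "w \<in> slit_plane \<longleftrightarrow> 1 - w \<notin> \<real>\<^sub>\<le>\<^sub>0"
  by (auto simp: slit_plane_iff complex_nonpos_Reals_iff)

lemma zero_in_slit_plane [simp]: "0 \<in> slit_plane"
  by (simp add: slit_plane_iff)

lemma ball_subset_slit_plane: "ball 0 1 \<subseteq> slit_plane"
proof
  fix w :: complex assume "w \<in> ball 0 1"
  thus "w \<in> slit_plane" using complex_Re_le_cmod[of w] by (auto simp: slit_plane_iff)
qed

lemma open_slit_plane [intro, simp]: "open slit_plane"
proof -
  have "slit_plane = {w. Im w < 0} \<union> {w. Im w > 0} \<union> {w. Re w < 1}"
    by (auto simp: slit_plane_iff)
  moreover have "open ({w. Im w < 0} \<union> {w. Im w > 0} \<union> {w. Re w < 1})"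
    by (intro open_Un open_halfspace_Im_lt open_halfspace_Im_gt open_halfspace_Re_lt)
  ultimately show ?thesis by simp
qed

lemma slit_plane_scale: "w \<in> slit_plane \<Longrightarrow> 0 \<le> t \<Longrightarrow> t \<le> 1 \<Longrightarrow> t *\<^sub>R w \<in> slit_plane"
  by (auto simp: slit_plane_iff) (smt (verit) mult_left_le_one_le mult_nonneg_nonpos)+

lemma starlike_0I:
  assumes "0 \<in> S" "\<And>w t. w \<in> S \<Longrightarrow> 0 \<le> t \<Longrightarrow> t \<le> 1 \<Longrightarrow> t *\<^sub>R w \<in> S"
  shows "starlike (S :: complex set)"
  unfolding starlike_def using assms by (intro bexI[of _ 0]) (auto simp: in_segment)

lemma connected_slit_plane [intro, simp]: "connected slit_plane"
  by (intro starlike_imp_connected starlike_0I slit_plane_scale) auto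

abbreviation hyp_fps :: "complex \<Rightarrow> complex \<Rightarrow> complex \<Rightarrow> complex fps" where
  "hyp_fps a b c \<equiv> fps_hypergeo [a, b] [c] 1"

lemma add_of_nat_nonzero: "(c :: complex) \<notin> \<int>\<^sub>\<le>\<^sub>0 \<Longrightarrow> c + of_nat n \<noteq> 0" "c \<notin> \<int>\<^sub>\<le>\<^sub>0 \<Longrightarrow> of_nat n + c \<noteq> 0"
  by (auto dest: plus_of_nat_eq_0_imp simp: add.commute)

lemma hyp_fps_Suc:
  assumes "c \<notin> \<int>\<^sub>\<le>\<^sub>0"
  shows "of_nat (Suc n) * (c + of_nat n) * fps_nth (hyp_fps a b c) (Suc n) =
     (a + of_nat n) * (b + of_nat n) * fps_nth (hyp_fps a b c) n"
proof -
  have "pochhammer c n \<noteq> 0" using assms by (auto dest: pochhammer_eq_0_imp_nonpos_Int)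
  moreover have e1: "fps_nth (hyp_fps a b c) n = pochhammer a n * pochhammer b n / (pochhammer c n * fact n)"
    by simp
  moreover have e2: "fps_nth (hyp_fps a b c) (Suc n) = pochhammer a n * (a + of_nat n) * (pochhammer b n * (b + of_nat n))
      / (pochhammer c n * (c + of_nat n) * (of_nat (Suc n) * fact n))"
    by (simp add: pochhammer_Suc) (simp add: algebra_simps)
  ultimately show ?thesis
    using add_of_nat_nonzero[OF assms, of n] unfolding e1 e2
    by (simp add: divide_simps del: of_nat_Suc)
qed

lemma tendsto_shift_ratio: "(\<lambda>n. (a + of_nat n) / (c + of_nat n :: complex)) \<longlonglongrightarrow> 1"
proof -
  have "filterlim (\<lambda>n. c + of_nat n) at_infinity sequentially"
    by (intro tendsto_add_filterlim_at_infinity[of _ c] tendsto_const tendsto_of_nat)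
  hence "(\<lambda>n. 1 + (a - c) / (c + of_nat n)) \<longlonglongrightarrow> 1 + 0"
    by (intro tendsto_add tendsto_const tendsto_divide_0[OF tendsto_const])
  moreover have "eventually (\<lambda>n. c + of_nat n \<noteq> (0::complex)) sequentially"
    by (rule filterlim_at_infinity_imp_eventually_ne) fact
  hence "eventually (\<lambda>n. 1 + (a - c) / (c + of_nat n) = (a + of_nat n) / (c + of_nat n)) sequentially"
    by eventually_elim (simp add: field_simps)
  ultimately show ?thesis
    by (simp add: tendsto_cong)
qed

text \<open>Ratio test. Only a lower bound can be claimed, since a terminating series has infinite
  radius. The coefficient ratios tend to 1, so any number strictly between s and 1 serves as the
  contraction factor; the midpoint is taken.\<close>

lemma hyp_fps_conv_radius:
  assumes c: "c \<notin> \<int>\<^sub>\<le>\<^sub>0"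
  shows "fps_conv_radius (hyp_fps a b c) \<ge> 1"
  unfolding fps_conv_radius_def
proof (rule conv_radius_geI_ex')
  fix s :: real assume s: "0 < s" "ereal s < 1"
  let ?f = "fps_nth (hyp_fps a b c)"
  define q where "q n = (a + of_nat n) / (c + of_nat n) * ((b + of_nat n) / (1 + of_nat n))" for n
  have f_Suc: "?f (Suc n) = q n * ?f n" for n
  proof -
    have "1 + of_nat n \<noteq> (0 :: complex)" by (metis of_nat_Suc of_nat_neq_0)
    thus ?thesis
      using hyp_fps_Suc[OF c, of n a b] add_of_nat_nonzero[OF c, of n]
      by (simp add: q_def divide_simps mult_ac del: fps_hypergeo_nth)
  qed
  have "(\<lambda>n. norm (q n) * s) \<longlonglongrightarrow> norm (1 * 1 :: complex) * s"
    unfolding q_def by (intro tendsto_intros tendsto_shift_ratio)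
  moreover have "norm (1 * 1 :: complex) * s < (1 + s) / 2" using s by simp
  ultimately have "eventually (\<lambda>n. norm (q n) * s < (1 + s) / 2) sequentially"
    by (rule order_tendstoD(2))
  then obtain N where N: "\<And>n. n \<ge> N \<Longrightarrow> norm (q n) * s < (1 + s) / 2"
    by (auto simp: eventually_sequentially)
  show "summable (\<lambda>n. ?f n * of_real s ^ n)"
  proof (rule summable_ratio_test)
    show "(1 + s) / 2 < 1" using s by simp
    fix n assume n: "n \<ge> N"
    have "norm (?f (Suc n) * of_real s ^ Suc n) = norm (q n) * s * norm (?f n * of_real s ^ n)"
      using s unfolding f_Suc by (simp add: norm_mult norm_power del: fps_hypergeo_nth)
    also have "\<dots> \<le> (1 + s) / 2 * norm (?f n * of_real s ^ n)"
      using N[OF n] by (intro mult_right_mono) auto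
    finally show "norm (?f (Suc n) * of_real s ^ Suc n) \<le> (1 + s) / 2 * norm (?f n * of_real s ^ n)" .
  qed
qed

lemma hyp_fps_conv_radius_gt:
  assumes "c \<notin> \<int>\<^sub>\<le>\<^sub>0"
  shows "norm (w :: complex) < 1 \<Longrightarrow> ereal (norm w) < fps_conv_radius (hyp_fps a b c)"
    and "fps_conv_radius (hyp_fps a b c) > 0"
proof -
  show *: "ereal (norm w) < fps_conv_radius (hyp_fps a b c)" if "norm w < 1" for w :: complex
    using less_le_trans[OF _ hyp_fps_conv_radius[OF assms, of a b], of "ereal (norm w)"] that by simp
  show "fps_conv_radius (hyp_fps a b c) > 0" using *[of 0] by (simp add: zero_ereal_def)
qed

definition hyp_ode :: "complex \<Rightarrow> complex \<Rightarrow> complex \<Rightarrow> (complex \<Rightarrow> complex) \<Rightarrow> complex \<Rightarrow> bool" where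
  "hyp_ode a b c f w \<longleftrightarrow>
     w * (1 - w) * deriv (deriv f) w + (c - (a + b + 1) * w) * deriv f w - a * b * f w = 0"

definition hyp_ode_fps :: "complex \<Rightarrow> complex \<Rightarrow> complex \<Rightarrow> complex fps \<Rightarrow> complex fps" where
  "hyp_ode_fps a b c f = fps_X * (1 - fps_X) * fps_deriv (fps_deriv f)
     + (fps_const c - fps_const (a + b + 1) * fps_X) * fps_deriv f - fps_const (a * b) * f"

text \<open>Coefficientwise the hypergeometric operator is a two-term recurrence. It is used in both
  directions: the hypergeometric series solves the equation, and a power series solution is
  determined by its constant term.\<close>

lemma hyp_ode_fps_nth:
  "fps_nth (hyp_ode_fps a b c f) n =
     of_nat (Suc n) * (c + of_nat n) * fps_nth f (Suc n) - (a + of_nat n) * (b + of_nat n) * fps_nth f n"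
proof -
  have "hyp_ode_fps a b c f = fps_X * fps_deriv (fps_deriv f) - fps_X * (fps_X * fps_deriv (fps_deriv f))
     + fps_const c * fps_deriv f - fps_const (a + b + 1) * (fps_X * fps_deriv f) - fps_const (a * b) * f"
    by (simp add: hyp_ode_fps_def algebra_simps)
  moreover have "fps_nth (fps_X * fps_deriv (fps_deriv f)) n = of_nat n * of_nat (Suc n) * fps_nth f (Suc n)"
    by (cases n) (simp_all add: mult_ac)
  moreover have "fps_nth (fps_X * (fps_X * fps_deriv (fps_deriv f))) n = of_nat n * (of_nat n - 1) * fps_nth f n"
  proof (cases n)
    case (Suc m)
    thus ?thesis by (cases m) (simp_all add: mult_ac)
  qed auto
  moreover have "fps_nth (fps_X * fps_deriv f) n = of_nat n * fps_nth f n"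
    by (cases n) simp_all
  moreover have "fps_nth (fps_deriv f) n = of_nat (Suc n) * fps_nth f (Suc n)"
    by simp
  ultimately have "fps_nth (hyp_ode_fps a b c f) n = of_nat n * of_nat (Suc n) * fps_nth f (Suc n)
     - of_nat n * (of_nat n - 1) * fps_nth f n + c * (of_nat (Suc n) * fps_nth f (Suc n))
     - (a + b + 1) * (of_nat n * fps_nth f n) - a * b * fps_nth f n"
    by (simp only: fps_add_nth fps_sub_nth fps_mult_left_const_nth)
  also have "\<dots> = of_nat (Suc n) * (c + of_nat n) * fps_nth f (Suc n) - (a + of_nat n) * (b + of_nat n) * fps_nth f n"
    by (simp add: algebra_simps)
  finally show ?thesis .
qed

lemma has_fps_expansion_hyp_ode:
  assumes f: "f has_fps_expansion F"
  shows "(\<lambda>w. w * (1 - w) * deriv (deriv f) w + (c - (a + b + 1) * w) * deriv f w - a * b * f w)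
           has_fps_expansion hyp_ode_fps a b c F"
  unfolding hyp_ode_fps_def by (intro fps_expansion_intros f)

text \<open>The equation holds as an identity of expansions at 0; its left side is holomorphic on
  \<open>S\<close>, and the identity theorem spreads it over this connected set.\<close>

lemma hyp_ode_of_expansion:
  assumes f: "f has_fps_expansion hyp_fps a b c" and c: "c \<notin> \<int>\<^sub>\<le>\<^sub>0"
    and hol: "f holomorphic_on S" and S: "open S" "connected S" "0 \<in> S" "w \<in> S"
  shows "hyp_ode a b c f w"
proof -
  have "hyp_ode_fps a b c (hyp_fps a b c) = 0"
    using hyp_fps_Suc[OF c] by (simp add: fps_eq_iff hyp_ode_fps_nth del: fps_hypergeo_nth)
  hence "(\<lambda>w. w * (1 - w) * deriv (deriv f) w + (c - (a + b + 1) * w) * deriv f w - a * b * f w)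
           has_fps_expansion 0" using has_fps_expansion_hyp_ode[OF f, of c a b] by simp
  moreover have "(\<lambda>w. w * (1 - w) * deriv (deriv f) w + (c - (a + b + 1) * w) * deriv f w - a * b * f w)
           holomorphic_on S"
    by (intro holomorphic_intros holomorphic_deriv hol S)
  ultimately show ?thesis
    unfolding hyp_ode_def using S by (rule has_fps_expansion_0_analytic_continuation)
qed

text \<open>One initial value suffices at this singular point: the leading factor (n + 1) (c + n) of
  the recurrence never vanishes.\<close>

lemma hyp_ode_unique:
  assumes f: "f has_fps_expansion F" and c: "c \<notin> \<int>\<^sub>\<le>\<^sub>0"
    and ode: "eventually (hyp_ode a b c f) (nhds 0)" and f0: "f 0 = 1"
  shows "F = hyp_fps a b c"
proof -
  have "(\<lambda>w. w * (1 - w) * deriv (deriv f) w + (c - (a + b + 1) * w) * deriv f w - a * b * f w)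
           has_fps_expansion 0"
    unfolding has_fps_expansion_0_iff using ode by eventually_elim (simp add: hyp_ode_def)
  with has_fps_expansion_hyp_ode[OF f, of c a b] have "hyp_ode_fps a b c F = 0"
    by (rule fps_expansion_unique_complex)
  hence *: "of_nat (Suc n) * (c + of_nat n) * fps_nth F (Suc n) = (a + of_nat n) * (b + of_nat n) * fps_nth F n" for n
    using hyp_ode_fps_nth[of a b c F n] by simp
  have "fps_nth F n = fps_nth (hyp_fps a b c) n" for n
  proof (induction n)
    case 0
    thus ?case using f f0 by (simp add: has_fps_expansion_imp_0_eq_fps_nth_0)
  next
    case (Suc n)
    have "of_nat (Suc n) * (c + of_nat n) * fps_nth F (Suc n) =
          of_nat (Suc n) * (c + of_nat n) * fps_nth (hyp_fps a b c) (Suc n)"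
      unfolding * Suc hyp_fps_Suc[OF c] ..
    thus ?case using add_of_nat_nonzero[OF c, of n] by (simp del: of_nat_Suc fps_hypergeo_nth)
  qed
  thus ?thesis by (simp add: fps_eq_iff del: fps_hypergeo_nth)
qed

section \<open>Second-order equations under change of variable and multiplication by a
  factor\<close>

lemma deriv2_eqI:
  assumes "open T" "t \<in> T"
    and "\<And>t. t \<in> T \<Longrightarrow> (H has_field_derivative H1 t) (at t)"
    and "\<And>t. t \<in> T \<Longrightarrow> (H1 has_field_derivative H2 t) (at t)"
  shows "deriv H t = H1 t" "deriv (deriv H) t = H2 t"
proof -
  have *: "deriv H t = H1 t" if "t \<in> T" for t using assms(3)[OF that] by (rule DERIV_imp_deriv)
  show "deriv H t = H1 t" using *[OF assms(2)] .
  have "eventually (\<lambda>t. t \<in> T) (nhds t)" using assms(1,2) by (rule eventually_nhds_in_open)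
  hence "deriv (deriv H) t = deriv H1 t"
    by (intro deriv_cong_ev refl) (auto elim!: eventually_mono simp: *)
  thus "deriv (deriv H) t = H2 t" using assms(4)[OF assms(2)] by (simp add: DERIV_imp_deriv)
qed

lemma deriv2_mult_compose:
  fixes m \<phi> f :: "complex \<Rightarrow> complex"
  assumes T: "open T" "t \<in> T" and S: "open S" "f holomorphic_on S" "\<And>t. t \<in> T \<Longrightarrow> \<phi> t \<in> S"
    and m: "\<And>t. t \<in> T \<Longrightarrow> (m has_field_derivative m1 t) (at t)"
      "\<And>t. t \<in> T \<Longrightarrow> (m1 has_field_derivative m2 t) (at t)"
    and \<phi>: "\<And>t. t \<in> T \<Longrightarrow> (\<phi> has_field_derivative \<phi>1 t) (at t)"
      "\<And>t. t \<in> T \<Longrightarrow> (\<phi>1 has_field_derivative \<phi>2 t) (at t)"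
  shows "deriv (\<lambda>t. m t * f (\<phi> t)) t = m1 t * f (\<phi> t) + m t * \<phi>1 t * deriv f (\<phi> t)"
    and "deriv (deriv (\<lambda>t. m t * f (\<phi> t))) t = m2 t * f (\<phi> t)
       + (2 * m1 t * \<phi>1 t + m t * \<phi>2 t) * deriv f (\<phi> t) + m t * (\<phi>1 t)\<^sup>2 * deriv (deriv f) (\<phi> t)"
proof -
  have f1: "((\<lambda>t. f (\<phi> t)) has_field_derivative deriv f (\<phi> t) * \<phi>1 t) (at t)" if "t \<in> T" for t
    using holomorphic_derivI[OF S(2,1) S(3)[OF that]] \<phi>(1)[OF that] by (rule DERIV_chain2)
  have f2: "((\<lambda>t. deriv f (\<phi> t)) has_field_derivative deriv (deriv f) (\<phi> t) * \<phi>1 t) (at t)" if "t \<in> T" for t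
    using holomorphic_derivI[OF holomorphic_deriv[OF S(2,1)] S(1) S(3)[OF that]] \<phi>(1)[OF that]
    by (rule DERIV_chain2)
  have 1: "((\<lambda>t. m t * f (\<phi> t)) has_field_derivative m1 t * f (\<phi> t) + m t * \<phi>1 t * deriv f (\<phi> t)) (at t)"
    if "t \<in> T" for t
    using DERIV_mult[OF m(1)[OF that] f1[OF that]]
    by (rule DERIV_cong) (simp add: algebra_simps)
  have 2: "((\<lambda>t. m1 t * f (\<phi> t) + m t * \<phi>1 t * deriv f (\<phi> t)) has_field_derivative
      m2 t * f (\<phi> t) + (2 * m1 t * \<phi>1 t + m t * \<phi>2 t) * deriv f (\<phi> t)
        + m t * (\<phi>1 t)\<^sup>2 * deriv (deriv f) (\<phi> t)) (at t)" if "t \<in> T" for t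
    using DERIV_add[OF DERIV_mult[OF m(2)[OF that] f1[OF that]]
        DERIV_mult[OF DERIV_mult[OF m(1)[OF that] \<phi>(2)[OF that]] f2[OF that]]]
    by (rule DERIV_cong) (simp add: algebra_simps power2_eq_square)
  show "deriv (\<lambda>t. m t * f (\<phi> t)) t = m1 t * f (\<phi> t) + m t * \<phi>1 t * deriv f (\<phi> t)"
    and "deriv (deriv (\<lambda>t. m t * f (\<phi> t))) t = m2 t * f (\<phi> t)
       + (2 * m1 t * \<phi>1 t + m t * \<phi>2 t) * deriv f (\<phi> t) + m t * (\<phi>1 t)\<^sup>2 * deriv (deriv f) (\<phi> t)"
    using deriv2_eqI[OF T 1 2] by auto
qed

text \<open>The three conditions compare the coefficients of f'', f' and f; \<open>l\<close> is the
  factor by which the transformed operator is a multiple of the hypergeometric one at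
  \<open>\<phi> t\<close>. Nothing is divided out, so that each later check of an equation becomes
  an identity between rational functions.\<close>

lemma ode_mult_compose:
  fixes m \<phi> f :: "complex \<Rightarrow> complex"
  assumes T: "open T" "t \<in> T" and S: "open S" "f holomorphic_on S" "\<And>t. t \<in> T \<Longrightarrow> \<phi> t \<in> S"
    and m: "\<And>t. t \<in> T \<Longrightarrow> (m has_field_derivative m1 t) (at t)"
      "\<And>t. t \<in> T \<Longrightarrow> (m1 has_field_derivative m2 t) (at t)"
    and \<phi>: "\<And>t. t \<in> T \<Longrightarrow> (\<phi> has_field_derivative \<phi>1 t) (at t)"
      "\<And>t. t \<in> T \<Longrightarrow> (\<phi>1 has_field_derivative \<phi>2 t) (at t)"
    and ode: "hyp_ode a b c f (\<phi> t)"
    and coeff: "p * (m t * (\<phi>1 t)\<^sup>2) = l * (\<phi> t * (1 - \<phi> t))"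
      "p * (2 * m1 t * \<phi>1 t + m t * \<phi>2 t) + q * (m t * \<phi>1 t) = l * (c - (a + b + 1) * \<phi> t)"
      "p * m2 t + q * m1 t + r * m t = - l * (a * b)"
  shows "p * deriv (deriv (\<lambda>t. m t * f (\<phi> t))) t + q * deriv (\<lambda>t. m t * f (\<phi> t)) t
          + r * (m t * f (\<phi> t)) = 0"
proof -
  have "p * deriv (deriv (\<lambda>t. m t * f (\<phi> t))) t + q * deriv (\<lambda>t. m t * f (\<phi> t)) t + r * (m t * f (\<phi> t))
     = (p * (m t * (\<phi>1 t)\<^sup>2)) * deriv (deriv f) (\<phi> t)
       + (p * (2 * m1 t * \<phi>1 t + m t * \<phi>2 t) + q * (m t * \<phi>1 t)) * deriv f (\<phi> t)
       + (p * m2 t + q * m1 t + r * m t) * f (\<phi> t)"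
    by (simp only: deriv2_mult_compose[OF T S m \<phi>] distrib_left distrib_right add_ac mult_ac)
  also have "\<dots> = l * (\<phi> t * (1 - \<phi> t) * deriv (deriv f) (\<phi> t)
      + (c - (a + b + 1) * \<phi> t) * deriv f (\<phi> t) - a * b * f (\<phi> t))"
    unfolding coeff by (simp add: algebra_simps)
  also have "\<dots> = 0" using ode by (simp add: hyp_ode_def)
  finally show ?thesis .
qed

text \<open>The Koebe map carries the unit disc conformally onto the slit plane, so the hypergeometric equation
  pulls back to one whose only singularity in the disc is 0; its power series solution converges there.\<close>

definition koebe :: "complex \<Rightarrow> complex" where "koebe u = 4 * u / (1 + u)\<^sup>2"
text \<open>Since 1 - koebe u = ((1 - u) / (1 + u))^2, this solves csqrt (1 - w) = (1 - u) / (1 + u)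
  for u. The root lies in the right half plane, which the Cayley transform maps into the unit
  disc.\<close>

definition koebe_inv :: "complex \<Rightarrow> complex" where "koebe_inv w = (1 - csqrt (1 - w)) / (1 + csqrt (1 - w))"

text \<open>The principal root has non-negative real part, and a purely imaginary root would make 1
  - w a non-positive real number.\<close>

lemma Re_csqrt_slit: "w \<in> slit_plane \<Longrightarrow> Re (csqrt (1 - w)) > 0"
proof (rule ccontr)
  assume w: "w \<in> slit_plane" and "\<not> Re (csqrt (1 - w)) > 0"
  with csqrt_principal[of "1 - w"] have "Re (csqrt (1 - w)) = 0" by linarith
  hence "csqrt (1 - w) ^ 2 = - of_real (Im (csqrt (1 - w)) ^ 2)"
    by (simp add: complex_eq_iff power2_eq_square)
  hence "1 - w = of_real (- (Im (csqrt (1 - w)) ^ 2))" by simp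
  hence "1 - w \<in> \<real>\<^sub>\<le>\<^sub>0"
    by (metis nonpos_Reals_of_real_iff neg_le_0_iff_le zero_le_power2)
  thus False using w by (simp add: slit_plane_alt)
qed

lemma koebe_inv_holomorphic: "koebe_inv holomorphic_on slit_plane"
proof -
  have "1 + csqrt (1 - w) \<noteq> 0" if "w \<in> slit_plane" for w
  proof
    assume "1 + csqrt (1 - w) = 0"
    hence "Re (1 + csqrt (1 - w)) = 0" by (simp only: zero_complex.sel)
    thus False using Re_csqrt_slit[OF that] unfolding plus_complex.sel one_complex.sel by linarith
  qed
  thus ?thesis unfolding koebe_inv_def
    by (intro holomorphic_intros) (auto simp: slit_plane_alt)
qed

lemma koebe_koebe_inv:
  assumes "w \<in> slit_plane"
  shows "koebe (koebe_inv w) = w" "norm (koebe_inv w) < 1"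
proof -
  define s where "s = csqrt (1 - w)"
  have s: "Re s > 0" "s\<^sup>2 = 1 - w" using Re_csqrt_slit[OF assms] by (auto simp: s_def)
  have nz: "1 + s \<noteq> 0" using s by (auto simp: complex_eq_iff)
  have "1 + koebe_inv w = 2 / (1 + s)" using nz by (simp add: koebe_inv_def s_def [symmetric] field_simps)
  hence "koebe (koebe_inv w) = 4 * ((1 - s) / (1 + s)) / (2 / (1 + s))\<^sup>2"
    by (simp add: koebe_def koebe_inv_def s_def)
  also have "\<dots> = (1 - s) * (1 + s)"
  proof -
    have "4 * ((1 - s) / e) / (2 / e)\<^sup>2 = (1 - s) * e" if "e \<noteq> 0" for e
      using that by (simp add: power2_eq_square)
    thus ?thesis using nz by blast
  qed
  also have "\<dots> = 1 - s\<^sup>2" by (simp add: algebra_simps power2_eq_square)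
  finally show "koebe (koebe_inv w) = w" using s by simp
  \<comment> \<open>The two squares differ by 4 Re s.\<close>
  have "norm (1 - s) ^ 2 < norm (1 + s) ^ 2"
    using s by (simp add: cmod_power2) (simp add: power2_eq_square algebra_simps)
  hence "norm (1 - s) < norm (1 + s)" by (rule power_less_imp_less_base) simp
  thus "norm (koebe_inv w) < 1" using nz by (simp add: koebe_inv_def s_def [symmetric] norm_divide)
qed

lemma koebe_deriv:
  assumes "1 + u \<noteq> (0::complex)"
  shows "((\<lambda>u. 4 * u / (1 + u)\<^sup>2) has_field_derivative 4 * (1 - u) / (1 + u) ^ 3) (at u)"
  using assms
  by (auto intro!: derivative_eq_intros simp: divide_simps) (simp add: eval_nat_numeral algebra_simps)

lemma koebe_deriv2:
  assumes "1 + u \<noteq> (0::complex)"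
  shows "((\<lambda>u. 4 * (1 - u) / (1 + u) ^ 3) has_field_derivative (8 * u - 16) / (1 + u) ^ 4) (at u)"
  using assms
  by (auto intro!: derivative_eq_intros simp: divide_simps) (simp add: eval_nat_numeral algebra_simps)

text \<open>The coefficient of f''; it fixes the multiplier 4 / (1 + u)^2.\<close>

lemma koebe_coeff2:
  assumes "1 + u \<noteq> (0::complex)"
  shows "u * (1 * (4 * (1 - u) / (1 + u) ^ 3)\<^sup>2) = 4 / (1 + u)\<^sup>2 * (4 * u / (1 + u)\<^sup>2 * ((1 - u)\<^sup>2 / (1 + u)\<^sup>2))"
  using assms
  by (simp add: power_divide power_mult_distrib flip: power_mult power_add)
    (simp add: power2_eq_square algebra_simps)

text \<open>\<open>d\<close> stands for a + b + 1, and the long bracket is the pulled-back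
  coefficient of the first derivative. In it (1 + u) / (1 - u) is the multiplier over the first
  derivative of the Koebe map, and u / (1 - u) + 3 u / (1 + u) is minus u times its second
  derivative over its first. The only poles are 1 and -1, on the unit circle.\<close>

lemma koebe_coeff1:
  assumes "1 + u \<noteq> (0::complex)" "1 - u \<noteq> 0"
  shows "u * (2 * 0 * (4 * (1 - u) / (1 + u) ^ 3) + 1 * ((8 * u - 16) / (1 + u) ^ 4)) + ((c - d * (4 * u / (1 + u)\<^sup>2)) * (1 + u) / (1 - u) + u / (1 - u) + 3 * u / (1 + u)) * (1 * (4 * (1 - u) / (1 + u) ^ 3)) =
        4 / (1 + u)\<^sup>2 * (c - d * (4 * u / (1 + u)\<^sup>2))"
proof -
  define e where "e = 1 + u"
  define g where "g = 1 - u"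
  have u: "u = e - 1" "g = 2 - e" by (auto simp: e_def g_def)
  have nz: "e \<noteq> 0" "g \<noteq> 0" using assms by (auto simp: e_def g_def)
  have 1: "((c - d * (4 * u / e\<^sup>2)) * e / g + u / g + 3 * u / e) * (4 * g / e ^ 3)
    = 4 / e\<^sup>2 * (c - d * (4 * u / e\<^sup>2)) + (4 * u / e ^ 3 + 12 * u * g / e ^ 4)"
    using nz by (simp add: divide_simps eval_nat_numeral)
  have 2: "4 * u / e ^ 3 + 12 * u * g / e ^ 4 = - (u * ((8 * u - 16) / e ^ 4))"
    using nz unfolding u by (simp add: divide_simps eval_nat_numeral) (simp add: algebra_simps)
  have 3: "x + (y + - x) = y" for x y :: complex by simp
  show ?thesis
    unfolding e_def [symmetric] g_def [symmetric] mult_1_left mult_zero_right mult_zero_left add_0_left 1 2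
    by (rule 3)
qed

text \<open>Discharges the existence side of the choice in \<open>hyp2F1_def\<close>. Arguing
  through the equation puts no restriction on a and b.\<close>

lemma hyp_continuation_exists:
  assumes c: "c \<notin> \<int>\<^sub>\<le>\<^sub>0"
  shows "\<exists>F. F holomorphic_on slit_plane \<and> (\<forall>w. norm w < 1 \<longrightarrow> F w = eval_fps (hyp_fps a b c) w)"
proof -
  define f where "f = eval_fps (hyp_fps a b c)"
  have f_hol: "f holomorphic_on ball 0 1"
    unfolding f_def using hyp_fps_conv_radius_gt(1)[OF c, of _ a b]
    by (intro holomorphic_on_eval_fps) auto
  have f_exp: "f has_fps_expansion hyp_fps a b c"
    unfolding f_def using hyp_fps_conv_radius_gt[OF c]
    by (intro eval_fps_has_fps_expansion) auto
  have f_ode: "hyp_ode a b c f w" if "w \<in> ball 0 1" for w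
    using that by (intro hyp_ode_of_expansion[OF f_exp c f_hol]) auto
  \<comment> \<open>The radius only has to be small enough for the Koebe map to land in the unit
    disc, where f is given by the series: 4 |u| < 1/4 < (15/16)^2.\<close>
  define B :: "complex set" where "B = ball 0 (1 / 16)"
  have B: "1 + u \<noteq> 0" "1 - u \<noteq> 0" "koebe u \<in> ball 0 1" if "u \<in> B" for u
  proof -
    have u: "norm u < 1 / 16" using that by (simp add: B_def)
    have 1: "norm (1 + u) > 15 / 16" using norm_diff_ineq[of 1 u] u by simp
    thus "1 + u \<noteq> 0" by auto
    show "1 - u \<noteq> 0" using u by auto
    have "norm (1 + u) ^ 2 > (15 / 16) ^ 2" using 1 by (intro power_strict_mono) auto
    hence "4 * norm u < norm (1 + u) ^ 2" using u by (simp add: power2_eq_square)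
    thus "koebe u \<in> ball 0 1" using \<open>1 + u \<noteq> 0\<close> by (simp add: koebe_def norm_divide norm_mult norm_power)
  qed
  \<comment> \<open>The factor 1 is the constant \<open>m\<close> of
    \<open>ode_mult_compose\<close>.\<close>
  define H where "H = (\<lambda>u. 1 * f (koebe u))"
  have H_hol: "H holomorphic_on B"
  proof -
    have "koebe holomorphic_on B"
      unfolding koebe_def [abs_def] by (intro holomorphic_intros) (simp add: B(1))
    hence "(f \<circ> koebe) holomorphic_on B"
      using f_hol by (rule holomorphic_on_compose_gen) (use B(3) in blast)
    thus ?thesis by (simp add: H_def o_def)
  qed
  define P where "P u = (c - (a + b + 1) * (4 * u / (1 + u)\<^sup>2)) * (1 + u) / (1 - u) + u / (1 - u) + 3 * u / (1 + u)" for u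
  define Q where "Q u = - 4 * a * b / (1 + u)\<^sup>2" for u :: complex
  have nz: "1 + u \<noteq> 0" "1 - u \<noteq> 0" if "norm u < 1" for u :: complex
    using that by (auto simp: add_eq_0_iff)
  have PQ_hol: "P holomorphic_on ball 0 1" "Q holomorphic_on ball 0 1"
    unfolding P_def Q_def by (auto intro!: holomorphic_intros simp: nz)
  define h p q where "h = fps_expansion H 0" and "p = fps_expansion P 0" and "q = fps_expansion Q 0"
  have exps: "H has_fps_expansion h" "P has_fps_expansion p" "Q has_fps_expansion q"
    unfolding h_def p_def q_def
    by (rule has_fps_expansion_fps_expansion[of B] has_fps_expansion_fps_expansion[of "ball 0 1"];
        use H_hol PQ_hol in \<open>simp add: B_def\<close>)+
  have ode: "u * deriv (deriv H) u + P u * deriv H u + Q u * H u = 0" if u: "u \<in> B" for u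
    unfolding H_def
  proof (rule ode_mult_compose[where m = "\<lambda>_. 1" and \<phi> = koebe and T = B and S = "ball 0 1" and ?m1.0 = "\<lambda>_. 0" and ?m2.0 = "\<lambda>_. 0"
        and ?\<phi>1.0 = "\<lambda>u. 4 * (1 - u) / (1 + u) ^ 3"
        and ?\<phi>2.0 = "\<lambda>u. (8 * u - 16) / (1 + u) ^ 4"
        and l = "4 / (1 + u)\<^sup>2" and a = a and b = b and c = c])
    fix u assume u: "u \<in> B"
    show "(koebe has_field_derivative 4 * (1 - u) / (1 + u) ^ 3) (at u)"
      unfolding koebe_def [abs_def] by (rule koebe_deriv[OF B(1)[OF u]])
    show "((\<lambda>u. 4 * (1 - u) / (1 + u) ^ 3) has_field_derivative (8 * u - 16) / (1 + u) ^ 4) (at u)"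
      by (rule koebe_deriv2[OF B(1)[OF u]])
    show "koebe u \<in> ball 0 1" by (rule B(3)[OF u])
  next
    have e: "1 - koebe u = (1 - u)\<^sup>2 / (1 + u)\<^sup>2"
    proof -
      have "(1 + u)\<^sup>2 - 4 * u = (1 - u)\<^sup>2" by (simp add: power2_eq_square algebra_simps)
      thus ?thesis using B(1)[OF u] by (simp add: koebe_def divide_simps)
    qed
    show "u * (1 * (4 * (1 - u) / (1 + u) ^ 3)\<^sup>2) = 4 / (1 + u)\<^sup>2 * (koebe u * (1 - koebe u))"
      unfolding e unfolding koebe_def by (rule koebe_coeff2[OF B(1)[OF u]])
    show "u * (2 * 0 * (4 * (1 - u) / (1 + u) ^ 3) + 1 * ((8 * u - 16) / (1 + u) ^ 4)) + P u * (1 * (4 * (1 - u) / (1 + u) ^ 3)) =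
        4 / (1 + u)\<^sup>2 * (c - (a + b + 1) * koebe u)"
      unfolding koebe_def P_def by (rule koebe_coeff1[OF B(1,2)[OF u]])
    show "u * 0 + P u * 0 + Q u * 1 = - (4 / (1 + u)\<^sup>2) * (a * b)" by (simp add: Q_def)
    show "hyp_ode a b c f (koebe u)" by (rule f_ode[OF B(3)[OF u]])
  qed (use u f_hol in \<open>simp_all add: B_def\<close>)
  have "eventually (\<lambda>u. u \<in> B) (nhds 0)" by (intro eventually_nhds_in_open) (auto simp: B_def)
  hence "eventually (\<lambda>u. u * deriv (deriv H) u + P u * deriv H u + Q u * H u = 0) (nhds 0)"
    by eventually_elim (rule ode)
  hence h_rad: "fps_conv_radius h \<ge> 1"
    using PQ_hol exps
    by (intro frobenius_conv_radius[OF exps] holomorphic_on_imp_fps_conv_radius_ge[where f = P]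
          holomorphic_on_imp_fps_conv_radius_ge[where f = Q]) auto
  define F where "F w = eval_fps h (koebe_inv w)" for w
  have F_hol: "F holomorphic_on slit_plane"
    unfolding F_def [abs_def]
    by (intro holomorphic_on_compose_gen[OF koebe_inv_holomorphic, where t = "ball 0 1", unfolded o_def]
          holomorphic_on_eval_fps)
       (use koebe_koebe_inv less_le_trans[OF _ h_rad, of "ereal (norm _)"] in auto)
  have "koebe_inv 0 = 0" by (simp add: koebe_inv_def)
  moreover have "isCont koebe_inv 0"
    using koebe_inv_holomorphic holomorphic_on_imp_continuous_on continuous_on_eq_continuous_at
      open_slit_plane zero_in_slit_plane by blast
  ultimately have lim: "filterlim koebe_inv (nhds 0) (nhds 0)"
    by (simp add: continuous_within tendsto_nhds_iff isCont_def)
  have "eventually (\<lambda>u. u \<in> B \<and> eval_fps h u = H u) (nhds 0)"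
    using \<open>eventually (\<lambda>u. u \<in> B) (nhds 0)\<close> exps(1) by (auto simp: has_fps_expansion_def eventually_conj_iff)
  hence "eventually (\<lambda>w. koebe_inv w \<in> B \<and> eval_fps h (koebe_inv w) = H (koebe_inv w)) (nhds 0)"
    using lim by (rule eventually_compose_filterlim)
  moreover have "eventually (\<lambda>w. w \<in> ball 0 1) (nhds (0::complex))" by (intro eventually_nhds_in_open) auto
  ultimately have "eventually (\<lambda>w. F w = f w) (nhds 0)"
  proof eventually_elim
    case (elim w)
    hence "w \<in> slit_plane" using ball_subset_slit_plane by auto
    thus ?case using elim by (simp add: F_def H_def koebe_koebe_inv)
  qed
  \<comment> \<open>Agreement near 0 extends to the whole unit disc, where both functions are
    holomorphic.\<close>
  hence "(\<lambda>w. F w - f w) has_fps_expansion 0"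
    by (simp add: has_fps_expansion_0_iff)
  hence "F w - f w = 0" if "norm w < 1" for w
    using that F_hol f_hol ball_subset_slit_plane
    by (intro has_fps_expansion_0_analytic_continuation[where A = "ball 0 1" and f = "\<lambda>w. F w - f w"])
       (auto intro!: holomorphic_intros elim: holomorphic_on_subset)
  thus ?thesis using F_hol by (intro exI[of _ F]) (auto simp: f_def)
qed

lemma hyp2F1_spec:
  assumes c: "c \<notin> \<int>\<^sub>\<le>\<^sub>0"
  shows hyp2F1_holomorphic: "hyp2F1 a b c holomorphic_on slit_plane"
    and hyp2F1_eq_series: "norm w < 1 \<Longrightarrow> hyp2F1 a b c w = eval_fps (hyp_fps a b c) w"
proof -
  have *: "hyp2F1 a b c holomorphic_on slit_plane \<and> (\<forall>w. norm w < 1 \<longrightarrow> hyp2F1 a b c w = eval_fps (hyp_fps a b c) w)"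
    unfolding hyp2F1_def slit_plane_def [symmetric] by (rule someI_ex[OF hyp_continuation_exists[OF c]])
  show "hyp2F1 a b c holomorphic_on slit_plane" using * by blast
  show "norm w < 1 \<Longrightarrow> hyp2F1 a b c w = eval_fps (hyp_fps a b c) w" using * by blast
qed

lemma hyp2F1_expansion:
  assumes c: "c \<notin> \<int>\<^sub>\<le>\<^sub>0"
  shows "hyp2F1 a b c has_fps_expansion hyp_fps a b c"
proof -
  have "eventually (\<lambda>w. w \<in> ball 0 1) (nhds (0::complex))" by (intro eventually_nhds_in_open) auto
  hence "eventually (\<lambda>w. eval_fps (hyp_fps a b c) w = hyp2F1 a b c w) (nhds 0)"
    by eventually_elim (simp add: hyp2F1_eq_series[OF c])
  thus ?thesis using hyp_fps_conv_radius_gt(2)[OF c]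
    by (simp add: has_fps_expansion_def)
qed

lemma hyp2F1_0: "c \<notin> \<int>\<^sub>\<le>\<^sub>0 \<Longrightarrow> hyp2F1 a b c 0 = 1"
  by (simp add: hyp2F1_eq_series eval_fps_at_0)

lemma hyp2F1_ode:
  assumes "c \<notin> \<int>\<^sub>\<le>\<^sub>0" "w \<in> slit_plane"
  shows "hyp_ode a b c (hyp2F1 a b c) w"
  using assms by (intro hyp_ode_of_expansion[OF hyp2F1_expansion _ hyp2F1_holomorphic]) auto

text \<open>The device for recognising a transformed hypergeometric function:
  \<open>hyp_ode_unique\<close> fixes its expansion at 0, and the identity theorem carries the
  equality through \<open>S\<close>.\<close>

lemma hyp2F1_uniqueI:
  assumes c: "c \<notin> \<int>\<^sub>\<le>\<^sub>0" and f: "f holomorphic_on S" "open S" "connected S" "0 \<in> S" "S \<subseteq> slit_plane" "f 0 = 1"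
    and ode: "\<And>w. w \<in> S \<Longrightarrow> hyp_ode a b c f w" and w: "w \<in> S"
  shows "f w = hyp2F1 a b c w"
proof -
  have fe: "f has_fps_expansion fps_expansion f 0" using f by auto
  have "eventually (\<lambda>w. w \<in> S) (nhds 0)" using f by (intro eventually_nhds_in_open)
  hence "eventually (hyp_ode a b c f) (nhds 0)" by eventually_elim (rule ode)
  from hyp_ode_unique[OF fe c this f(6)] have "f has_fps_expansion hyp_fps a b c"
    using fe by simp
  from has_fps_expansion_diff[OF this hyp2F1_expansion[OF c, of a b]]
  have "(\<lambda>w. f w - hyp2F1 a b c w) has_fps_expansion 0" by simp
  hence "f w - hyp2F1 a b c w = 0"
    using f w holomorphic_on_subset[OF hyp2F1_holomorphic[OF c]]
    by (intro has_fps_expansion_0_analytic_continuation[where A = S and f = "\<lambda>w. f w - hyp2F1 a b c w"])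
       (auto intro!: holomorphic_intros)
  thus ?thesis by simp
qed

subsection \<open>Gauss's summation theorem\<close>

definition hyp_coeff :: "complex \<Rightarrow> complex \<Rightarrow> complex \<Rightarrow> nat \<Rightarrow> complex" where
  "hyp_coeff a b c n = pochhammer a n * pochhammer b n / (pochhammer c n * fact n)"

lemma hyp_coeff_eq_fps: "hyp_coeff a b c n = fps_nth (hyp_fps a b c) n"
  by (simp add: hyp_coeff_def)

text \<open>Carries the asymptotics of the coefficients: the \<open>rGamma_series\<close> factors
  converge, and the exponential is n^(a + b - c). The shift to n + 1 arises because
  \<open>rGamma_series\<close> at n has a Pochhammer symbol with n + 1 factors over the factorial of
  n.\<close>

lemma hyp_coeff_rGamma_series:
  assumes c: "c \<notin> \<int>\<^sub>\<le>\<^sub>0"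
  shows "of_nat (Suc n) * hyp_coeff a b c (Suc n) =
     rGamma_series a n * rGamma_series b n / rGamma_series c n * exp (- (c - a - b) * of_real (ln (real n)))"
proof -
  define L where "L = complex_of_real (ln (real n))"
  define F where "F = (fact n :: complex)"
  have F: "F \<noteq> 0" by (simp add: F_def)
  have e: "rGamma_series x n = pochhammer x (Suc n) / (F * exp (x * L))" for x
    by (simp add: rGamma_series_def L_def F_def)
  have pc: "pochhammer c (Suc n) \<noteq> 0" using c pochhammer_eq_0_imp_nonpos_Int by blast
  have ex: "exp (- (c - a - b) * L) = exp (a * L) * exp (b * L) / exp (c * L)"
    by (simp add: algebra_simps exp_add exp_diff)
  have fS: "fact (Suc n) = of_nat (Suc n) * F" by (simp add: F_def)
  have S: "of_nat (Suc n) \<noteq> (0::complex)" using of_nat_neq_0 by blast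
  have "of_nat (Suc n) * hyp_coeff a b c (Suc n) = pochhammer a (Suc n) * pochhammer b (Suc n) / (pochhammer c (Suc n) * F)"
    using pc F S unfolding hyp_coeff_def fS by (simp add: divide_simps del: pochhammer_Suc of_nat_Suc)
  also have "\<dots> = rGamma_series a n * rGamma_series b n / rGamma_series c n * exp (- (c - a - b) * L)"
    unfolding e ex using pc F by (simp add: divide_simps)
  finally show ?thesis unfolding L_def .
qed

lemma norm_exp_ln_of_nat: "n > 0 \<Longrightarrow> norm (exp (z * of_real (ln (real n)))) = real n powr Re z"
  by (simp add: powr_def)

lemma hyp_coeff_bound:
  assumes c: "c \<notin> \<int>\<^sub>\<le>\<^sub>0"
  obtains K where "\<And>n. n > 0 \<Longrightarrow> norm (of_nat (Suc n) * hyp_coeff a b c (Suc n)) \<le> K * real n powr (- Re (c - a - b))"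
proof -
  define R where "R n = rGamma_series a n * rGamma_series b n / rGamma_series c n" for n
  have "rGamma c \<noteq> 0" using c by (simp add: rGamma_eq_zero_iff)
  hence "R \<longlonglongrightarrow> rGamma a * rGamma b / rGamma c"
    unfolding R_def by (intro tendsto_intros)
  hence "Bseq R" by (intro convergent_imp_Bseq convergentI)
  then obtain K where K: "K > 0" "\<And>n. norm (R n) \<le> K" by (auto simp: Bseq_def)
  show thesis
  proof (rule that[of K])
    fix n :: nat assume n: "n > 0"
    have "norm (of_nat (Suc n) * hyp_coeff a b c (Suc n)) = norm (R n) * real n powr (- Re (c - a - b))"
      unfolding hyp_coeff_rGamma_series[OF c] norm_mult norm_exp_ln_of_nat[OF n] R_def by simp
    also have "\<dots> \<le> K * real n powr (- Re (c - a - b))" by (intro mult_right_mono K) auto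
    finally show "norm (of_nat (Suc n) * hyp_coeff a b c (Suc n)) \<le> K * real n powr (- Re (c - a - b))" .
  qed
qed

lemma powr_minus1_minus: "x > 0 \<Longrightarrow> x powr (- 1 - y) = x powr (- y) / (x :: real)"
  using powr_diff[of x "- y" 1] by (simp add: minus_diff_commute [of 1 y])

text \<open>Both parts come from the decay n^(-1 - Re (c - a - b)). The second is the vanishing
  boundary term of the telescoping sum behind Gauss's theorem.\<close>

lemma hyp_coeff_summable:
  assumes c: "c \<notin> \<int>\<^sub>\<le>\<^sub>0" and re: "Re (c - a - b) > 0"
  shows "summable (\<lambda>n. norm (hyp_coeff a b c n))"
    and "(\<lambda>n. of_nat n * hyp_coeff a b c n) \<longlonglongrightarrow> 0"
proof -
  obtain K where K: "\<And>n. n > 0 \<Longrightarrow> norm (of_nat (Suc n) * hyp_coeff a b c (Suc n)) \<le> K * real n powr (- Re (c - a - b))"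
    using hyp_coeff_bound[OF c] by blast
  have le: "norm (hyp_coeff a b c (Suc n)) \<le> K * real n powr (- 1 - Re (c - a - b))" if n: "n > 0" for n
  proof -
    have "real n * norm (hyp_coeff a b c (Suc n)) \<le> norm (of_nat (Suc n) * hyp_coeff a b c (Suc n))"
      by (simp only: norm_mult norm_of_nat) (intro mult_right_mono; simp)
    also note K[OF n]
    finally have "norm (hyp_coeff a b c (Suc n)) \<le> K * real n powr (- Re (c - a - b)) / real n"
      using n by (simp add: field_simps)
    also have "\<dots> = K * real n powr (- 1 - Re (c - a - b))"
      using n by (simp only: powr_minus1_minus of_nat_0_less_iff times_divide_eq_right)
    finally show ?thesis .
  qed
  have "eventually (\<lambda>n. norm (norm (hyp_coeff a b c (Suc n))) \<le> K * real n powr (- 1 - Re (c - a - b))) sequentially"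
    using eventually_gt_at_top[of 0] by eventually_elim (simp only: real_norm_def abs_norm_cancel le)
  moreover have "summable (\<lambda>n. K * real n powr (- 1 - Re (c - a - b)))"
    using re by (intro summable_mult) (simp add: summable_real_powr_iff)
  ultimately have "summable (\<lambda>n. norm (hyp_coeff a b c (Suc n)))"
    by (rule summable_comparison_test_ev)
  thus "summable (\<lambda>n. norm (hyp_coeff a b c n))" by (subst (asm) summable_Suc_iff)
  have "(\<lambda>n. K * real n powr (- Re (c - a - b))) \<longlonglongrightarrow> K * 0"
    using re by (intro tendsto_mult tendsto_const tendsto_neg_powr filterlim_real_sequentially) auto
  hence lim: "(\<lambda>n. K * real n powr (- Re (c - a - b))) \<longlonglongrightarrow> 0" by (simp only: mult_zero_right)
  have "eventually (\<lambda>n. norm (of_nat (Suc n) * hyp_coeff a b c (Suc n)) \<le> K * real n powr (- Re (c - a - b))) sequentially"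
    using eventually_gt_at_top[of 0] by eventually_elim (rule K)
  from this lim have "(\<lambda>n. of_nat (Suc n) * hyp_coeff a b c (Suc n)) \<longlonglongrightarrow> 0"
    by (rule Lim_null_comparison)
  thus "(\<lambda>n. of_nat n * hyp_coeff a b c n) \<longlonglongrightarrow> 0" by (rule LIMSEQ_imp_Suc)
qed

lemma hyp_coeff_Suc:
  assumes "c \<notin> \<int>\<^sub>\<le>\<^sub>0"
  shows "of_nat (Suc n) * (c + of_nat n) * hyp_coeff a b c (Suc n) = (a + of_nat n) * (b + of_nat n) * hyp_coeff a b c n"
  using hyp_fps_Suc[OF assms] by (simp only: hyp_coeff_eq_fps)

lemma plus_of_nat_notin_nonpos_Ints: "(c :: complex) \<notin> \<int>\<^sub>\<le>\<^sub>0 \<Longrightarrow> c + of_nat n \<notin> \<int>\<^sub>\<le>\<^sub>0"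
  by (metis add_diff_cancel_right' nonpos_Ints_diff_Nats of_nat_in_Nats)

lemma hyp_coeff_c_plus1:
  assumes c: "c \<notin> \<int>\<^sub>\<le>\<^sub>0"
  shows "(c + of_nat n) * hyp_coeff a b (c + 1) n = c * hyp_coeff a b c n"
proof -
  have "pochhammer c (Suc n) \<noteq> 0" using c pochhammer_eq_0_imp_nonpos_Int by blast
  moreover have "pochhammer c (Suc n) = c * pochhammer (c + 1) n" by (rule pochhammer_rec)
  moreover have "pochhammer c (Suc n) = (c + of_nat n) * pochhammer c n" by (rule pochhammer_rec')
  ultimately have "c \<noteq> 0" "pochhammer (c + 1) n \<noteq> 0" "pochhammer c n \<noteq> 0"
    "c * pochhammer (c + 1) n = (c + of_nat n) * pochhammer c n" by auto
  thus ?thesis by (simp add: hyp_coeff_def divide_simps)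
qed

definition gauss_sum :: "complex \<Rightarrow> complex \<Rightarrow> complex \<Rightarrow> complex" where
  "gauss_sum a b c = (\<Sum>n. hyp_coeff a b c n)"

lemma hyp_coeff_sums_gauss_sum:
  assumes "c \<notin> \<int>\<^sub>\<le>\<^sub>0" "Re (c - a - b) > 0"
  shows "hyp_coeff a b c sums gauss_sum a b c"
  unfolding gauss_sum_def
  by (rule summable_sums, rule summable_norm_cancel, rule hyp_coeff_summable(1)[OF assms])

text \<open>The difference of the two sides telescopes with antidifference \<open>n * hyp_coeff a b c n\<close>.\<close>

lemma gauss_sum_c_plus1:
  assumes c: "c \<notin> \<int>\<^sub>\<le>\<^sub>0" and re: "Re (c - a - b) > 0"
  shows "c * (c - a - b) * gauss_sum a b c = (c - a) * (c - b) * gauss_sum a b (c + 1)"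
proof -
  have c1: "c + 1 \<notin> \<int>\<^sub>\<le>\<^sub>0" using plus_of_nat_notin_nonpos_Ints[OF c, of 1] by simp
  have "hyp_coeff a b c sums gauss_sum a b c"
    by (rule hyp_coeff_sums_gauss_sum[OF c re])
  moreover have "hyp_coeff a b (c + 1) sums gauss_sum a b (c + 1)"
    using re by (intro hyp_coeff_sums_gauss_sum[OF c1]) simp
  ultimately have "(\<lambda>n. c * (c - a - b) * hyp_coeff a b c n - (c - a) * (c - b) * hyp_coeff a b (c + 1) n)
      sums (c * (c - a - b) * gauss_sum a b c - (c - a) * (c - b) * gauss_sum a b (c + 1))"
    by (intro sums_diff sums_mult)
  moreover have "(\<lambda>n. - c * (of_nat (Suc n) * hyp_coeff a b c (Suc n) - of_nat n * hyp_coeff a b c n))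
      sums (- c * (0 - of_nat 0 * hyp_coeff a b c 0))"
    using hyp_coeff_summable(2)[OF c re] by (intro sums_mult telescope_sums)
  moreover have "c * (c - a - b) * hyp_coeff a b c n - (c - a) * (c - b) * hyp_coeff a b (c + 1) n
      = - c * (of_nat (Suc n) * hyp_coeff a b c (Suc n) - of_nat n * hyp_coeff a b c n)" for n
  proof -
    have nz: "c + of_nat n \<noteq> 0" by (rule add_of_nat_nonzero[OF c])
    have "(c + of_nat n) * (c * (c - a - b) * hyp_coeff a b c n - (c - a) * (c - b) * hyp_coeff a b (c + 1) n)
       = c * (c - a - b) * (c + of_nat n) * hyp_coeff a b c n - (c - a) * (c - b) * ((c + of_nat n) * hyp_coeff a b (c + 1) n)"
      by (simp add: algebra_simps)
    also have "\<dots> = - c * ((a + of_nat n) * (b + of_nat n) * hyp_coeff a b c n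
        - (c + of_nat n) * of_nat n * hyp_coeff a b c n)"
      unfolding hyp_coeff_c_plus1[OF c] by (simp add: algebra_simps)
    also have "\<dots> = (c + of_nat n) * (- c * (of_nat (Suc n) * hyp_coeff a b c (Suc n) - of_nat n * hyp_coeff a b c n))"
      unfolding hyp_coeff_Suc[OF c, symmetric] by (simp add: algebra_simps)
    finally show ?thesis using nz by (simp only: mult_cancel_left simp_thms if_False)
  qed
  ultimately have "c * (c - a - b) * gauss_sum a b c - (c - a) * (c - b) * gauss_sum a b (c + 1)
      = - c * (0 - of_nat 0 * hyp_coeff a b c 0)"
    using sums_unique2 by force
  thus ?thesis by simp
qed

lemma gauss_sum_c_plus:
  assumes c: "c \<notin> \<int>\<^sub>\<le>\<^sub>0" and re: "Re (c - a - b) > 0"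
  shows "pochhammer c n * pochhammer (c - a - b) n * gauss_sum a b c =
           pochhammer (c - a) n * pochhammer (c - b) n * gauss_sum a b (c + of_nat n)"
proof (induction n)
  case (Suc n)
  have *: "(c + of_nat n) * (c + of_nat n - a - b) * gauss_sum a b (c + of_nat n) =
      (c + of_nat n - a) * (c + of_nat n - b) * gauss_sum a b (c + of_nat n + 1)"
    using re by (intro gauss_sum_c_plus1 plus_of_nat_notin_nonpos_Ints c) simp
  have "pochhammer c (Suc n) * pochhammer (c - a - b) (Suc n) * gauss_sum a b c
     = (c + of_nat n) * (c + of_nat n - a - b) * (pochhammer c n * pochhammer (c - a - b) n * gauss_sum a b c)"
    by (simp add: pochhammer_rec' algebra_simps)
  also have "\<dots> = pochhammer (c - a) n * pochhammer (c - b) n * ((c + of_nat n) * (c + of_nat n - a - b) * gauss_sum a b (c + of_nat n))"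
    unfolding Suc by (simp only: mult_ac)
  also have "\<dots> = pochhammer (c - a) (Suc n) * pochhammer (c - b) (Suc n) * gauss_sum a b (c + of_nat n + 1)"
    unfolding * by (simp add: pochhammer_rec' algebra_simps)
  finally show ?case by (simp add: add_ac)
qed auto

text \<open>Tannery's theorem: every coefficient with k >= 1 has the growing parameter in its
  denominator and tends to 0, which leaves the constant term 1.\<close>

lemma gauss_sum_tendsto_1:
  assumes c: "c \<notin> \<int>\<^sub>\<le>\<^sub>0" and re: "Re (c - a - b) > 0"
  shows "(\<lambda>m. gauss_sum a b (c + of_nat m)) \<longlonglongrightarrow> 1"
proof -
  \<comment> \<open>For Re d >= 0, adding m to d does not decrease the modulus of any factor of the
    Pochhammer symbol, so the coefficients at d dominate those at d + m.\<close>
  obtain M :: nat where M: "real M \<ge> - Re c" using real_arch_simple by blast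
  define d where "d = c + of_nat M"
  have d: "d \<notin> \<int>\<^sub>\<le>\<^sub>0" "Re (d - a - b) > 0" "Re d \<ge> 0"
    using M re by (auto simp: d_def intro!: plus_of_nat_notin_nonpos_Ints c)
  have dm: "d + of_nat m \<notin> \<int>\<^sub>\<le>\<^sub>0" for m by (intro plus_of_nat_notin_nonpos_Ints d)
  have "(\<lambda>m. \<Sum>k. hyp_coeff a b (d + of_nat m) k) \<longlonglongrightarrow> (\<Sum>k. if k = 0 then 1 else 0)"
  proof (rule tannerys_theorem[where M = "\<lambda>k. norm (hyp_coeff a b d k)", THEN conjunct2, THEN conjunct2])
    fix k
    show "(\<lambda>m. hyp_coeff a b (d + of_nat m) k) \<longlonglongrightarrow> (if k = 0 then 1 else 0)"
    proof (cases k)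
      case (Suc j)
      have "(\<lambda>m. 1 / pochhammer (d + of_nat m) k) \<longlonglongrightarrow> 0"
        unfolding Suc
      proof (induction j)
        case 0
        have "filterlim (\<lambda>m. d + of_nat m) at_infinity sequentially"
          by (intro tendsto_add_filterlim_at_infinity[of _ d] tendsto_const tendsto_of_nat)
        thus ?case by (auto intro!: tendsto_divide_0[OF tendsto_const])
      next
        case (Suc j)
        have "filterlim (\<lambda>m. (d + of_nat (Suc j)) + of_nat m) at_infinity sequentially"
          by (intro tendsto_add_filterlim_at_infinity[of _ "d + of_nat (Suc j)"] tendsto_const tendsto_of_nat)
        hence "(\<lambda>m. 1 / ((d + of_nat (Suc j)) + of_nat m)) \<longlonglongrightarrow> 0"
          by (intro tendsto_divide_0[OF tendsto_const])
        from tendsto_mult[OF this Suc] show ?case by (simp add: pochhammer_rec' add_ac)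
      qed
      hence "(\<lambda>m. (pochhammer a k * pochhammer b k / fact k) * (1 / pochhammer (d + of_nat m) k)) \<longlonglongrightarrow> (pochhammer a k * pochhammer b k / fact k) * 0"
        by (intro tendsto_mult tendsto_const)
      thus ?thesis using Suc by (simp add: hyp_coeff_def mult_ac)
    qed (simp add: hyp_coeff_def)
  next
    have "norm (hyp_coeff a b (d + of_nat m) k) \<le> norm (hyp_coeff a b d k)" for m k
    proof -
      have "norm (pochhammer d k) \<le> norm (pochhammer (d + of_nat m) k)"
        unfolding pochhammer_prod prod_norm [symmetric]
      proof (intro prod_mono conjI norm_ge_zero)
        fix i
        have "norm (d + of_nat i) ^ 2 \<le> norm (d + of_nat m + of_nat i) ^ 2"
          using d(3) by (simp add: cmod_power2)
        thus "norm (d + of_nat i) \<le> norm (d + of_nat m + of_nat i)"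
          by (rule power2_le_imp_le) simp
      qed
      moreover have "norm (pochhammer d k) > 0"
        using d(1) pochhammer_eq_0_imp_nonpos_Int by auto
      ultimately show ?thesis unfolding hyp_coeff_def norm_divide norm_mult
        by (intro divide_left_mono mult_right_mono mult_pos_pos mult_nonneg_nonneg) auto
    qed
    thus "\<forall>\<^sub>F (k, m) in sequentially \<times>\<^sub>F sequentially. norm (hyp_coeff a b (d + of_nat m) k) \<le> norm (hyp_coeff a b d k)"
      by (intro always_eventually) auto
  qed (use hyp_coeff_summable(1)[OF d(1,2)] in auto)
  also have "(\<Sum>k. if k = 0 then 1 else 0 :: complex) = 1"
    by (subst suminf_finite[of "{0}"]) auto
  finally have "(\<lambda>m. gauss_sum a b (c + of_nat (m + M))) \<longlonglongrightarrow> 1"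
    by (simp add: gauss_sum_def d_def add_ac)
  thus ?thesis by (rule LIMSEQ_offset)
qed

text \<open>The contiguous relation is applied n + 1 times and n tends to infinity. The Pochhammer
  products become \<open>rGamma_series\<close>; their factorials and exponentials match on the two
  sides because c + (c - a - b) = (c - a) + (c - b).\<close>

theorem gauss_sum_eq:
  assumes c: "c \<notin> \<int>\<^sub>\<le>\<^sub>0" and re: "Re (c - a - b) > 0"
  shows "gauss_sum a b c = Gamma c * Gamma (c - a - b) * rGamma (c - a) * rGamma (c - b)"
proof -
  have d: "c - a - b \<notin> \<int>\<^sub>\<le>\<^sub>0"
  proof
    assume "c - a - b \<in> \<int>\<^sub>\<le>\<^sub>0"
    then obtain n where "c - a - b = of_int n" "n \<le> 0" by (rule nonpos_Ints_cases)
    thus False using re by (simp only: complex_Re_of_int)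
  qed
  have "rGamma_series c n * rGamma_series (c - a - b) n * gauss_sum a b c =
        rGamma_series (c - a) n * rGamma_series (c - b) n * gauss_sum a b (c + of_nat (Suc n))" for n
  proof -
    define L where "L = complex_of_real (ln (real n))"
    define F where "F = (fact n :: complex)"
    have e: "rGamma_series x n = pochhammer x (Suc n) / (F * exp (x * L))" for x
      by (simp add: rGamma_series_def L_def F_def)
    have x: "exp (c * L) * exp ((c - a - b) * L) = exp ((c - a) * L) * exp ((c - b) * L)"
      by (simp flip: exp_add add: algebra_simps)
    have "rGamma_series c n * rGamma_series (c - a - b) n * gauss_sum a b c =
       (pochhammer c (Suc n) * pochhammer (c - a - b) (Suc n) * gauss_sum a b c) / (F * F * (exp (c * L) * exp ((c - a - b) * L)))"
      unfolding e by (simp add: mult_ac)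
    also have "\<dots> = (pochhammer (c - a) (Suc n) * pochhammer (c - b) (Suc n) * gauss_sum a b (c + of_nat (Suc n)))
         / (F * F * (exp ((c - a) * L) * exp ((c - b) * L)))"
      unfolding gauss_sum_c_plus[OF c re] x ..
    also have "\<dots> = rGamma_series (c - a) n * rGamma_series (c - b) n * gauss_sum a b (c + of_nat (Suc n))"
      unfolding e by (simp add: mult_ac)
    finally show ?thesis .
  qed
  moreover have "(\<lambda>n. rGamma_series c n * rGamma_series (c - a - b) n * gauss_sum a b c)
     \<longlonglongrightarrow> rGamma c * rGamma (c - a - b) * gauss_sum a b c" by (intro tendsto_intros)
  moreover have "(\<lambda>n. rGamma_series (c - a) n * rGamma_series (c - b) n * gauss_sum a b (c + of_nat (Suc n)))
     \<longlonglongrightarrow> rGamma (c - a) * rGamma (c - b) * 1"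
    by (intro tendsto_intros LIMSEQ_Suc[OF gauss_sum_tendsto_1[OF c re]])
  ultimately have "rGamma c * rGamma (c - a - b) * gauss_sum a b c = rGamma (c - a) * rGamma (c - b) * 1"
    using LIMSEQ_unique by fastforce
  thus ?thesis using c d
    by (simp add: Gamma_def rGamma_eq_zero_iff field_simps)
qed

text \<open>The coefficients are absolutely summable, so they dominate the series on (0, 1) and
  Tannery's theorem gives the radial limit.\<close>

lemma hyp2F1_tendsto_gauss_sum:
  assumes c: "c \<notin> \<int>\<^sub>\<le>\<^sub>0" and re: "Re (c - a - b) > 0"
  shows "((\<lambda>x. hyp2F1 a b c (of_real x)) \<longlongrightarrow> gauss_sum a b c) (at_left 1)"
proof -
  have "((\<lambda>x. \<Sum>k. hyp_coeff a b c k * of_real x ^ k) \<longlongrightarrow> (\<Sum>k. hyp_coeff a b c k)) (at_left 1)"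
  proof (rule tannerys_theorem[where M = "\<lambda>k. norm (hyp_coeff a b c k)", THEN conjunct2, THEN conjunct2])
    fix k
    have "((\<lambda>x::real. hyp_coeff a b c k * of_real x ^ k) \<longlongrightarrow> hyp_coeff a b c k * of_real 1 ^ k) (at_left 1)"
      by (intro tendsto_intros)
    thus "((\<lambda>x::real. hyp_coeff a b c k * of_real x ^ k) \<longlongrightarrow> hyp_coeff a b c k) (at_left 1)" by simp
  next
    have "eventually (\<lambda>x::real. x \<in> {0<..<1}) (at_left 1)"
      by (rule eventually_at_leftI[of 0]) auto
    hence "eventually (\<lambda>(k, x::real). x \<in> {0<..<1}) (sequentially \<times>\<^sub>F at_left 1)"
      by (intro eventually_prod2[THEN iffD2]) auto
    thus "\<forall>\<^sub>F (k, x::real) in sequentially \<times>\<^sub>F at_left 1. norm (hyp_coeff a b c k * of_real x ^ k) \<le> norm (hyp_coeff a b c k)"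
      by eventually_elim (auto simp: norm_mult norm_power power_le_one intro!: mult_left_le)
  qed (use hyp_coeff_summable(1)[OF c re] in auto)
  moreover have "eventually (\<lambda>x::real. x \<in> {0<..<1}) (at_left 1)"
    by (rule eventually_at_leftI[of 0]) auto
  hence "eventually (\<lambda>x. (\<Sum>k. hyp_coeff a b c k * of_real x ^ k) = hyp2F1 a b c (of_real x)) (at_left 1)"
    by eventually_elim (simp add: hyp2F1_eq_series[OF c] eval_fps_def hyp_coeff_eq_fps)
  ultimately show ?thesis unfolding gauss_sum_def by (rule Lim_transform_eventually)
qed

subsection \<open>Pfaff's transformation\<close>

text \<open>The derivative keeps the same power and divides by 1 - t instead of shifting the
  exponent: the power is then a common factor in the conditions of \<open>ode_mult_compose\<close>,
  and the rest is rational.\<close>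

lemma powr_one_minus_deriv:
  fixes s t :: complex
  assumes "1 - t \<notin> \<real>\<^sub>\<le>\<^sub>0"
  shows "((\<lambda>t. (1 - t) powr (- s)) has_field_derivative s * ((1 - t) powr (- s)) / (1 - t)) (at t)"
proof -
  have "(1 - t) powr (- s - 1) = (1 - t) powr (- s) / (1 - t)"
    using assms by (subst powr_diff) auto
  thus ?thesis using assms by (auto intro!: derivative_eq_intros)
qed

lemma powr_one_minus_deriv2:
  fixes s t :: complex
  assumes "1 - t \<notin> \<real>\<^sub>\<le>\<^sub>0"
  shows "((\<lambda>t. s * ((1 - t) powr (- s)) / (1 - t)) has_field_derivative
      s * (s + 1) * ((1 - t) powr (- s)) / (1 - t)\<^sup>2) (at t)"
proof -
  have nz: "1 - t \<noteq> 0" using assms by auto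
  have "((\<lambda>t. s * ((1 - t) powr (- s)) / (1 - t)) has_field_derivative
     (s * (s * ((1 - t) powr (- s)) / (1 - t)) * (1 - t) - s * ((1 - t) powr (- s)) * (-1)) / ((1 - t) * (1 - t))) (at t)"
    using nz by (intro DERIV_divide DERIV_cmult powr_one_minus_deriv assms) (auto intro!: derivative_eq_intros)
  also have "(s * (s * ((1 - t) powr (- s)) / (1 - t)) * (1 - t) - s * ((1 - t) powr (- s)) * (-1)) / ((1 - t) * (1 - t))
     = s * (s + 1) * ((1 - t) powr (- s)) / (1 - t)\<^sup>2"
  proof -
    have "(s * (s * m / d) * d - s * m * (-1)) / (d * d) = s * (s + 1) * m / d\<^sup>2" if "d \<noteq> 0" for d m
      using that by (simp add: power2_eq_square algebra_simps)
    thus ?thesis using nz by blast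
  qed
  finally show ?thesis .
qed

text \<open>The involution w / (w - 1) preserves the slit plane because 1 - w / (w - 1) = 1 / (1 -
  w). The left side is therefore holomorphic there, equals 1 at 0 and solves the equation of the
  right side.\<close>

theorem pfaff:
  assumes c: "c \<notin> \<int>\<^sub>\<le>\<^sub>0" and w: "w \<in> slit_plane"
  shows "(1 - w) powr (- b) * hyp2F1 (c - a) b c (w / (w - 1)) = hyp2F1 a b c w"
proof (rule hyp2F1_uniqueI[where S = slit_plane])
  let ?F = "hyp2F1 (c - a) b c"
  have nz: "1 - w \<noteq> 0" if "w \<in> slit_plane" for w using that by (auto simp: slit_plane_alt)
  have nz': "w - 1 \<noteq> 0" if "w \<in> slit_plane" for w using nz[OF that] by auto
  have map: "w / (w - 1) \<in> slit_plane" if w: "w \<in> slit_plane" for w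
  proof -
    have "1 - w / (w - 1) = inverse (1 - w)" using nz[OF w] nz'[OF w] by (simp add: field_simps)
    thus ?thesis using w by (simp add: slit_plane_alt)
  qed
  have F: "?F holomorphic_on slit_plane" by (rule hyp2F1_holomorphic[OF c])
  have "(\<lambda>w. w / (w - 1)) holomorphic_on slit_plane"
    by (intro holomorphic_intros nz')
  hence "(?F \<circ> (\<lambda>w. w / (w - 1))) holomorphic_on slit_plane"
    using F by (rule holomorphic_on_compose_gen) (use map in auto)
  thus "(\<lambda>w. (1 - w) powr (- b) * ?F (w / (w - 1))) holomorphic_on slit_plane"
    by (intro holomorphic_intros) (auto simp: slit_plane_alt o_def)
  show "(1 - 0) powr (- b) * ?F (0 / (0 - 1)) = 1" by (simp add: hyp2F1_0[OF c])
  fix w assume w: "w \<in> slit_plane"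
  note nzw = nz[OF w] nz'[OF w]
  define d where "d = 1 - w"
  define m where "m = d powr (- b)"
  have d: "d \<noteq> 0" "w - 1 = - d" "w = 1 - d" using nzw by (auto simp: d_def)
  have "w * (1 - w) * deriv (deriv (\<lambda>w. (1 - w) powr (- b) * ?F (w / (w - 1)))) w
      + (c - (a + b + 1) * w) * deriv (\<lambda>w. (1 - w) powr (- b) * ?F (w / (w - 1))) w
      + (- (a * b)) * ((1 - w) powr (- b) * ?F (w / (w - 1))) = 0"
  proof (rule ode_mult_compose[where m = "\<lambda>w. (1 - w) powr (- b)" and \<phi> = "\<lambda>w. w / (w - 1)"
     and T = slit_plane and S = slit_plane and l = "- ((1 - w) powr (- b)) / (1 - w)"
     and ?\<phi>1.0 = "\<lambda>w. - 1 / (w - 1)\<^sup>2" and ?\<phi>2.0 = "\<lambda>w. 2 / (w - 1) ^ 3"])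
    fix w assume w: "w \<in> slit_plane"
    show "((\<lambda>t. (1 - t) powr (- b)) has_field_derivative b * ((1 - w) powr (- b)) / (1 - w)) (at w)"
      using w by (intro powr_one_minus_deriv) (simp add: slit_plane_alt)
    show "((\<lambda>t. b * ((1 - t) powr (- b)) / (1 - t)) has_field_derivative
      b * (b + 1) * ((1 - w) powr (- b)) / (1 - w)\<^sup>2) (at w)"
      using w by (intro powr_one_minus_deriv2) (simp add: slit_plane_alt)
    show "((\<lambda>w. w / (w - 1)) has_field_derivative - 1 / (w - 1)\<^sup>2) (at w)"
      using nz'[OF w] by (auto intro!: derivative_eq_intros simp: power2_eq_square divide_simps)
    show "((\<lambda>w. - 1 / (w - 1)\<^sup>2) has_field_derivative 2 / (w - 1) ^ 3) (at w)"
      using nz'[OF w] by (auto intro!: derivative_eq_intros simp: divide_simps) (simp add: eval_nat_numeral algebra_simps)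
    show "w / (w - 1) \<in> slit_plane" by (rule map[OF w])
  next
    show "hyp_ode (c - a) b c ?F (w / (w - 1))" by (intro hyp2F1_ode c map w)
    show "w * (1 - w) * ((1 - w) powr (- b) * (- 1 / (w - 1)\<^sup>2)\<^sup>2) =
      - ((1 - w) powr (- b)) / (1 - w) * (w / (w - 1) * (1 - w / (w - 1)))"
      unfolding d_def [symmetric] m_def [symmetric] d(2)
      using d(1) by (simp add: d(3) divide_simps; simp add: eval_nat_numeral)
    show "w * (1 - w) * (2 * (b * ((1 - w) powr (- b)) / (1 - w)) * (- 1 / (w - 1)\<^sup>2) + (1 - w) powr (- b) * (2 / (w - 1) ^ 3))
      + (c - (a + b + 1) * w) * ((1 - w) powr (- b) * (- 1 / (w - 1)\<^sup>2)) =
      - ((1 - w) powr (- b)) / (1 - w) * (c - (c - a + b + 1) * (w / (w - 1)))"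
      unfolding d_def [symmetric] m_def [symmetric] d(2)
      using d(1) by (simp add: d(3) divide_simps eval_nat_numeral; simp add: algebra_simps)
    show "w * (1 - w) * (b * (b + 1) * ((1 - w) powr (- b)) / (1 - w)\<^sup>2)
      + (c - (a + b + 1) * w) * (b * ((1 - w) powr (- b)) / (1 - w)) + - (a * b) * ((1 - w) powr (- b)) =
      - (- ((1 - w) powr (- b)) / (1 - w)) * ((c - a) * b)"
      unfolding d_def [symmetric] m_def [symmetric] d(2)
      using d(1) by (simp add: d(3) divide_simps eval_nat_numeral; simp add: algebra_simps)
  qed (use w F in auto)
  thus "hyp_ode a b c (\<lambda>w. (1 - w) powr (- b) * ?F (w / (w - 1))) w" by (simp add: hyp_ode_def algebra_simps)
qed (use c w in auto)

subsection \<open>Quadratic transformation\<close>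

lemma deriv2_lincomb:
  fixes f g :: "complex \<Rightarrow> complex"
  assumes S: "open S" "t \<in> S" and f: "f holomorphic_on S" and g: "g holomorphic_on S"
  shows "deriv (\<lambda>t. A * f t + B * g t) t = A * deriv f t + B * deriv g t"
    and "deriv (deriv (\<lambda>t. A * f t + B * g t)) t = A * deriv (deriv f) t + B * deriv (deriv g) t"
proof -
  have 1: "((\<lambda>t. A * f t + B * g t) has_field_derivative A * deriv f t + B * deriv g t) (at t)" if "t \<in> S" for t
    using holomorphic_derivI[OF f S(1) that] holomorphic_derivI[OF g S(1) that]
    by (intro DERIV_add DERIV_cmult)
  have 2: "((\<lambda>t. A * deriv f t + B * deriv g t) has_field_derivative A * deriv (deriv f) t + B * deriv (deriv g) t) (at t)"
    if "t \<in> S" for t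
    using holomorphic_derivI[OF holomorphic_deriv[OF f S(1)] S(1) that]
      holomorphic_derivI[OF holomorphic_deriv[OF g S(1)] S(1) that]
    by (intro DERIV_add DERIV_cmult)
  show "deriv (\<lambda>t. A * f t + B * g t) t = A * deriv f t + B * deriv g t"
    and "deriv (deriv (\<lambda>t. A * f t + B * g t)) t = A * deriv (deriv f) t + B * deriv (deriv g) t"
    using deriv2_eqI[OF S 1 2] by auto
qed

lemma ode_lincomb:
  fixes f g :: "complex \<Rightarrow> complex"
  assumes S: "open S" "t \<in> S" and f: "f holomorphic_on S" and g: "g holomorphic_on S"
    and "p * deriv (deriv f) t + q * deriv f t + r * f t = 0"
    and "p * deriv (deriv g) t + q * deriv g t + r * g t = 0"
  shows "p * deriv (deriv (\<lambda>t. A * f t + B * g t)) t + q * deriv (\<lambda>t. A * f t + B * g t) t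
     + r * (A * f t + B * g t) = 0"
proof -
  have "p * deriv (deriv (\<lambda>t. A * f t + B * g t)) t + q * deriv (\<lambda>t. A * f t + B * g t) t + r * (A * f t + B * g t)
    = A * (p * deriv (deriv f) t + q * deriv f t + r * f t) + B * (p * deriv (deriv g) t + q * deriv g t + r * g t)"
    unfolding deriv2_lincomb[OF S f g] by (simp add: algebra_simps)
  thus ?thesis using assms(5,6) by simp
qed

text \<open>Translating \<open>z0\<close> to 0 and multiplying by u puts a regular point into the
  singular form. Both coefficient functions then vanish at 0, so p_0 = 0, the recurrence degenerates
  only at n = 0, and value and derivative are the free data.\<close>

lemma ode_regular_unique:
  fixes y p q :: "complex \<Rightarrow> complex"
  assumes S: "open S" "connected S" and hol: "y holomorphic_on S" "p holomorphic_on S" "q holomorphic_on S"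
    and ode: "\<And>z. z \<in> S \<Longrightarrow> deriv (deriv y) z = p z * deriv y z + q z * y z"
    and z0: "z0 \<in> S" "y z0 = 0" "deriv y z0 = 0" and z: "z \<in> S"
  shows "y z = 0"
proof -
  define S' where "S' = (+) (- z0) ` S"
  have S': "open S'" "connected S'" "0 \<in> S'"
  proof -
    show "open S'" unfolding S'_def by (rule open_translation[OF S(1)])
    show "connected S'" unfolding S'_def by (intro connected_continuous_image continuous_intros S(2))
    show "0 \<in> S'" unfolding S'_def using z0(1) by (intro image_eqI[of _ _ z0]) simp_all
  qed
  have shift: "z0 + u \<in> S" if "u \<in> S'" for u using that by (auto simp: S'_def)
  define H where "H = (\<lambda>u. 1 * y (z0 + u))"
  define P Q where "P = (\<lambda>u. - u * p (z0 + u))" and "Q = (\<lambda>u. - u * q (z0 + u))"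
  have comp: "(\<lambda>u. f (z0 + u)) holomorphic_on S'" if "f holomorphic_on S" for f
  proof -
    have "(f \<circ> (\<lambda>u. z0 + u)) holomorphic_on S'"
      by (rule holomorphic_on_compose_gen[OF _ that]) (auto intro!: holomorphic_intros shift)
    thus ?thesis by (simp add: o_def)
  qed
  have hol': "H holomorphic_on S'" "P holomorphic_on S'" "Q holomorphic_on S'"
    unfolding H_def P_def Q_def by (intro holomorphic_intros comp hol)+
  have d: "deriv H u = deriv y (z0 + u)" "deriv (deriv H) u = deriv (deriv y) (z0 + u)" if u: "u \<in> S'" for u
  proof -
    have "((+) z0 has_field_derivative 1) (at t)" for t by (auto intro!: derivative_eq_intros)
    thus "deriv H u = deriv y (z0 + u)" "deriv (deriv H) u = deriv (deriv y) (z0 + u)"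
      using deriv2_mult_compose[OF S'(1) u S(1) hol(1), of "\<lambda>u. z0 + u" "\<lambda>_. 1" "\<lambda>_. 0" "\<lambda>_. 0" "\<lambda>_. 1" "\<lambda>_. 0"] shift
      by (auto simp: H_def)
  qed
  have H_app: "H u = y (z0 + u)" for u by (simp add: H_def)
  have ev: "eventually (\<lambda>u. u * deriv (deriv H) u + P u * deriv H u + Q u * H u = 0) (nhds 0)"
    using eventually_nhds_in_open[OF S'(1,3)]
  proof eventually_elim
    case (elim u)
    have "u * deriv (deriv H) u + P u * deriv H u + Q u * H u
        = u * (deriv (deriv y) (z0 + u) - (p (z0 + u) * deriv y (z0 + u) + q (z0 + u) * y (z0 + u)))"
      by (simp add: d[OF elim] P_def Q_def H_app algebra_simps)
    thus ?case by (simp add: ode[OF shift[OF elim]])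
  qed
  have e: "H has_fps_expansion fps_expansion H 0" "P has_fps_expansion fps_expansion P 0"
      "Q has_fps_expansion fps_expansion Q 0"
    using S' hol' by (auto intro: has_fps_expansion_fps_expansion)
  have "fps_expansion H 0 = 0"
  proof (rule frobenius_unique[OF e ev, of 1])
    have "fps_nth (fps_expansion P 0) 0 = 0"
      using has_fps_expansion_imp_0_eq_fps_nth_0[OF e(2)] by (simp add: P_def)
    thus "of_nat n + fps_nth (fps_expansion P 0) 0 \<noteq> 0" if "n \<ge> 1" for n using that by simp
    fix k :: nat assume "k \<le> 1"
    hence "k = 0 \<or> k = 1" by auto
    thus "fps_nth (fps_expansion H 0) k = 0"
      using z0 d(1)[OF S'(3)] fps_nth_fps_expansion[OF e(1), of k] by (auto simp: H_app)
  qed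
  hence "H has_fps_expansion 0" using e(1) by simp
  hence "H (z - z0) = 0"
    using S' hol' z by (intro has_fps_expansion_0_analytic_continuation[of H S']) (auto simp: S'_def)
  thus ?thesis by (simp add: H_def)
qed

section \<open>Geometry of the doubly cut plane\<close>

definition double_slit_plane :: "complex set" where
  "double_slit_plane = - complex_of_real ` ({..-1} \<union> {1..})"

lemma double_slit_plane_iff: "z \<in> double_slit_plane \<longleftrightarrow> Im z \<noteq> 0 \<or> (-1 < Re z \<and> Re z < 1)"
proof -
  have "z \<in> complex_of_real ` ({..-1} \<union> {1..}) \<longleftrightarrow> Im z = 0 \<and> (Re z \<le> -1 \<or> Re z \<ge> 1)"
    by (auto simp: complex_eq_iff intro!: image_eqI[of _ _ "Re z"])
  thus ?thesis by (auto simp: double_slit_plane_def)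
qed

lemma double_slit_plane_alt: "z \<in> double_slit_plane \<longleftrightarrow> 1 - z \<notin> \<real>\<^sub>\<le>\<^sub>0 \<and> 1 + z \<notin> \<real>\<^sub>\<le>\<^sub>0"
  by (auto simp: double_slit_plane_iff complex_nonpos_Reals_iff)

lemma zero_in_double_slit_plane [simp]: "0 \<in> double_slit_plane"
  by (simp add: double_slit_plane_iff)

lemma open_double_slit_plane [intro, simp]: "open double_slit_plane"
proof -
  have "double_slit_plane = slit_plane \<inter> uminus -` slit_plane"
    by (auto simp: double_slit_plane_iff slit_plane_iff)
  moreover have "open (slit_plane \<inter> uminus -` slit_plane)"
    by (intro open_Int open_vimage continuous_intros open_slit_plane)
  ultimately show ?thesis by simp
qed

lemma connected_double_slit_plane [intro, simp]: "connected double_slit_plane"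
proof (intro starlike_imp_connected starlike_0I)
  fix w t assume w: "w \<in> double_slit_plane" "0 \<le> (t::real)" "t \<le> 1"
  hence "t *\<^sub>R w \<in> slit_plane" "t *\<^sub>R (- w) \<in> slit_plane"
    by (intro slit_plane_scale; auto simp: double_slit_plane_iff slit_plane_iff)+
  thus "t *\<^sub>R w \<in> double_slit_plane" by (auto simp: double_slit_plane_iff slit_plane_iff)
qed auto

lemma square_in_slit_plane: "z \<in> double_slit_plane \<Longrightarrow> z\<^sup>2 \<in> slit_plane"
proof (rule ccontr)
  assume z: "z \<in> double_slit_plane" and "z\<^sup>2 \<notin> slit_plane"
  hence sq: "Im (z\<^sup>2) = 0" "Re (z\<^sup>2) \<ge> 1" by (auto simp: slit_plane_iff)
  have "Re z = 0 \<or> Im z = 0" using sq(1) by (simp add: Im_power2)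
  thus False
  proof
    assume "Re z = 0"
    hence "1 \<le> - (Im z)\<^sup>2" using sq(2) by (simp add: Re_power2)
    thus False using zero_le_power2[of "Im z"] by linarith
  next
    assume i: "Im z = 0"
    hence "\<bar>Re z\<bar> < 1" using z by (auto simp: double_slit_plane_iff)
    hence "(Re z)\<^sup>2 < 1" by (simp add: abs_square_less_1)
    thus False using sq(2) i by (simp add: Re_power2)
  qed
qed

text \<open>As 1 - 2 t / (t - 1) = (1 + t) / (1 - t), failure would make this quotient a real r <=
  0, and then t = (r - 1) / (1 + r) would be real with |t| >= 1.\<close>

lemma moebius_in_slit_plane:
  assumes t: "t \<in> double_slit_plane"
  shows "2 * t / (t - 1) \<in> slit_plane"
proof -
  have nz: "1 - t \<noteq> 0" "t - 1 \<noteq> 0" "1 + t \<noteq> 0" using t by (auto simp: double_slit_plane_alt add_eq_0_iff)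
  have e: "1 - 2 * t / (t - 1) = (1 + t) / (1 - t)" using nz by (simp add: divide_simps) (simp add: algebra_simps)
  have "(1 + t) / (1 - t) \<notin> \<real>\<^sub>\<le>\<^sub>0"
  proof
    assume "(1 + t) / (1 - t) \<in> \<real>\<^sub>\<le>\<^sub>0"
    then obtain r where r: "r \<le> 0" "(1 + t) / (1 - t) = of_real r" by (auto elim!: nonpos_Reals_cases)
    hence "1 + t = of_real r * (1 - t)" using nz by (simp add: field_simps)
    hence "t * of_real (1 + r) = of_real (r - 1)" by (simp add: algebra_simps)
    moreover have "1 + r \<noteq> 0"
    proof
      assume "1 + r = 0"
      hence "r = - 1" by simp
      thus False using calculation by simp
    qed
    moreover from this have "complex_of_real (1 + r) \<noteq> 0" by (simp only: of_real_eq_0_iff not_False_eq_True)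
    ultimately have "t = of_real ((r - 1) / (1 + r))"
      unfolding of_real_divide by (simp only: eq_divide_eq if_True simp_thms)
    moreover have "\<bar>(r - 1) / (1 + r)\<bar> \<ge> 1" using r(1) \<open>1 + r \<noteq> 0\<close>
      by (simp add: abs_divide divide_simps)
    ultimately show False using t by (auto simp: double_slit_plane_iff abs_if split: if_splits)
  qed
  thus ?thesis unfolding slit_plane_alt e .
qed

text \<open>Both sides solve the same equation with regular singular point 0, where the second
  exponent is \<open>2 - 2 * c\<close>.\<close>

theorem quadratic_transformation:
  assumes c: "c \<notin> \<int>\<^sub>\<le>\<^sub>0" and c2: "2 * c - 1 \<notin> \<int>\<^sub>\<le>\<^sub>0" and t: "t \<in> double_slit_plane"
  shows "hyp2F1 (b + 1 / 2) b c (t\<^sup>2) =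
     (1 - t) powr (- (2 * b)) * hyp2F1 (2 * b) (c - 1 / 2) (2 * c - 1) (2 * t / (t - 1))"
proof -
  let ?D = double_slit_plane
  let ?F = "hyp2F1 (b + 1 / 2) b c" and ?G = "hyp2F1 (2 * b) (c - 1 / 2) (2 * c - 1)"
  define f where "f = (\<lambda>t. 1 * ?F (t\<^sup>2))"
  define g where "g = (\<lambda>t. (1 - t) powr (- (2 * b)) * ?G (2 * t / (t - 1)))"
  \<comment> \<open>The common equation: that of \<open>hyp2F1 (b + 1 / 2) b c\<close> pulled back
    along t^2, with multiplier 4 t.\<close>
  define p q r where "p t = t * (1 - t\<^sup>2)" and "q t = 2 * c - 1 - (4 * b + 2) * t\<^sup>2"
    and "r t = - (2 * t * b * (2 * b + 1))" for t :: complex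
  have nz: "1 - t \<noteq> 0" "t - 1 \<noteq> 0" "1 + t \<noteq> 0" if "t \<in> ?D" for t
    using that by (auto simp: double_slit_plane_alt add_eq_0_iff)
  have F: "?F holomorphic_on slit_plane" and G: "?G holomorphic_on slit_plane"
    by (intro hyp2F1_holomorphic c c2)+
  have "(?F \<circ> (\<lambda>t. t\<^sup>2)) holomorphic_on ?D"
    using F by (rule holomorphic_on_compose_gen[rotated]) (auto intro!: holomorphic_intros square_in_slit_plane)
  hence f_hol: "f holomorphic_on ?D" by (simp add: f_def o_def)
  have "(?G \<circ> (\<lambda>t. 2 * t / (t - 1))) holomorphic_on ?D"
    using G by (rule holomorphic_on_compose_gen[rotated]) (auto intro!: holomorphic_intros moebius_in_slit_plane dest: nz)
  hence g_hol: "g holomorphic_on ?D"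
    unfolding g_def o_def by (intro holomorphic_intros) (auto simp: double_slit_plane_alt)
  have f_ode: "p t * deriv (deriv f) t + q t * deriv f t + r t * f t = 0" if t: "t \<in> ?D" for t
    unfolding f_def
  proof (rule ode_mult_compose[where m = "\<lambda>_. 1" and \<phi> = "\<lambda>t. t\<^sup>2" and T = ?D and S = slit_plane
        and ?m1.0 = "\<lambda>_. 0" and ?m2.0 = "\<lambda>_. 0" and ?\<phi>1.0 = "\<lambda>t. 2 * t" and ?\<phi>2.0 = "\<lambda>_. 2" and l = "4 * t"])
    show "hyp_ode (b + 1 / 2) b c ?F (t\<^sup>2)" by (intro hyp2F1_ode c square_in_slit_plane t)
    show "p t * (1 * (2 * t)\<^sup>2) = 4 * t * (t\<^sup>2 * (1 - t\<^sup>2))"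
      by (simp add: p_def algebra_simps power2_eq_square)
    show "p t * (2 * 0 * (2 * t) + 1 * 2) + q t * (1 * (2 * t)) = 4 * t * (c - (b + 1 / 2 + b + 1) * t\<^sup>2)"
      by (simp add: p_def q_def algebra_simps power2_eq_square)
    show "p t * 0 + q t * 0 + r t * 1 = - (4 * t) * ((b + 1 / 2) * b)"
      by (simp add: r_def algebra_simps)
  qed (use t F in \<open>auto intro!: derivative_eq_intros square_in_slit_plane\<close>)
  have g_ode: "p t * deriv (deriv g) t + q t * deriv g t + r t * g t = 0" if t: "t \<in> ?D" for t
    unfolding g_def
  proof (rule ode_mult_compose[where m = "\<lambda>t. (1 - t) powr (- (2 * b))" and \<phi> = "\<lambda>t. 2 * t / (t - 1)"
        and T = ?D and S = slit_plane
        and ?\<phi>1.0 = "\<lambda>t. - 2 / (t - 1)\<^sup>2" and ?\<phi>2.0 = "\<lambda>t. 4 / (t - 1) ^ 3"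
        and l = "- 2 * ((1 - t) powr (- (2 * b))) / (1 - t)"])
    fix t assume t: "t \<in> ?D"
    show "((\<lambda>t. (1 - t) powr (- (2 * b))) has_field_derivative (2 * b) * ((1 - t) powr (- (2 * b))) / (1 - t)) (at t)"
      using t by (intro powr_one_minus_deriv) (simp add: double_slit_plane_alt)
    show "((\<lambda>t. (2 * b) * ((1 - t) powr (- (2 * b))) / (1 - t)) has_field_derivative
      (2 * b) * (2 * b + 1) * ((1 - t) powr (- (2 * b))) / (1 - t)\<^sup>2) (at t)"
      using t by (intro powr_one_minus_deriv2) (simp add: double_slit_plane_alt)
    show "((\<lambda>t. 2 * t / (t - 1)) has_field_derivative - 2 / (t - 1)\<^sup>2) (at t)"
      using nz[OF t] by (auto intro!: derivative_eq_intros simp: power2_eq_square divide_simps)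
    show "((\<lambda>t. - 2 / (t - 1)\<^sup>2) has_field_derivative 4 / (t - 1) ^ 3) (at t)"
      using nz[OF t] by (auto intro!: derivative_eq_intros simp: divide_simps; simp add: eval_nat_numeral algebra_simps)
    show "2 * t / (t - 1) \<in> slit_plane" by (rule moebius_in_slit_plane[OF t])
  next
    show "hyp_ode (2 * b) (c - 1 / 2) (2 * c - 1) ?G (2 * t / (t - 1))"
      by (intro hyp2F1_ode c2 moebius_in_slit_plane t)
    define d where "d = 1 - t"
    define m where "m = d powr (- (2 * b))"
    have d: "d \<noteq> 0" "t - 1 = - d" "t = 1 - d" using nz[OF t] by (auto simp: d_def)
    show "p t * ((1 - t) powr (- (2 * b)) * (- 2 / (t - 1)\<^sup>2)\<^sup>2) =
       - 2 * ((1 - t) powr (- (2 * b))) / (1 - t) * (2 * t / (t - 1) * (1 - 2 * t / (t - 1)))"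
      unfolding d_def [symmetric] m_def [symmetric] d(2) p_def
      using d(1) by (simp add: d(3) divide_simps; simp add: eval_nat_numeral algebra_simps)
    show "p t * (2 * (2 * b * ((1 - t) powr (- (2 * b))) / (1 - t)) * (- 2 / (t - 1)\<^sup>2) + (1 - t) powr (- (2 * b)) * (4 / (t - 1) ^ 3))
      + q t * ((1 - t) powr (- (2 * b)) * (- 2 / (t - 1)\<^sup>2)) =
      - 2 * ((1 - t) powr (- (2 * b))) / (1 - t) * (2 * c - 1 - (2 * b + (c - 1 / 2) + 1) * (2 * t / (t - 1)))"
      unfolding d_def [symmetric] m_def [symmetric] d(2) p_def q_def
      using d(1) by (simp add: d(3) divide_simps eval_nat_numeral; simp add: algebra_simps)
    show "p t * (2 * b * (2 * b + 1) * ((1 - t) powr (- (2 * b))) / (1 - t)\<^sup>2)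
      + q t * (2 * b * ((1 - t) powr (- (2 * b))) / (1 - t)) + r t * ((1 - t) powr (- (2 * b))) =
      - (- 2 * ((1 - t) powr (- (2 * b))) / (1 - t)) * (2 * b * (c - 1 / 2))"
      unfolding d_def [symmetric] m_def [symmetric] d(2) p_def q_def r_def
      using d(1) by (simp add: d(3) divide_simps eval_nat_numeral; simp add: algebra_simps)
  qed (use t G in auto)
  define H where "H = (\<lambda>t. 1 * f t + (- 1) * g t)"
  define P Q where "P = (\<lambda>t. q t / (1 - t\<^sup>2))" and "Q = (\<lambda>t. r t / (1 - t\<^sup>2))"
  have sq: "1 - t\<^sup>2 \<noteq> 0" if "t \<in> ?D" for t
    using square_in_slit_plane[OF that] by (auto simp: slit_plane_alt)
  have hol: "H holomorphic_on ?D" "P holomorphic_on ?D" "Q holomorphic_on ?D"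
    unfolding H_def P_def Q_def q_def r_def by (intro holomorphic_intros f_hol g_hol sq; assumption)+
  have ode: "eventually (\<lambda>t. t * deriv (deriv H) t + P t * deriv H t + Q t * H t = 0) (nhds 0)"
    using eventually_nhds_in_open[OF open_double_slit_plane zero_in_double_slit_plane]
  proof eventually_elim
    case (elim t)
    have "p t * deriv (deriv H) t + q t * deriv H t + r t * H t = 0"
      unfolding H_def by (rule ode_lincomb[OF open_double_slit_plane elim f_hol g_hol f_ode[OF elim] g_ode[OF elim]])
    hence "(p t * deriv (deriv H) t + q t * deriv H t + r t * H t) / (1 - t\<^sup>2) = 0" by simp
    thus ?case using sq[OF elim] by (simp add: p_def P_def Q_def add_divide_distrib)
  qed
  have e: "H has_fps_expansion fps_expansion H 0" "P has_fps_expansion fps_expansion P 0"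
      "Q has_fps_expansion fps_expansion Q 0"
    using hol by (auto intro: has_fps_expansion_fps_expansion[OF open_double_slit_plane zero_in_double_slit_plane])
  have "fps_expansion H 0 = 0"
  proof (rule frobenius_unique[OF e ode, of 0])
    have "fps_nth (fps_expansion P 0) 0 = 2 * c - 1"
      using has_fps_expansion_imp_0_eq_fps_nth_0[OF e(2)] by (simp add: P_def q_def)
    thus "of_nat n + fps_nth (fps_expansion P 0) 0 \<noteq> 0" for n using add_of_nat_nonzero(2)[OF c2, of n] by simp
    fix k :: nat assume "k \<le> 0"
    thus "fps_nth (fps_expansion H 0) k = 0"
      using has_fps_expansion_imp_0_eq_fps_nth_0[OF e(1)]
      by (simp add: H_def f_def g_def hyp2F1_0[OF c] hyp2F1_0[OF c2])
  qed
  hence "H has_fps_expansion 0" using e(1) by simp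
  hence "H t = 0" using hol(1) t by (intro has_fps_expansion_0_analytic_continuation[of H ?D]) auto
  thus ?thesis by (simp add: H_def f_def g_def)
qed

subsection \<open>Solutions of Legendre's equation\<close>

text \<open>The two choice terms select by the same predicate, so they agree as functions, even
  where their values are unspecified.\<close>

lemma hyp2F1_commute: "hyp2F1 a b c = hyp2F1 b a c"
proof -
  have "hyp_fps a b c = hyp_fps b a c" by (simp add: fps_eq_iff mult_ac)
  thus ?thesis by (simp only: hyp2F1_def)
qed

text \<open>The operator b + w d/dw multiplies the n-th coefficient by b + n, which moves the
  Pochhammer symbol from b to b + 1. It is what turns the derivative of \<open>sol_inf\<close> into
  \<open>sol_inf\<close> at \<mu> + 1.\<close>

lemma hyp2F1_raise_b:
  assumes c: "c \<notin> \<int>\<^sub>\<le>\<^sub>0" and w: "w \<in> slit_plane"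
  shows "b * hyp2F1 a b c w + w * deriv (hyp2F1 a b c) w = b * hyp2F1 a (b + 1) c w"
proof -
  have "fps_const b * hyp_fps a b c + fps_X * fps_deriv (hyp_fps a b c) - fps_const b * hyp_fps a (b + 1) c = 0"
  proof (rule fps_ext)
    fix n
    have "fps_nth (fps_X * fps_deriv (hyp_fps a b c)) n = of_nat n * fps_nth (hyp_fps a b c) n"
      by (cases n) simp_all
    moreover have "b * pochhammer (b + 1) n = (b + of_nat n) * pochhammer b n"
      by (simp only: pochhammer_rec [symmetric] pochhammer_rec')
    hence "b * fps_nth (hyp_fps a (b + 1) c) n = (b + of_nat n) * fps_nth (hyp_fps a b c) n"
      by (simp add: mult_ac)
    ultimately show "fps_nth (fps_const b * hyp_fps a b c + fps_X * fps_deriv (hyp_fps a b c) - fps_const b * hyp_fps a (b + 1) c) n = fps_nth 0 n"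
      by (simp only: fps_add_nth fps_sub_nth fps_mult_left_const_nth fps_zero_nth) (simp add: algebra_simps del: fps_hypergeo_nth)
  qed
  moreover have "(\<lambda>w. b * hyp2F1 a b c w + w * deriv (hyp2F1 a b c) w - b * hyp2F1 a (b + 1) c w) has_fps_expansion
      fps_const b * hyp_fps a b c + fps_X * fps_deriv (hyp_fps a b c) - fps_const b * hyp_fps a (b + 1) c"
    by (intro fps_expansion_intros hyp2F1_expansion c)
  ultimately have "b * hyp2F1 a b c w + w * deriv (hyp2F1 a b c) w - b * hyp2F1 a (b + 1) c w = 0"
    using w by (intro has_fps_expansion_0_analytic_continuation
       [where A = slit_plane and f = "\<lambda>w. b * hyp2F1 a b c w + w * deriv (hyp2F1 a b c) w - b * hyp2F1 a (b + 1) c w"])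
      (auto intro!: holomorphic_intros holomorphic_deriv hyp2F1_holomorphic c)
  thus ?thesis by simp
qed

text \<open>The sign is a parameter: s = 1 gives the upper and s = -1 the lower half plane.\<close>

definition half_plane :: "real \<Rightarrow> complex set" where "half_plane s = {z. s * Im z > 0}"

lemma open_half_plane [simp, intro]: "open (half_plane s)"
  unfolding half_plane_def by (intro open_Collect_less continuous_intros)

lemma convex_half_plane: "convex (half_plane s)"
  using convex_halfspace_gt[of 0 "Complex 0 s"] by (simp add: half_plane_def inner_complex_def)

lemma connected_half_plane [simp, intro]: "connected (half_plane s)"
  by (intro convex_connected convex_half_plane)

lemma half_plane_subset: "half_plane s \<subseteq> double_slit_plane"
  by (auto simp: half_plane_def double_slit_plane_iff)

lemma half_plane_notin: "z \<in> half_plane s \<Longrightarrow> z \<notin> \<real>\<^sub>\<le>\<^sub>0" "z \<in> half_plane s \<Longrightarrow> z \<noteq> 0"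
  by (auto simp: half_plane_def complex_nonpos_Reals_iff)

lemma inverse_in_double_slit_plane:
  assumes "z \<in> half_plane s" shows "1 / z \<in> double_slit_plane"
proof -
  have "Im z \<noteq> 0" "z \<noteq> 0" using assms by (auto simp: half_plane_def)
  hence "Im (1 / z) \<noteq> 0" by (simp add: Im_divide cmod_power2 [symmetric])
  thus ?thesis by (simp add: double_slit_plane_iff)
qed

lemma inverse_square_in_slit_plane: "z \<in> half_plane s \<Longrightarrow> 1 / z\<^sup>2 \<in> slit_plane"
  using square_in_slit_plane[OF inverse_in_double_slit_plane] by (simp add: power_divide)

definition gegenbauer_ode :: "complex \<Rightarrow> complex \<Rightarrow> (complex \<Rightarrow> complex) \<Rightarrow> complex \<Rightarrow> bool" where
  "gegenbauer_ode \<nu> \<mu> y z \<longleftrightarrow>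
     (1 - z\<^sup>2) * deriv (deriv y) z + (- (2 * (\<mu> + 1) * z)) * deriv y z + (\<nu> - \<mu>) * (\<nu> + \<mu> + 1) * y z = 0"

text \<open>With the factor \<open>(z\<^sup>2 - 1) powr (\<mu> / 2)\<close> removed, Legendre's equation becomes \<open>gegenbauer_ode\<close>;
  \<open>sol_inf\<close> is its solution recessive at infinity, \<open>sol_even\<close> and \<open>sol_odd\<close> are its normalised
  even and odd solutions.\<close>

definition sol_inf :: "complex \<Rightarrow> complex \<Rightarrow> complex \<Rightarrow> complex" where
  "sol_inf \<nu> \<mu> z = z powr (- (\<nu> + \<mu> + 1)) * hyp2F1 ((\<nu> + \<mu> + 2) / 2) ((\<nu> + \<mu> + 1) / 2) (\<nu> + 3 / 2) (1 / z\<^sup>2)"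

definition sol_even :: "complex \<Rightarrow> complex \<Rightarrow> complex \<Rightarrow> complex" where
  "sol_even \<nu> \<mu> z = 1 * hyp2F1 ((\<mu> - \<nu>) / 2) ((\<nu> + \<mu> + 1) / 2) (1 / 2) (z\<^sup>2)"

definition sol_odd :: "complex \<Rightarrow> complex \<Rightarrow> complex \<Rightarrow> complex" where
  "sol_odd \<nu> \<mu> z = z * hyp2F1 ((\<mu> - \<nu> + 1) / 2) ((\<nu> + \<mu> + 2) / 2) (3 / 2) (z\<^sup>2)"

lemma half_notin_nonpos_Ints: "1 / 2 \<notin> (\<int>\<^sub>\<le>\<^sub>0 :: complex set)" "3 / 2 \<notin> (\<int>\<^sub>\<le>\<^sub>0 :: complex set)"
proof -
  have "of_real r \<notin> (\<int>\<^sub>\<le>\<^sub>0 :: complex set)" if "r > 0" for r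
    using that by (auto elim!: nonpos_Ints_cases simp: complex_eq_iff)
  from this[of "1 / 2"] this[of "3 / 2"] show "1 / 2 \<notin> (\<int>\<^sub>\<le>\<^sub>0 :: complex set)" "3 / 2 \<notin> (\<int>\<^sub>\<le>\<^sub>0 :: complex set)"
    by simp_all
qed

lemma powr_deriv_minus:
  fixes z s :: complex
  assumes "z \<notin> \<real>\<^sub>\<le>\<^sub>0"
  shows "((\<lambda>z. z powr (- s)) has_field_derivative - s * (z powr (- s)) / z) (at z)"
proof -
  have "z powr (- s - 1) = z powr (- s) / z" using assms by (subst powr_diff) auto
  thus ?thesis using assms by (auto intro!: derivative_eq_intros)
qed

lemma powr_deriv2_minus:
  fixes z s :: complex
  assumes "z \<notin> \<real>\<^sub>\<le>\<^sub>0"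
  shows "((\<lambda>z. - s * (z powr (- s)) / z) has_field_derivative s * (s + 1) * (z powr (- s)) / z\<^sup>2) (at z)"
proof -
  have nz: "z \<noteq> 0" using assms by auto
  have "((\<lambda>z. - s * (z powr (- s)) / z) has_field_derivative
     (- s * (- s * (z powr (- s)) / z) * z - - s * (z powr (- s)) * 1) / (z * z)) (at z)"
    using nz by (intro DERIV_divide DERIV_cmult powr_deriv_minus assms DERIV_ident)
  also have "(- s * (- s * (z powr (- s)) / z) * z - - s * (z powr (- s)) * 1) / (z * z)
     = s * (s + 1) * (z powr (- s)) / z\<^sup>2"
  proof -
    have "(- s * (- s * m / z) * z - - s * m * 1) / (z * z) = s * (s + 1) * m / z\<^sup>2" for m
      using nz by (simp add: power2_eq_square algebra_simps)
    thus ?thesis .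
  qed
  finally show ?thesis .
qed

lemma deriv_inverse_square:
  assumes "z \<noteq> (0 :: complex)"
  shows "((\<lambda>z. 1 / z\<^sup>2) has_field_derivative - 2 / z ^ 3) (at z)"
    and "((\<lambda>z. - 2 / z ^ 3) has_field_derivative 6 / z ^ 4) (at z)"
  using assms by (auto intro!: derivative_eq_intros simp: divide_simps; simp add: eval_nat_numeral)+

lemma sol_inf_holomorphic:
  assumes c: "\<nu> + 3 / 2 \<notin> \<int>\<^sub>\<le>\<^sub>0"
  shows "sol_inf \<nu> \<mu> holomorphic_on half_plane s"
proof -
  have "(hyp2F1 ((\<nu> + \<mu> + 2) / 2) ((\<nu> + \<mu> + 1) / 2) (\<nu> + 3 / 2) \<circ> (\<lambda>z. 1 / z\<^sup>2)) holomorphic_on half_plane s"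
    using hyp2F1_holomorphic[OF c]
    by (rule holomorphic_on_compose_gen[rotated]) (auto intro!: holomorphic_intros inverse_square_in_slit_plane simp: half_plane_notin)
  thus ?thesis unfolding sol_inf_def [abs_def] o_def
    by (intro holomorphic_intros) (auto simp: half_plane_notin)
qed

text \<open>The conditions of \<open>ode_mult_compose\<close> for the substitution 1 / z^2, with
  \<open>m\<close> in place of the power of z, so that only rational identities in z remain.\<close>

lemma sol_inf_coeffs:
  fixes z m \<nu> \<mu> :: complex
  assumes "z \<noteq> 0"
  shows "(1 - z\<^sup>2) * (m * (- 2 / z ^ 3)\<^sup>2) = - 4 * m / z\<^sup>2 * (1 / z\<^sup>2 * (1 - 1 / z\<^sup>2))"
    and "(1 - z\<^sup>2) * (2 * (- (\<nu> + \<mu> + 1) * m / z) * (- 2 / z ^ 3) + m * (6 / z ^ 4))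
     + - (2 * (\<mu> + 1) * z) * (m * (- 2 / z ^ 3)) =
     - 4 * m / z\<^sup>2 * (\<nu> + 3 / 2 - ((\<nu> + \<mu> + 2) / 2 + (\<nu> + \<mu> + 1) / 2 + 1) * (1 / z\<^sup>2))"
    and "(1 - z\<^sup>2) * ((\<nu> + \<mu> + 1) * ((\<nu> + \<mu> + 1) + 1) * m / z\<^sup>2)
     + - (2 * (\<mu> + 1) * z) * (- (\<nu> + \<mu> + 1) * m / z)
     + (\<nu> - \<mu>) * (\<nu> + \<mu> + 1) * m =
     - (- 4 * m / z\<^sup>2) * ((\<nu> + \<mu> + 2) / 2 * ((\<nu> + \<mu> + 1) / 2))"
proof -
  define q where "q = z * z"
  have q: "q \<noteq> 0" using assms by (simp add: q_def)
  have p: "z\<^sup>2 = q" "z ^ 3 = q * z" "z ^ 4 = q * q" by (simp_all add: q_def eval_nat_numeral)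
  have e: "(- 2 / (q * z))\<^sup>2 = 4 / (q * q * q)"
    using assms by (simp add: q_def power2_eq_square)
  have e2: "2 * (x / z) * (- 2 / (q * z)) = - 4 * x / (q * q)" "- (2 * y * z) * (m * (- 2 / (q * z))) = 4 * y * m / q"
    "- (2 * y * z) * (x / z) = - 2 * y * x" for x y
    using assms by (simp_all add: q_def)
  show "(1 - z\<^sup>2) * (m * (- 2 / z ^ 3)\<^sup>2) = - 4 * m / z\<^sup>2 * (1 / z\<^sup>2 * (1 - 1 / z\<^sup>2))"
    unfolding p e using q by (simp add: field_simps)
  show "(1 - z\<^sup>2) * (2 * (- (\<nu> + \<mu> + 1) * m / z) * (- 2 / z ^ 3) + m * (6 / z ^ 4))
     + - (2 * (\<mu> + 1) * z) * (m * (- 2 / z ^ 3)) =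
     - 4 * m / z\<^sup>2 * (\<nu> + 3 / 2 - ((\<nu> + \<mu> + 2) / 2 + (\<nu> + \<mu> + 1) / 2 + 1) * (1 / z\<^sup>2))"
    unfolding p e2 using q by (simp add: field_simps)
  show "(1 - z\<^sup>2) * ((\<nu> + \<mu> + 1) * ((\<nu> + \<mu> + 1) + 1) * m / z\<^sup>2)
     + - (2 * (\<mu> + 1) * z) * (- (\<nu> + \<mu> + 1) * m / z)
     + (\<nu> - \<mu>) * (\<nu> + \<mu> + 1) * m =
     - (- 4 * m / z\<^sup>2) * ((\<nu> + \<mu> + 2) / 2 * ((\<nu> + \<mu> + 1) / 2))"
    unfolding p e2 using q by (simp add: field_simps)
qed

lemma sol_inf_ode:
  assumes c: "\<nu> + 3 / 2 \<notin> \<int>\<^sub>\<le>\<^sub>0" and z: "z \<in> half_plane s"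
  shows "gegenbauer_ode \<nu> \<mu> (sol_inf \<nu> \<mu>) z"
  unfolding gegenbauer_ode_def sol_inf_def [abs_def]
proof (rule ode_mult_compose[where m = "\<lambda>z. z powr (- (\<nu> + \<mu> + 1))" and \<phi> = "\<lambda>z. 1 / z\<^sup>2" and T = "half_plane s"
     and S = slit_plane and ?\<phi>1.0 = "\<lambda>z. - 2 / z ^ 3" and ?\<phi>2.0 = "\<lambda>z. 6 / z ^ 4" and l = "- 4 * z powr (- (\<nu> + \<mu> + 1)) / z\<^sup>2"])
  fix z assume z: "z \<in> half_plane s"
  show "((\<lambda>z. z powr (- (\<nu> + \<mu> + 1))) has_field_derivative - (\<nu> + \<mu> + 1) * (z powr (- (\<nu> + \<mu> + 1))) / z) (at z)"
    by (rule powr_deriv_minus[OF half_plane_notin(1)[OF z]])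
  show "((\<lambda>z. - (\<nu> + \<mu> + 1) * (z powr (- (\<nu> + \<mu> + 1))) / z) has_field_derivative
     (\<nu> + \<mu> + 1) * ((\<nu> + \<mu> + 1) + 1) * (z powr (- (\<nu> + \<mu> + 1))) / z\<^sup>2) (at z)"
    by (rule powr_deriv2_minus[OF half_plane_notin(1)[OF z]])
  show "((\<lambda>z. 1 / z\<^sup>2) has_field_derivative - 2 / z ^ 3) (at z)" "((\<lambda>z. - 2 / z ^ 3) has_field_derivative 6 / z ^ 4) (at z)"
    by (rule deriv_inverse_square[OF half_plane_notin(2)[OF z]])+
  show "1 / z\<^sup>2 \<in> slit_plane" by (rule inverse_square_in_slit_plane[OF z])
next
  show "hyp_ode ((\<nu> + \<mu> + 2) / 2) ((\<nu> + \<mu> + 1) / 2) (\<nu> + 3 / 2) (hyp2F1 ((\<nu> + \<mu> + 2) / 2) ((\<nu> + \<mu> + 1) / 2) (\<nu> + 3 / 2)) (1 / z\<^sup>2)"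
    by (intro hyp2F1_ode c inverse_square_in_slit_plane[OF z])
qed (use z hyp2F1_holomorphic[OF c] sol_inf_coeffs[OF half_plane_notin(2)[OF z]] in auto)

text \<open>With w = 1 / z^2 and \<sigma> = \<nu> + \<mu> + 1, differentiation produces the operator
  \<sigma>/2 + w d/dw, which raises the second upper parameter by 1. After exchanging the upper
  parameters these are the ones belonging to \<mu> + 1.\<close>

lemma sol_inf_deriv:
  assumes c: "\<nu> + 3 / 2 \<notin> \<int>\<^sub>\<le>\<^sub>0" and z: "z \<in> half_plane s"
  shows "deriv (sol_inf \<nu> \<mu>) z = - (\<nu> + \<mu> + 1) * sol_inf \<nu> (\<mu> + 1) z"
proof -
  define \<sigma> where "\<sigma> = \<nu> + \<mu> + 1"
  define F where "F = hyp2F1 ((\<nu> + \<mu> + 2) / 2) (\<sigma> / 2) (\<nu> + 3 / 2)"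
  have nz: "z \<noteq> 0" by (rule half_plane_notin(2)[OF z])
  have w: "1 / z\<^sup>2 \<in> slit_plane" by (rule inverse_square_in_slit_plane[OF z])
  have "((\<lambda>z. F (1 / z\<^sup>2)) has_field_derivative deriv F (1 / z\<^sup>2) * (- 2 / z ^ 3)) (at z)"
    unfolding F_def by (rule DERIV_chain2[OF holomorphic_derivI[OF hyp2F1_holomorphic[OF c] open_slit_plane w] deriv_inverse_square(1)[OF nz]])
  from DERIV_mult[OF powr_deriv_minus[OF half_plane_notin(1)[OF z], of \<sigma>] this]
  have "deriv (sol_inf \<nu> \<mu>) z = - \<sigma> * z powr - \<sigma> / z * F (1 / z\<^sup>2) + deriv F (1 / z\<^sup>2) * (- 2 / z ^ 3) * z powr - \<sigma>"
    by (intro DERIV_imp_deriv) (simp only: sol_inf_def [abs_def] F_def \<sigma>_def)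
  also have "\<dots> = - 2 * (z powr - \<sigma> / z) * (\<sigma> / 2 * F (1 / z\<^sup>2) + 1 / z\<^sup>2 * deriv F (1 / z\<^sup>2))"
    using nz by (simp add: eval_nat_numeral algebra_simps)
  also have "\<sigma> / 2 * F (1 / z\<^sup>2) + 1 / z\<^sup>2 * deriv F (1 / z\<^sup>2) = \<sigma> / 2 * hyp2F1 ((\<nu> + \<mu> + 2) / 2) (\<sigma> / 2 + 1) (\<nu> + 3 / 2) (1 / z\<^sup>2)"
    unfolding F_def by (rule hyp2F1_raise_b[OF c w])
  also have "hyp2F1 ((\<nu> + \<mu> + 2) / 2) (\<sigma> / 2 + 1) (\<nu> + 3 / 2) = hyp2F1 ((\<nu> + (\<mu> + 1) + 2) / 2) ((\<nu> + (\<mu> + 1) + 1) / 2) (\<nu> + 3 / 2)"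
  proof -
    have "\<sigma> / 2 + 1 = (\<nu> + (\<mu> + 1) + 2) / 2" "(\<nu> + \<mu> + 2) / 2 = (\<nu> + (\<mu> + 1) + 1) / 2"
      by (simp_all add: \<sigma>_def field_simps)
    thus ?thesis using hyp2F1_commute by metis
  qed
  also have "z powr - \<sigma> / z = z powr (- (\<nu> + (\<mu> + 1) + 1))"
  proof -
    have "- (\<nu> + (\<mu> + 1) + 1) = - \<sigma> - 1" by (simp add: \<sigma>_def)
    moreover have "z powr (- \<sigma> - 1) = z powr - \<sigma> / z" using nz by (subst powr_diff) auto
    ultimately show ?thesis by (simp only:)
  qed
  finally have *: "deriv (sol_inf \<nu> \<mu>) z = - 2 * z powr (- (\<nu> + (\<mu> + 1) + 1)) *
     (\<sigma> / 2 * hyp2F1 ((\<nu> + (\<mu> + 1) + 2) / 2) ((\<nu> + (\<mu> + 1) + 1) / 2) (\<nu> + 3 / 2) (1 / z\<^sup>2))" .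
  have "- 2 * X * (\<sigma> / 2 * Y) = - \<sigma> * (X * Y)" for X Y :: complex by simp
  thus ?thesis unfolding * sol_inf_def [of \<nu> "\<mu> + 1"] by (simp only: \<sigma>_def)
qed

lemma sol_even_odd_holomorphic:
  "sol_even \<nu> \<mu> holomorphic_on double_slit_plane" "sol_odd \<nu> \<mu> holomorphic_on double_slit_plane"
proof -
  have *: "(\<lambda>z. hyp2F1 a b c (z\<^sup>2)) holomorphic_on double_slit_plane" if "c \<notin> \<int>\<^sub>\<le>\<^sub>0" for a b c
  proof -
    have "(hyp2F1 a b c \<circ> (\<lambda>z. z\<^sup>2)) holomorphic_on double_slit_plane"
      using hyp2F1_holomorphic[OF that]
      by (rule holomorphic_on_compose_gen[rotated]) (auto intro!: holomorphic_intros square_in_slit_plane)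
    thus ?thesis by (simp add: o_def)
  qed
  show "sol_even \<nu> \<mu> holomorphic_on double_slit_plane" "sol_odd \<nu> \<mu> holomorphic_on double_slit_plane"
    unfolding sol_even_def [abs_def] sol_odd_def [abs_def]
    by (intro holomorphic_intros * half_notin_nonpos_Ints)+
qed

lemma sol_even_ode:
  assumes z: "z \<in> double_slit_plane"
  shows "gegenbauer_ode \<nu> \<mu> (sol_even \<nu> \<mu>) z"
  \<comment> \<open>The factor 1 in \<open>sol_even\<close> is the \<open>m\<close> of
    \<open>ode_mult_compose\<close>.\<close>
  unfolding gegenbauer_ode_def sol_even_def [abs_def]
proof (rule ode_mult_compose[where m = "\<lambda>_. 1" and \<phi> = "\<lambda>z. z\<^sup>2" and T = double_slit_plane
     and S = slit_plane and ?m1.0 = "\<lambda>_. 0" and ?m2.0 = "\<lambda>_. 0" and ?\<phi>1.0 = "\<lambda>z. 2 * z" and ?\<phi>2.0 = "\<lambda>z. 2" and l = 4])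
  show "hyp_ode ((\<mu> - \<nu>) / 2) ((\<nu> + \<mu> + 1) / 2) (1 / 2) (hyp2F1 ((\<mu> - \<nu>) / 2) ((\<nu> + \<mu> + 1) / 2) (1 / 2)) (z\<^sup>2)"
    by (intro hyp2F1_ode half_notin_nonpos_Ints square_in_slit_plane z)
  show "(1 - z\<^sup>2) * (1 * (2 * z)\<^sup>2) = 4 * (z\<^sup>2 * (1 - z\<^sup>2))"
    by (simp add: power2_eq_square algebra_simps)
  show "(1 - z\<^sup>2) * (2 * 0 * (2 * z) + 1 * 2) + - (2 * (\<mu> + 1) * z) * (1 * (2 * z)) =
    4 * (1 / 2 - ((\<mu> - \<nu>) / 2 + (\<nu> + \<mu> + 1) / 2 + 1) * z\<^sup>2)"
    by (simp add: power2_eq_square field_simps)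
  show "(1 - z\<^sup>2) * 0 + - (2 * (\<mu> + 1) * z) * 0 + (\<nu> - \<mu>) * (\<nu> + \<mu> + 1) * 1 = - 4 * ((\<mu> - \<nu>) / 2 * ((\<nu> + \<mu> + 1) / 2))"
    by (simp add: field_simps)
qed (use z hyp2F1_holomorphic half_notin_nonpos_Ints in \<open>auto intro!: derivative_eq_intros square_in_slit_plane\<close>)

lemma sol_odd_ode:
  assumes z: "z \<in> double_slit_plane"
  shows "gegenbauer_ode \<nu> \<mu> (sol_odd \<nu> \<mu>) z"
  unfolding gegenbauer_ode_def sol_odd_def [abs_def]
proof (rule ode_mult_compose[where m = "\<lambda>z. z" and \<phi> = "\<lambda>z. z\<^sup>2" and T = double_slit_plane
     and S = slit_plane and ?m1.0 = "\<lambda>_. 1" and ?m2.0 = "\<lambda>_. 0" and ?\<phi>1.0 = "\<lambda>z. 2 * z" and ?\<phi>2.0 = "\<lambda>z. 2" and l = "4 * z"])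
  show "hyp_ode ((\<mu> - \<nu> + 1) / 2) ((\<nu> + \<mu> + 2) / 2) (3 / 2) (hyp2F1 ((\<mu> - \<nu> + 1) / 2) ((\<nu> + \<mu> + 2) / 2) (3 / 2)) (z\<^sup>2)"
    by (intro hyp2F1_ode half_notin_nonpos_Ints square_in_slit_plane z)
  show "(1 - z\<^sup>2) * (z * (2 * z)\<^sup>2) = 4 * z * (z\<^sup>2 * (1 - z\<^sup>2))"
    by (simp add: power2_eq_square algebra_simps)
  show "(1 - z\<^sup>2) * (2 * 1 * (2 * z) + z * 2) + - (2 * (\<mu> + 1) * z) * (z * (2 * z)) =
    4 * z * (3 / 2 - ((\<mu> - \<nu> + 1) / 2 + (\<nu> + \<mu> + 2) / 2 + 1) * z\<^sup>2)"
    by (simp add: power2_eq_square field_simps)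
  show "(1 - z\<^sup>2) * 0 + - (2 * (\<mu> + 1) * z) * 1 + (\<nu> - \<mu>) * (\<nu> + \<mu> + 1) * z =
    - (4 * z) * ((\<mu> - \<nu> + 1) / 2 * ((\<nu> + \<mu> + 2) / 2))"
    by (simp add: field_simps)
qed (use z hyp2F1_holomorphic half_notin_nonpos_Ints in \<open>auto intro!: derivative_eq_intros square_in_slit_plane\<close>)

lemma sol_even_odd_at_0:
  "sol_even \<nu> \<mu> 0 = 1" "sol_odd \<nu> \<mu> 0 = 0" "deriv (sol_even \<nu> \<mu>) 0 = 0" "deriv (sol_odd \<nu> \<mu>) 0 = 1"
proof -
  have d: "((\<lambda>z::complex. z\<^sup>2) has_field_derivative 2 * z) (at z)" "((\<lambda>z::complex. 2 * z) has_field_derivative 2) (at z)" for z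
    by (auto intro!: derivative_eq_intros)
  note * = deriv2_mult_compose(1)[OF open_double_slit_plane zero_in_double_slit_plane open_slit_plane hyp2F1_holomorphic square_in_slit_plane _ _ d]
  show "sol_even \<nu> \<mu> 0 = 1" "sol_odd \<nu> \<mu> 0 = 0"
    by (simp_all add: sol_even_def sol_odd_def hyp2F1_0 half_notin_nonpos_Ints)
  show "deriv (sol_even \<nu> \<mu>) 0 = 0"
    unfolding sol_even_def [abs_def]
    by (subst *[where ?m1.0 = "\<lambda>_. 0" and ?m2.0 = "\<lambda>_. 0"]) (use half_notin_nonpos_Ints in \<open>auto intro!: derivative_eq_intros\<close>)
  show "deriv (sol_odd \<nu> \<mu>) 0 = 1"
    unfolding sol_odd_def [abs_def]
    by (subst *[where ?m1.0 = "\<lambda>_. 1" and ?m2.0 = "\<lambda>_. 0"]) (use half_notin_nonpos_Ints in \<open>auto intro!: derivative_eq_intros simp: hyp2F1_0\<close>)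
qed

subsection \<open>Connection between infinity and the origin\<close>

text \<open>The exponential is (i s)^(- \<nu> - \<mu> - 1), the phase of the power on the imaginary
  axis; the Gamma factors are Gauss's sum for the series that Pfaff's transformation produces. With
  \<open>rGamma\<close> the formula includes the parameters for which the limit is 0.\<close>

definition conn_even :: "complex \<Rightarrow> complex \<Rightarrow> real \<Rightarrow> complex" where
  "conn_even \<nu> \<mu> s = exp (- (\<nu> + \<mu> + 1) * (\<i> * of_real (s * pi / 2))) * Gamma (\<nu> + 3 / 2) * of_real (sqrt pi) *
     rGamma ((\<nu> + \<mu> + 2) / 2) * rGamma ((\<nu> - \<mu> + 2) / 2)"

definition conn_odd :: "complex \<Rightarrow> complex \<Rightarrow> real \<Rightarrow> complex" where
  "conn_odd \<nu> \<mu> s = - 2 * exp (- (\<nu> + \<mu> + 2) * (\<i> * of_real (s * pi / 2))) * Gamma (\<nu> + 3 / 2) * of_real (sqrt pi) *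
     rGamma ((\<nu> + \<mu> + 1) / 2) * rGamma ((\<nu> - \<mu> + 1) / 2)"

text \<open>The functional equation of \<open>rGamma\<close> absorbs (\<nu> + \<mu> + 1) / 2, which
  leaves the factor 2 in \<open>conn_odd\<close>.\<close>

lemma conn_odd_eq: "- (\<nu> + \<mu> + 1) * conn_even \<nu> (\<mu> + 1) s = conn_odd \<nu> \<mu> s"
proof -
  have "(\<nu> + \<mu> + 1) / 2 * rGamma ((\<nu> + \<mu> + 1) / 2 + 1) = rGamma ((\<nu> + \<mu> + 1) / 2)"
    by (rule rGamma_plus1)
  moreover have "(\<nu> + \<mu> + 1) / 2 + 1 = (\<nu> + (\<mu> + 1) + 2) / 2" by (simp add: field_simps)
  ultimately have 1: "rGamma ((\<nu> + \<mu> + 1) / 2) = (\<nu> + \<mu> + 1) / 2 * rGamma ((\<nu> + (\<mu> + 1) + 2) / 2)" by simp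
  have 2: "\<nu> - (\<mu> + 1) + 2 = \<nu> - \<mu> + 1" "\<nu> + (\<mu> + 1) + 1 = \<nu> + \<mu> + 2" by simp_all
  have alg: "- x * (e * g * p * r * q) = - 2 * e * g * p * (x / 2 * r) * q" for x e g p r q :: complex by simp
  show ?thesis unfolding conn_even_def conn_odd_def 1 2 by (rule alg)
qed

lemma Ln_imaginary:
  assumes "s = 1 \<or> s = (-1::real)" "y > 0"
  shows "Ln (\<i> * of_real (s * y)) = of_real (ln y) + \<i> * of_real (s * pi / 2)"
proof (rule Ln_unique)
  have "exp (\<i> * of_real (s * pi / 2)) = \<i> * of_real s"
    unfolding cis_conv_exp [symmetric] using assms(1) by auto
  thus "exp (of_real (ln y) + \<i> * of_real (s * pi / 2)) = \<i> * of_real (s * y)"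
    using assms(2) by (simp add: exp_add exp_of_real)
  show "- pi < Im (of_real (ln y) + \<i> * of_real (s * pi / 2))" "Im (of_real (ln y) + \<i> * of_real (s * pi / 2)) \<le> pi"
    using assms(1) pi_gt_zero by auto
qed

text \<open>At z = i s y the variable 1 / z^2 is -1 / y^2, which runs to infinity as y tends to 0;
  Pfaff's transformation replaces it by 1 / (1 + y^2), which tends to 1. The singular power of y in
  front cancels against the one in ((1 + y^2) / y^2)^(-(\<nu> + \<mu> + 1) / 2).\<close>

lemma sol_inf_imaginary:
  assumes c: "\<nu> + 3 / 2 \<notin> \<int>\<^sub>\<le>\<^sub>0" and s: "s = 1 \<or> s = (-1::real)" and y: "y > 0"
  shows "sol_inf \<nu> \<mu> (\<i> * of_real (s * y)) =
     exp (- (\<nu> + \<mu> + 1) * (\<i> * of_real (s * pi / 2))) * exp (- (\<nu> + \<mu> + 1) / 2 * of_real (ln (1 + y\<^sup>2))) *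
     hyp2F1 (\<nu> + 3 / 2 - (\<nu> + \<mu> + 2) / 2) ((\<nu> + \<mu> + 1) / 2) (\<nu> + 3 / 2) (of_real (1 / (1 + y\<^sup>2)))"
proof -
  define z where "z = \<i> * of_real (s * y)"
  define \<sigma> where "\<sigma> = \<nu> + \<mu> + 1"
  define w where "w = complex_of_real (- 1 / y\<^sup>2)"
  have z: "z \<noteq> 0" using s y by (auto simp: z_def)
  have "1 / z\<^sup>2 = w" using s by (auto simp: z_def w_def power_mult_distrib)
  have w: "w \<in> slit_plane" using y by (simp add: w_def slit_plane_iff less_le_trans[of _ 0])
  have y2: "1 + y\<^sup>2 > 0" by (simp add: add_pos_nonneg)
  have 1: "1 - w = of_real ((1 + y\<^sup>2) / y\<^sup>2)" using y by (simp add: w_def field_simps)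
  have 2: "w / (w - 1) = of_real (1 / (1 + y\<^sup>2))"
  proof -
    have "- 1 / y\<^sup>2 / (- 1 / y\<^sup>2 - 1) = 1 / (1 + y\<^sup>2)" using y y2 by (simp add: divide_simps)
    hence "complex_of_real (- 1 / y\<^sup>2 / (- 1 / y\<^sup>2 - 1)) = of_real (1 / (1 + y\<^sup>2))" by (simp only:)
    thus ?thesis by (simp add: w_def)
  qed
  have "ln ((1 + y\<^sup>2) / y\<^sup>2) = ln (1 + y\<^sup>2) - 2 * ln y"
    using y y2 by (simp add: ln_div ln_realpow)
  hence 3: "(1 - w) powr (- (\<sigma> / 2)) = exp (- (\<sigma> / 2) * of_real (ln (1 + y\<^sup>2) - 2 * ln y))"
  proof -
    assume "ln ((1 + y\<^sup>2) / y\<^sup>2) = ln (1 + y\<^sup>2) - 2 * ln y"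
    moreover have "complex_of_real r powr x = exp (x * of_real (ln r))" if "r > 0" for r x
      using that by (simp add: powr_def Ln_of_real)
    ultimately show ?thesis unfolding 1 using y y2 by (simp only: zero_less_divide_iff zero_less_power simp_thms)
  qed
  have 4: "z powr - \<sigma> = exp (- \<sigma> * (of_real (ln y) + \<i> * of_real (s * pi / 2)))"
  proof -
    have "z powr - \<sigma> = exp (- \<sigma> * Ln z)" using z by (simp add: powr_def)
    also have "Ln z = of_real (ln y) + \<i> * of_real (s * pi / 2)" unfolding z_def by (rule Ln_imaginary[OF s y])
    finally show ?thesis .
  qed
  have "sol_inf \<nu> \<mu> z = z powr - \<sigma> * ((1 - w) powr (- (\<sigma> / 2)) *
      hyp2F1 (\<nu> + 3 / 2 - (\<nu> + \<mu> + 2) / 2) (\<sigma> / 2) (\<nu> + 3 / 2) (w / (w - 1)))"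
    unfolding pfaff[OF c w] sol_inf_def \<sigma>_def \<open>1 / z\<^sup>2 = w\<close> ..
  also have "\<dots> = exp (- \<sigma> * (of_real (ln y) + \<i> * of_real (s * pi / 2))) * exp (- (\<sigma> / 2) * of_real (ln (1 + y\<^sup>2) - 2 * ln y)) *
      hyp2F1 (\<nu> + 3 / 2 - (\<nu> + \<mu> + 2) / 2) (\<sigma> / 2) (\<nu> + 3 / 2) (of_real (1 / (1 + y\<^sup>2)))"
    unfolding 2 3 4 by (simp only: mult.assoc)
  also have "exp (- \<sigma> * (of_real (ln y) + \<i> * of_real (s * pi / 2))) * exp (- (\<sigma> / 2) * of_real (ln (1 + y\<^sup>2) - 2 * ln y))
     = exp (- \<sigma> * (\<i> * of_real (s * pi / 2))) * exp (- \<sigma> / 2 * of_real (ln (1 + y\<^sup>2)))"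
    unfolding exp_add [symmetric] by (rule arg_cong[of _ _ exp]) (simp add: algebra_simps)
  finally show ?thesis unfolding z_def \<sigma>_def .
qed

text \<open>After Pfaff's transformation the excess of the lower over the upper parameters is a - b
  = 1/2 for all \<nu> and \<mu>, so Gauss's theorem always applies.\<close>

lemma sol_inf_tendsto:
  assumes c: "\<nu> + 3 / 2 \<notin> \<int>\<^sub>\<le>\<^sub>0" and s: "s = 1 \<or> s = (-1::real)"
  shows "((\<lambda>y. sol_inf \<nu> \<mu> (\<i> * of_real (s * y))) \<longlongrightarrow> conn_even \<nu> \<mu> s) (at_right 0)"
proof -
  define a b where "a = (\<nu> + \<mu> + 2) / 2" and "b = (\<nu> + \<mu> + 1) / 2"
  have ab: "a - b = 1 / 2" by (simp add: a_def b_def field_simps)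
  have "gauss_sum (\<nu> + 3 / 2 - a) b (\<nu> + 3 / 2) = Gamma (\<nu> + 3 / 2) * Gamma (\<nu> + 3 / 2 - (\<nu> + 3 / 2 - a) - b)
     * rGamma (\<nu> + 3 / 2 - (\<nu> + 3 / 2 - a)) * rGamma (\<nu> + 3 / 2 - b)"
    by (rule gauss_sum_eq[OF c]) (use arg_cong[OF ab, of Re] in simp)
  also have "\<nu> + 3 / 2 - (\<nu> + 3 / 2 - a) - b = 1 / 2" using ab by simp
  also have "Gamma (1 / 2 :: complex) = of_real (sqrt pi)" by (rule Gamma_one_half_complex)
  also have "\<nu> + 3 / 2 - (\<nu> + 3 / 2 - a) = (\<nu> + \<mu> + 2) / 2" by (simp add: a_def)
  also have "\<nu> + 3 / 2 - b = (\<nu> - \<mu> + 2) / 2" by (simp add: b_def field_simps)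
  finally have gs: "gauss_sum (\<nu> + 3 / 2 - a) b (\<nu> + 3 / 2) =
    Gamma (\<nu> + 3 / 2) * of_real (sqrt pi) * rGamma ((\<nu> + \<mu> + 2) / 2) * rGamma ((\<nu> - \<mu> + 2) / 2)" .
  have "((\<lambda>x. hyp2F1 (\<nu> + 3 / 2 - a) b (\<nu> + 3 / 2) (of_real x)) \<longlongrightarrow> gauss_sum (\<nu> + 3 / 2 - a) b (\<nu> + 3 / 2)) (at_left 1)"
    by (rule hyp2F1_tendsto_gauss_sum[OF c]) (use arg_cong[OF ab, of Re] in simp)
  moreover have "filterlim (\<lambda>y::real. 1 / (1 + y\<^sup>2)) (at_left 1) (at_right 0)"
  proof (rule tendsto_imp_filterlim_at_left)
    have "((\<lambda>y::real. 1 / (1 + y\<^sup>2)) \<longlongrightarrow> 1 / (1 + 0\<^sup>2)) (at_right 0)"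
      by (intro tendsto_intros) auto
    thus "((\<lambda>y::real. 1 / (1 + y\<^sup>2)) \<longlongrightarrow> 1) (at_right 0)" by simp
    show "eventually (\<lambda>y::real. 1 / (1 + y\<^sup>2) < 1) (at_right 0)"
      using eventually_at_right_less[of "0::real"] by eventually_elim (simp add: divide_simps add_pos_pos)
  qed
  ultimately have lim: "((\<lambda>y. hyp2F1 (\<nu> + 3 / 2 - a) b (\<nu> + 3 / 2) (of_real (1 / (1 + y\<^sup>2)))) \<longlongrightarrow>
      gauss_sum (\<nu> + 3 / 2 - a) b (\<nu> + 3 / 2)) (at_right 0)"
    by (rule filterlim_compose)
  have "((\<lambda>y::real. exp (- (\<nu> + \<mu> + 1) / 2 * of_real (ln (1 + y\<^sup>2)))) \<longlongrightarrow>
     exp (- (\<nu> + \<mu> + 1) / 2 * of_real (ln (1 + 0\<^sup>2)))) (at_right 0)"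
    by (intro tendsto_intros) auto
  hence lim2: "((\<lambda>y::real. exp (- (\<nu> + \<mu> + 1) / 2 * of_real (ln (1 + y\<^sup>2)))) \<longlongrightarrow> 1) (at_right 0)" by simp
  have "((\<lambda>y. exp (- (\<nu> + \<mu> + 1) * (\<i> * of_real (s * pi / 2))) * exp (- (\<nu> + \<mu> + 1) / 2 * of_real (ln (1 + y\<^sup>2))) *
     hyp2F1 (\<nu> + 3 / 2 - a) b (\<nu> + 3 / 2) (of_real (1 / (1 + y\<^sup>2)))) \<longlongrightarrow>
     exp (- (\<nu> + \<mu> + 1) * (\<i> * of_real (s * pi / 2))) * 1 * gauss_sum (\<nu> + 3 / 2 - a) b (\<nu> + 3 / 2)) (at_right 0)"
    by (intro tendsto_mult tendsto_const lim lim2)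
  moreover have "eventually (\<lambda>y. exp (- (\<nu> + \<mu> + 1) * (\<i> * of_real (s * pi / 2))) * exp (- (\<nu> + \<mu> + 1) / 2 * of_real (ln (1 + y\<^sup>2))) *
     hyp2F1 (\<nu> + 3 / 2 - a) b (\<nu> + 3 / 2) (of_real (1 / (1 + y\<^sup>2))) = sol_inf \<nu> \<mu> (\<i> * of_real (s * y))) (at_right 0)"
    using eventually_at_right_less[of "0::real"]
    by eventually_elim (simp only: sol_inf_imaginary[OF c s] a_def b_def)
  ultimately have "((\<lambda>y. sol_inf \<nu> \<mu> (\<i> * of_real (s * y))) \<longlongrightarrow>
     exp (- (\<nu> + \<mu> + 1) * (\<i> * of_real (s * pi / 2))) * 1 * gauss_sum (\<nu> + 3 / 2 - a) b (\<nu> + 3 / 2)) (at_right 0)"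
    by (rule Lim_transform_eventually)
  thus ?thesis unfolding gs conn_even_def by (simp only: mult_1_right mult.assoc)
qed

text \<open>The coefficients are the values of \<open>sol_inf \<nu> \<mu>\<close> and of its derivative at the regular point 0,
  approached along the imaginary axis; the derivative is again a solution recessive at infinity, for \<open>\<mu> + 1\<close>.\<close>

theorem sol_inf_connection:
  assumes c: "\<nu> + 3 / 2 \<notin> \<int>\<^sub>\<le>\<^sub>0" and s: "s = 1 \<or> s = (-1::real)" and z: "z \<in> half_plane s"
  shows "sol_inf \<nu> \<mu> z = conn_even \<nu> \<mu> s * sol_even \<nu> \<mu> z + conn_odd \<nu> \<mu> s * sol_odd \<nu> \<mu> z"
proof -
  let ?D = double_slit_plane and ?S = "half_plane s"
  let ?U = "sol_inf \<nu> \<mu>" and ?E = "sol_even \<nu> \<mu>" and ?O = "sol_odd \<nu> \<mu>"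
  note hol = sol_even_odd_holomorphic[of \<nu> \<mu>]
  have holS: "?E holomorphic_on ?S" "?O holomorphic_on ?S" "?U holomorphic_on ?S"
    using hol half_plane_subset sol_inf_holomorphic[OF c] holomorphic_on_subset by blast+
  have cont: "isCont ?E 0" "isCont ?O 0" "isCont (deriv ?E) 0" "isCont (deriv ?O) 0"
    using hol holomorphic_deriv[OF hol(1) open_double_slit_plane] holomorphic_deriv[OF hol(2) open_double_slit_plane]
    by (metis continuous_on_eq_continuous_at holomorphic_on_imp_continuous_on open_double_slit_plane zero_in_double_slit_plane)+
  have "((\<lambda>y. \<i> * of_real (s * y)) \<longlongrightarrow> \<i> * of_real (s * 0)) (at_right 0)" by (intro tendsto_intros)
  hence path: "((\<lambda>y. \<i> * of_real (s * y)) \<longlongrightarrow> 0) (at_right 0)" by simp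
  have lims: "((\<lambda>y. ?E (\<i> * of_real (s * y))) \<longlongrightarrow> 1) (at_right 0)"
      "((\<lambda>y. ?O (\<i> * of_real (s * y))) \<longlongrightarrow> 0) (at_right 0)"
      "((\<lambda>y. deriv ?E (\<i> * of_real (s * y))) \<longlongrightarrow> 0) (at_right 0)"
      "((\<lambda>y. deriv ?O (\<i> * of_real (s * y))) \<longlongrightarrow> 1) (at_right 0)"
    using isCont_tendsto_compose[OF cont(1) path] isCont_tendsto_compose[OF cont(2) path]
      isCont_tendsto_compose[OF cont(3) path] isCont_tendsto_compose[OF cont(4) path]
    by (simp_all only: sol_even_odd_at_0)
  have pathS: "\<i> * of_real (s * y) \<in> ?S" if "y > 0" for y using s that by (auto simp: half_plane_def)
  \<comment> \<open>The formula for \<open>sol_inf\<close> is singular at 0, so the coefficients are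
    fixed at a point of the half plane. The Wronskian is 1 at 0, hence nonzero at suitable points of
    the imaginary axis close to 0.\<close>
  define W where "W z = ?E z * deriv ?O z - deriv ?E z * ?O z" for z
  have "((\<lambda>y. W (\<i> * of_real (s * y))) \<longlongrightarrow> 1 * 1 - 0 * 0) (at_right 0)"
    unfolding W_def by (intro tendsto_intros lims)
  hence "eventually (\<lambda>y. W (\<i> * of_real (s * y)) \<noteq> 0) (at_right 0)"
    by (rule tendsto_imp_eventually_ne) simp
  hence "eventually (\<lambda>y. W (\<i> * of_real (s * y)) \<noteq> 0 \<and> y > 0) (at_right 0)"
    using eventually_at_right_less[of "0::real"] by eventually_elim simp
  then obtain y0 where y0: "W (\<i> * of_real (s * y0)) \<noteq> 0" "y0 > 0"
    using eventually_happens by fastforce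
  define z0 where "z0 = \<i> * of_real (s * y0)"
  have z0: "z0 \<in> ?S" "W z0 \<noteq> 0" using y0 pathS by (simp_all add: z0_def)
  \<comment> \<open>Cramer's rule for matching value and derivative at \<open>z0\<close>.\<close>
  define A where "A = (?U z0 * deriv ?O z0 - deriv ?U z0 * ?O z0) / W z0"
  define B where "B = (?E z0 * deriv ?U z0 - deriv ?E z0 * ?U z0) / W z0"
  define V where "V = (\<lambda>z. A * ?E z + B * ?O z)"
  have V_hol: "V holomorphic_on ?S" unfolding V_def by (intro holomorphic_intros holS)
  define y where "y = (\<lambda>z. 1 * ?U z + (- 1) * V z)"
  have y_hol: "y holomorphic_on ?S" unfolding y_def by (intro holomorphic_intros holS V_hol)
  have dV: "deriv V z = A * deriv ?E z + B * deriv ?O z" if "z \<in> ?S" for z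
    unfolding V_def by (rule deriv2_lincomb(1)[OF open_half_plane that holS(1,2)])
  have dy: "deriv y z = deriv ?U z - deriv V z" if "z \<in> ?S" for z
    unfolding y_def by (subst deriv2_lincomb(1)[OF open_half_plane that holS(3) V_hol]) simp
  have y_ode: "(1 - z\<^sup>2) * deriv (deriv y) z + (- (2 * (\<mu> + 1) * z)) * deriv y z + (\<nu> - \<mu>) * (\<nu> + \<mu> + 1) * y z = 0"
    if z: "z \<in> ?S" for z
  proof -
    have zD: "z \<in> ?D" using z half_plane_subset by blast
    show ?thesis
      unfolding y_def
      by (rule ode_lincomb[OF open_half_plane z holS(3) V_hol sol_inf_ode[OF c z, unfolded gegenbauer_ode_def]])
         (unfold V_def, rule ode_lincomb[OF open_half_plane z holS(1,2) sol_even_ode[OF zD, unfolded gegenbauer_ode_def]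
            sol_odd_ode[OF zD, unfolded gegenbauer_ode_def]])
  qed
  have W0: "?E z0 * deriv ?O z0 - deriv ?E z0 * ?O z0 \<noteq> 0" using z0(2) by (simp add: W_def)
  have "y z0 = 0" "deriv y z0 = 0"
  proof -
    have "W z0 * V z0 = W z0 * ?U z0"
    proof -
      have "W z0 * V z0 = (W z0 * A) * ?E z0 + (W z0 * B) * ?O z0" by (simp add: V_def algebra_simps)
      also have "\<dots> = W z0 * ?U z0" using z0(2) by (simp add: A_def B_def) (simp add: W_def algebra_simps)
      finally show ?thesis .
    qed
    thus "y z0 = 0" using z0(2) by (simp add: y_def)
    have "W z0 * deriv V z0 = W z0 * deriv ?U z0"
    proof -
      have "W z0 * deriv V z0 = (W z0 * A) * deriv ?E z0 + (W z0 * B) * deriv ?O z0" by (simp add: dV[OF z0(1)] algebra_simps)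
      also have "\<dots> = W z0 * deriv ?U z0" using z0(2) by (simp add: A_def B_def) (simp add: W_def algebra_simps)
      finally show ?thesis .
    qed
    thus "deriv y z0 = 0" using z0(2) by (simp add: dy[OF z0(1)])
  qed
  have nz: "1 - z\<^sup>2 \<noteq> 0" if "z \<in> ?S" for z
    using square_in_slit_plane[OF subsetD[OF half_plane_subset that]] by (auto simp: slit_plane_alt)
  have y0: "y z = 0" if "z \<in> ?S" for z
  proof (rule ode_regular_unique[OF open_half_plane connected_half_plane y_hol])
    show "(\<lambda>z. 2 * (\<mu> + 1) * z / (1 - z\<^sup>2)) holomorphic_on ?S" "(\<lambda>z. - ((\<nu> - \<mu>) * (\<nu> + \<mu> + 1)) / (1 - z\<^sup>2)) holomorphic_on ?S"
      by (intro holomorphic_intros nz; assumption)+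
    fix z assume z: "z \<in> ?S"
    have "(1 - z\<^sup>2) * deriv (deriv y) z = 2 * (\<mu> + 1) * z * deriv y z - (\<nu> - \<mu>) * (\<nu> + \<mu> + 1) * y z"
      using y_ode[OF z] by (simp add: algebra_simps)
    hence "deriv (deriv y) z = (2 * (\<mu> + 1) * z * deriv y z - (\<nu> - \<mu>) * (\<nu> + \<mu> + 1) * y z) / (1 - z\<^sup>2)"
      using nz[OF z] by (simp add: eq_divide_eq mult.commute)
    thus "deriv (deriv y) z = 2 * (\<mu> + 1) * z / (1 - z\<^sup>2) * deriv y z + - ((\<nu> - \<mu>) * (\<nu> + \<mu> + 1)) / (1 - z\<^sup>2) * y z"
      by (simp add: diff_divide_distrib)
  qed (use that z0 \<open>y z0 = 0\<close> \<open>deriv y z0 = 0\<close> in auto)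
  hence UV: "?U z = A * ?E z + B * ?O z" if "z \<in> ?S" for z
  proof -
    have "?U z = V z" using y0[OF that] by (simp add: y_def)
    thus ?thesis by (simp add: V_def)
  qed
  \<comment> \<open>The expansion now holds on the whole half plane, so \<open>A\<close> and, after
    differentiation, \<open>B\<close> can be read off as limits at 0.\<close>
  have "((\<lambda>y. A * ?E (\<i> * of_real (s * y)) + B * ?O (\<i> * of_real (s * y))) \<longlongrightarrow> A * 1 + B * 0) (at_right 0)"
    by (intro tendsto_intros lims)
  moreover have "eventually (\<lambda>y. A * ?E (\<i> * of_real (s * y)) + B * ?O (\<i> * of_real (s * y)) = ?U (\<i> * of_real (s * y))) (at_right 0)"
    using eventually_at_right_less[of "0::real"] by eventually_elim (simp only: UV pathS)
  ultimately have "((\<lambda>y. ?U (\<i> * of_real (s * y))) \<longlongrightarrow> A * 1 + B * 0) (at_right 0)"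
    by (rule Lim_transform_eventually)
  hence A: "A = conn_even \<nu> \<mu> s"
    using tendsto_unique[OF _ _ sol_inf_tendsto[OF c s]] by fastforce
  have dU: "A * deriv ?E z + B * deriv ?O z = deriv ?U z" if "z \<in> ?S" for z
  proof -
    have "eventually (\<lambda>z. ?U z = V z) (nhds z)"
      using eventually_nhds_in_open[OF open_half_plane that] by eventually_elim (simp add: UV V_def)
    hence "deriv ?U z = deriv V z" by (intro deriv_cong_ev) auto
    thus ?thesis by (simp add: dV[OF that])
  qed
  have "((\<lambda>y. A * deriv ?E (\<i> * of_real (s * y)) + B * deriv ?O (\<i> * of_real (s * y))) \<longlongrightarrow> A * 0 + B * 1) (at_right 0)"
    by (intro tendsto_intros lims)
  moreover have "eventually (\<lambda>y. A * deriv ?E (\<i> * of_real (s * y)) + B * deriv ?O (\<i> * of_real (s * y)) =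
       - (\<nu> + \<mu> + 1) * sol_inf \<nu> (\<mu> + 1) (\<i> * of_real (s * y))) (at_right 0)"
    using eventually_at_right_less[of "0::real"] by eventually_elim (simp only: dU pathS sol_inf_deriv[OF c pathS])
  ultimately have l1: "((\<lambda>y. - (\<nu> + \<mu> + 1) * sol_inf \<nu> (\<mu> + 1) (\<i> * of_real (s * y))) \<longlongrightarrow> A * 0 + B * 1) (at_right 0)"
    by (rule Lim_transform_eventually)
  have l2: "((\<lambda>y. - (\<nu> + \<mu> + 1) * sol_inf \<nu> (\<mu> + 1) (\<i> * of_real (s * y))) \<longlongrightarrow> - (\<nu> + \<mu> + 1) * conn_even \<nu> (\<mu> + 1) s) (at_right 0)"
    by (intro tendsto_mult tendsto_const sol_inf_tendsto[OF c s])
  have B: "B = conn_odd \<nu> \<mu> s"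
    using tendsto_unique[OF trivial_limit_at_right_real l1 l2] by (simp only: conn_odd_eq mult_zero_right mult_1_right add_0_left)
  show ?thesis using UV[OF z] unfolding A B .
qed

text \<open>From 1 - z = - z (1 - 1 / z). Both z and 1 - 1 / z lie in the half plane of sign s, so s
  times the sum of their arguments lies in (0, 2 \<pi>), and subtracting s \<pi> from the sum lands
  in the principal range.\<close>

lemma Ln_one_minus:
  assumes s: "s = 1 \<or> s = (-1::real)" and z: "z \<in> half_plane s"
  shows "Ln (1 - z) = Ln z + Ln (1 - 1 / z) - \<i> * of_real (s * pi)"
proof (rule Ln_unique)
  have nz: "z \<noteq> 0" "1 - 1 / z \<noteq> 0" using z inverse_in_double_slit_plane[OF z] by (auto simp: half_plane_def double_slit_plane_alt)
  have "exp (\<i> * of_real (s * pi)) = - 1" using s by (auto simp: exp_minus)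
  thus "exp (Ln z + Ln (1 - 1 / z) - \<i> * of_real (s * pi)) = 1 - z"
    using nz by (simp add: exp_diff exp_add) (simp add: field_simps)
  have im: "s * Im z > 0" "s * Im (1 - 1 / z) > 0"
    using z s nz by (auto simp: half_plane_def Im_divide cmod_power2 [symmetric] divide_simps zero_less_mult_iff)
  have arg: "0 < s * Im (Ln x) \<and> s * Im (Ln x) < pi" if "s * Im x > 0" for x
  proof -
    have x: "x \<noteq> 0" using that by auto
    show ?thesis using s
    proof
      assume "s = 1" thus ?thesis using Im_Ln_pos_lt[OF x] that by auto
    next
      assume "s = -1" thus ?thesis using Im_Ln_pos_le[OF x] Im_Ln_le_pi[OF x] mpi_less_Im_Ln[OF x] that by auto
    qed
  qed
  have "- pi < s * Im (Ln z) + s * Im (Ln (1 - 1 / z)) - pi \<and> s * Im (Ln z) + s * Im (Ln (1 - 1 / z)) - pi < pi"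
    using arg[OF im(1)] arg[OF im(2)] by linarith
  thus "- pi < Im (Ln z + Ln (1 - 1 / z) - \<i> * of_real (s * pi))"
       "Im (Ln z + Ln (1 - 1 / z) - \<i> * of_real (s * pi)) \<le> pi"
    using s by auto
qed

text \<open>The quadratic transformation at t = 1 / z, for which 2 t / (t - 1) = 2 / (1 - z). The
  exponential is the phase between the power of 1 - z and the product of the powers of z and 1 - 1 /
  z.\<close>

theorem sol_inf_eq_moebius_form:
  assumes c: "\<nu> + 3 / 2 \<notin> \<int>\<^sub>\<le>\<^sub>0" and c2: "2 * \<nu> + 2 \<notin> \<int>\<^sub>\<le>\<^sub>0"
    and s: "s = 1 \<or> s = (-1::real)" and z: "z \<in> half_plane s"
  shows "(1 - z) powr (- (\<nu> + \<mu> + 1)) * hyp2F1 (\<nu> + \<mu> + 1) (\<nu> + 1) (2 * \<nu> + 2) (2 / (1 - z)) =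
     exp (\<i> * of_real (s * pi) * (\<nu> + \<mu> + 1)) * sol_inf \<nu> \<mu> z"
proof -
  define b where "b = (\<nu> + \<mu> + 1) / 2"
  have t: "1 / z \<in> double_slit_plane" by (rule inverse_in_double_slit_plane[OF z])
  have nz: "z \<noteq> 0" "1 - 1 / z \<noteq> 0" "1 - z \<noteq> 0" using z t by (auto simp: half_plane_def double_slit_plane_alt)
  have "hyp2F1 (b + 1 / 2) b (\<nu> + 3 / 2) ((1 / z)\<^sup>2) = (1 - 1 / z) powr (- (2 * b)) *
      hyp2F1 (2 * b) (\<nu> + 3 / 2 - 1 / 2) (2 * (\<nu> + 3 / 2) - 1) (2 * (1 / z) / (1 / z - 1))"
    by (rule quadratic_transformation[OF c _ t]) (use c2 in \<open>simp add: algebra_simps\<close>)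
  moreover have "2 * (1 / z) / (1 / z - 1) = 2 / (1 - z)" using nz by (simp add: divide_simps)
  moreover have "b + 1 / 2 = (\<nu> + \<mu> + 2) / 2" "2 * b = \<nu> + \<mu> + 1" "\<nu> + 3 / 2 - 1 / 2 = \<nu> + 1" "2 * (\<nu> + 3 / 2) - 1 = 2 * \<nu> + 2"
    by (simp_all add: b_def field_simps)
  ultimately have 1: "sol_inf \<nu> \<mu> z = z powr (- (\<nu> + \<mu> + 1)) * ((1 - 1 / z) powr (- (\<nu> + \<mu> + 1)) *
     hyp2F1 (\<nu> + \<mu> + 1) (\<nu> + 1) (2 * \<nu> + 2) (2 / (1 - z)))"
    unfolding sol_inf_def b_def by (simp only: power_one_over)
  have "(1 - z) powr (- (\<nu> + \<mu> + 1)) = exp (\<i> * of_real (s * pi) * (\<nu> + \<mu> + 1)) * (z powr (- (\<nu> + \<mu> + 1)) * (1 - 1 / z) powr (- (\<nu> + \<mu> + 1)))"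
    using nz by (simp add: powr_def Ln_one_minus[OF s z]) (simp flip: exp_add add: algebra_simps)
  thus ?thesis unfolding 1 by (simp only: mult_ac)
qed

subsection \<open>Gamma function identities\<close>

lemma exp_sign_pi:
  assumes "s = 1 \<or> s = (-1::real)"
  shows "exp (\<i> * of_real (s * pi) * w) = cos (of_real pi * w) + of_real s * \<i> * sin (of_real pi * w)"
  using assms
proof
  assume "s = 1" thus ?thesis using exp_Euler[of "of_real pi * w"] by (simp add: mult_ac)
next
  assume "s = -1" thus ?thesis using exp_Euler[of "- (of_real pi * w)"] by (simp add: mult_ac)
qed

text \<open>At the poles of Gamma both sides vanish. These cases are included because (\<nu> - \<mu>
  + 1) / 2, to which this is applied, may be such a pole.\<close>

lemma rGamma_duplication:
  fixes z :: complex
  shows "rGamma (2 * z) = exp ((1 - 2 * z) * of_real (ln 2)) * of_real (sqrt pi) * (rGamma z * rGamma (z + 1 / 2))"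
proof (cases "z \<in> \<int>\<^sub>\<le>\<^sub>0 \<or> z + 1 / 2 \<in> \<int>\<^sub>\<le>\<^sub>0")
  case True
  have "2 * z \<in> \<int>\<^sub>\<le>\<^sub>0"
    using True
  proof
    assume "z \<in> \<int>\<^sub>\<le>\<^sub>0"
    then obtain n where n: "z = of_int n" "n \<le> 0" by (rule nonpos_Ints_cases)
    hence "2 * z = of_int (2 * n)" by simp
    thus ?thesis using n nonpos_Ints_of_int[of "2 * n"] by simp
  next
    assume "z + 1 / 2 \<in> \<int>\<^sub>\<le>\<^sub>0"
    then obtain n where n: "z + 1 / 2 = of_int n" "n \<le> 0" by (rule nonpos_Ints_cases)
    hence "2 * z = of_int (2 * n - 1)" by (simp add: field_simps)
    thus ?thesis using n nonpos_Ints_of_int[of "2 * n - 1"] by simp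
  qed
  hence "rGamma (2 * z) = 0" by (rule rGamma_nonpos_Int)
  moreover have "rGamma z * rGamma (z + 1 / 2) = 0"
    using True rGamma_nonpos_Int by fastforce
  ultimately show ?thesis by simp
next
  case False
  hence "Gamma z * Gamma (z + 1 / 2) = exp ((1 - 2 * z) * of_real (ln 2)) * of_real (sqrt pi) * Gamma (2 * z)"
    by (intro Gamma_legendre_duplication) auto
  moreover have "Gamma z * Gamma (z + 1 / 2) \<noteq> 0"
    using False by (simp add: Gamma_eq_zero_iff)
  ultimately have "Gamma (2 * z) \<noteq> 0" by auto
  moreover note \<open>Gamma z * Gamma (z + 1 / 2) = _\<close>
  ultimately show ?thesis
    using False by (simp add: rGamma_inverse_Gamma field_simps Gamma_eq_zero_iff)
qed

lemma rGamma_reflect: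
  "rGamma (z :: complex) * rGamma (1 - z) = sin (of_real pi * z) / of_real pi"
  "rGamma (z + 1 / 2) * rGamma (1 / 2 - z) = cos (of_real pi * z) / of_real pi"
proof -
  show "rGamma (z :: complex) * rGamma (1 - z) = sin (of_real pi * z) / of_real pi" for z
    by (rule rGamma_reflection_complex)
  from this[of "z + 1 / 2"] show "rGamma (z + 1 / 2) * rGamma (1 / 2 - z) = cos (of_real pi * z) / of_real pi"
    by (simp add: ring_distribs sin_add)
qed

text \<open>What remains of the even comparison once the Gamma factors have cancelled. The letters
  are cosines and sines of \<pi> a and \<pi> d, where a = (\<nu> + \<mu> + 1) / 2 and d = (\<nu> -
  \<mu> + 1) / 2, and \<open>si\<close> is i or -i. Then ca cd - sa sd is -cos(\<pi> \<nu>), ca cd +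
  sa sd is cos(\<pi> \<mu>), and 2 sd cd is sin(\<pi> (\<mu> - \<nu>)). \<open>trig_odd\<close> is
  the odd counterpart.\<close>

lemma trig_even:
  fixes ca sa cd sd si :: complex
  assumes "sa\<^sup>2 + ca\<^sup>2 = 1" "sd\<^sup>2 + cd\<^sup>2 = 1" "si\<^sup>2 = -1"
  shows "ca * (ca * cd - sa * sd) =
     (cd - si * sd) * ((ca * cd + sa * sd) * (ca * cd - sa * sd) + si * (sd * cd)) - (ca + si * sa) * (sd * sa)"
  using assms by algebra

lemma trig_odd:
  fixes ca sa cd sd si :: complex
  assumes "sa\<^sup>2 + ca\<^sup>2 = 1" "sd\<^sup>2 + cd\<^sup>2 = 1" "si\<^sup>2 = -1"
  shows "sa * (ca * cd - sa * sd) =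
     si * ((cd - si * sd) * ((ca * cd + sa * sd) * (ca * cd - sa * sd) + si * (sd * cd)) - (ca + si * sa) * (cd * ca))"
  using assms by algebra

text \<open>The constant in front of \<open>legendre_Q\<close> without the phase exp (i \<pi>
  \<mu>).\<close>

definition ferrers_factor :: "complex \<Rightarrow> complex \<Rightarrow> complex" where
  "ferrers_factor \<nu> \<mu> = of_real (sqrt pi) * Gamma (\<nu> + \<mu> + 1) / 2 powr (\<nu> + 1) * rGamma (\<nu> + 3 / 2)"

text \<open>The constants of the two terms are kept literally as in the final formula, with a
  complex sign, so that unfolding them closes the proof.\<close>

definition ferrers_coeff1 :: "complex \<Rightarrow> complex \<Rightarrow> complex \<Rightarrow> complex" where
  "ferrers_coeff1 \<nu> \<mu> s = 2 powr \<nu> * exp (- s * of_real pi * \<i> * (\<nu> + 1)) *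
      (cos (of_real pi * \<mu>) - s * \<i> * (sin (of_real pi * (\<mu> - \<nu>)) / (2 * cos (of_real pi * \<nu>)))) *
      (Gamma (\<nu> + 1) * Gamma (\<nu> + \<mu> + 1) / Gamma (2 * \<nu> + 2))"

definition ferrers_coeff2 :: "complex \<Rightarrow> complex \<Rightarrow> complex \<Rightarrow> complex" where
  "ferrers_coeff2 \<nu> \<mu> s = s * \<i> * of_real pi * 2 powr (- \<nu> - 2) * exp (s * of_real pi * \<i> * \<nu>) *
      (1 / cos (of_real pi * \<nu>)) *
      (Gamma (- \<nu>) / Gamma (- 2 * \<nu>) * rGamma (\<nu> - \<mu> + 1))"

locale ferrers_params =
  fixes \<nu> \<mu> :: complex
  assumes \<nu>\<mu>: "\<nu> + \<mu> \<notin> \<int>\<^sub>\<le>\<^sub>0" and \<nu>: "2 * \<nu> \<notin> \<int>"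
begin

lemma two_\<nu>: "2 * \<nu> + of_int n \<notin> \<int>\<^sub>\<le>\<^sub>0" "- 2 * \<nu> + of_int n \<notin> \<int>\<^sub>\<le>\<^sub>0"
proof -
  have "2 * \<nu> + of_int n \<notin> \<int>" using \<nu> Ints_diff[of "2 * \<nu> + of_int n" "of_int n"] by auto
  thus "2 * \<nu> + of_int n \<notin> \<int>\<^sub>\<le>\<^sub>0" using nonpos_Ints_Int by blast
  have "- 2 * \<nu> + of_int n \<notin> \<int>"
    using \<nu> Ints_diff[of "of_int n" "- 2 * \<nu> + of_int n"] by auto
  thus "- 2 * \<nu> + of_int n \<notin> \<int>\<^sub>\<le>\<^sub>0" using nonpos_Ints_Int by blast
qed

lemma \<nu>_half: "z \<notin> \<int>\<^sub>\<le>\<^sub>0" if "2 * z = 2 * \<nu> + of_int n \<or> 2 * z = - 2 * \<nu> + of_int n"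
proof
  assume "z \<in> \<int>\<^sub>\<le>\<^sub>0"
  then obtain m where m: "z = of_int m" "m \<le> 0" by (rule nonpos_Ints_cases)
  hence "2 * z \<in> \<int>\<^sub>\<le>\<^sub>0" using nonpos_Ints_of_int[of "2 * m"] by simp
  thus False using that two_\<nu>[of n] by auto
qed

lemma params:
  "\<nu> + 3 / 2 \<notin> \<int>\<^sub>\<le>\<^sub>0" "1 / 2 - \<nu> \<notin> \<int>\<^sub>\<le>\<^sub>0" "\<nu> + 1 \<notin> \<int>\<^sub>\<le>\<^sub>0" "- \<nu> \<notin> \<int>\<^sub>\<le>\<^sub>0"
  "2 * \<nu> + 2 \<notin> \<int>\<^sub>\<le>\<^sub>0" "- 2 * \<nu> \<notin> \<int>\<^sub>\<le>\<^sub>0"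
proof -
  show "\<nu> + 3 / 2 \<notin> \<int>\<^sub>\<le>\<^sub>0" by (rule \<nu>_half[where n = 3]) simp
  show "1 / 2 - \<nu> \<notin> \<int>\<^sub>\<le>\<^sub>0" by (rule \<nu>_half[where n = 1]) simp
  show "\<nu> + 1 \<notin> \<int>\<^sub>\<le>\<^sub>0" by (rule \<nu>_half[where n = 2]) simp
  show "- \<nu> \<notin> \<int>\<^sub>\<le>\<^sub>0" by (rule \<nu>_half[where n = 0]) simp
  show "2 * \<nu> + 2 \<notin> \<int>\<^sub>\<le>\<^sub>0" "- 2 * \<nu> \<notin> \<int>\<^sub>\<le>\<^sub>0" using two_\<nu>(1)[of 2] two_\<nu>(2)[of 0] by simp_all
qed

text \<open>By the reflection formula a zero of the cosine would make \<nu> + 1/2 or 1/2 - \<nu> a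
  pole of Gamma.\<close>

lemma cos_\<nu>: "cos (of_real pi * \<nu>) \<noteq> 0"
proof
  assume "cos (of_real pi * \<nu>) = 0"
  hence "rGamma (\<nu> + 1 / 2) * rGamma (1 / 2 - \<nu>) = 0" by (simp add: rGamma_reflect(2))
  moreover have "\<nu> + 1 / 2 \<notin> \<int>\<^sub>\<le>\<^sub>0" by (rule \<nu>_half[where n = 1]) simp
  ultimately show False using params by (simp add: rGamma_eq_zero_iff)
qed

text \<open>In terms of a and d, the exchange of \<nu> with - \<nu> - 1 sends a to 1/2 - d and d to
  1/2 - a, while a + d = \<nu> + 1 and a - d = \<mu>. All Gamma and trigonometric factors are
  expressed through these two numbers.\<close>

definition a where "a = (\<nu> + \<mu> + 1) / 2"
definition d where "d = (\<nu> - \<mu> + 1) / 2"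

lemma \<nu>\<mu>_eq: "\<nu> + \<mu> + 1 = 2 * a" "\<nu> - \<mu> + 1 = 2 * d" "\<mu> - \<nu> = 1 - 2 * d"
  by (simp_all add: a_def d_def field_simps)

lemma a_params: "a \<notin> \<int>\<^sub>\<le>\<^sub>0" "a + 1 / 2 \<notin> \<int>\<^sub>\<le>\<^sub>0" "2 * a \<notin> \<int>\<^sub>\<le>\<^sub>0"
proof -
  have *: "z \<notin> \<int>\<^sub>\<le>\<^sub>0" if "2 * z = \<nu> + \<mu> + 1 \<or> 2 * z = \<nu> + \<mu> + 2" for z
  proof
    assume "z \<in> \<int>\<^sub>\<le>\<^sub>0"
    then obtain m where m: "z = of_int m" "m \<le> 0" by (rule nonpos_Ints_cases)
    have "\<nu> + \<mu> = of_int (2 * m - 1) \<or> \<nu> + \<mu> = of_int (2 * m - 2)"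
      using that m(1) by (auto simp: algebra_simps)
    thus False using \<nu>\<mu> m(2) nonpos_Ints_of_int[of "2 * m - 1"] nonpos_Ints_of_int[of "2 * m - 2"] by auto
  qed
  show "a \<notin> \<int>\<^sub>\<le>\<^sub>0" "a + 1 / 2 \<notin> \<int>\<^sub>\<le>\<^sub>0" by (rule *; simp add: a_def field_simps)+
  show "2 * a \<notin> \<int>\<^sub>\<le>\<^sub>0"
    using plus_of_nat_notin_nonpos_Ints[OF \<nu>\<mu>, of 1] by (simp add: \<nu>\<mu>_eq(1))
qed

lemma two_powr: "2 powr z = exp (z * of_real (ln 2))" for z :: complex
proof -
  have "Ln 2 = complex_of_real (ln 2)" using Ln_of_real[of 2] by simp
  thus ?thesis by (simp add: powr_def)
qed

lemma two_powr_shift: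
  "2 powr (\<nu> + 1) = 2 * 2 powr \<nu>" "2 powr (- \<nu> - 2) = 1 / (4 * 2 powr \<nu>)"
  "exp ((1 - 2 * (\<nu> + 1)) * of_real (ln 2)) = 1 / (2 * (2 powr \<nu>)\<^sup>2)"
  "exp ((1 - 2 * (- \<nu>)) * of_real (ln 2)) = 2 * (2 powr \<nu>)\<^sup>2"
  "exp ((1 - 2 * a) * of_real (ln 2)) * exp ((1 - 2 * d) * of_real (ln 2)) = 1 / (2 powr \<nu>)\<^sup>2"
proof -
  define l where "l = complex_of_real (ln 2)"
  have l: "exp l = 2" by (simp add: l_def exp_of_real)
  have "exp (l + l) = 4" unfolding exp_add l by simp
  hence l2: "exp (2 * l) = 4" "exp (l * 2) = 4" by (simp_all only: mult_2 mult_2_right)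
  show "2 powr (\<nu> + 1) = 2 * 2 powr \<nu>" "2 powr (- \<nu> - 2) = 1 / (4 * 2 powr \<nu>)"
    unfolding two_powr l_def [symmetric] by (simp_all add: ring_distribs exp_add exp_diff exp_minus l l2 field_simps)
  show "exp ((1 - 2 * (\<nu> + 1)) * of_real (ln 2)) = 1 / (2 * (2 powr \<nu>)\<^sup>2)"
  proof -
    have "(1 - 2 * (\<nu> + 1)) * l = - (l + \<nu> * l + \<nu> * l)" by (simp add: algebra_simps)
    thus ?thesis unfolding two_powr l_def [symmetric]
      by (simp only: exp_minus exp_add l) (simp add: power2_eq_square field_simps)
  qed
  show "exp ((1 - 2 * (- \<nu>)) * of_real (ln 2)) = 2 * (2 powr \<nu>)\<^sup>2"
  proof -
    have "(1 - 2 * (- \<nu>)) * l = (l + \<nu> * l + \<nu> * l)" by (simp add: algebra_simps)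
    thus ?thesis unfolding two_powr l_def [symmetric]
      by (simp only: exp_add l) (simp add: power2_eq_square)
  qed
  show "exp ((1 - 2 * a) * of_real (ln 2)) * exp ((1 - 2 * d) * of_real (ln 2)) = 1 / (2 powr \<nu>)\<^sup>2"
  proof -
    have "(1 - 2 * a) * l + (1 - 2 * d) * l = - (\<nu> * l + \<nu> * l)" by (simp add: a_def d_def field_simps)
    thus ?thesis unfolding two_powr l_def [symmetric] exp_add [symmetric]
      by (simp only: exp_minus exp_add) (simp add: power2_eq_square field_simps)
  qed
qed

text \<open>Duplication at \<nu> + 1 and at - \<nu>. The reciprocal Gamma factor that is left
  cancels against the Gamma factor of the corresponding connection coefficient.\<close>

lemma Gamma_ratio:
  "Gamma (\<nu> + 1) / Gamma (2 * \<nu> + 2) = of_real (sqrt pi) / (2 * (2 powr \<nu>)\<^sup>2) * rGamma (\<nu> + 3 / 2)"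
  "Gamma (- \<nu>) / Gamma (- 2 * \<nu>) = 2 * (2 powr \<nu>)\<^sup>2 * of_real (sqrt pi) * rGamma (1 / 2 - \<nu>)"
proof -
  have *: "Gamma z / Gamma (2 * z) = exp ((1 - 2 * z) * of_real (ln 2)) * of_real (sqrt pi) * rGamma (z + 1 / 2)"
    if "z \<notin> \<int>\<^sub>\<le>\<^sub>0" for z :: complex
  proof -
    have "Gamma z / Gamma (2 * z) = Gamma z * rGamma (2 * z)" by (simp add: rGamma_inverse_Gamma field_simps)
    also have "\<dots> = exp ((1 - 2 * z) * of_real (ln 2)) * of_real (sqrt pi) * rGamma (z + 1 / 2) * (Gamma z * rGamma z)"
      unfolding rGamma_duplication by (simp only: mult_ac)
    also have "Gamma z * rGamma z = 1" using that by (simp add: rGamma_inverse_Gamma Gamma_eq_zero_iff)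
    finally show ?thesis by simp
  qed
  show "Gamma (\<nu> + 1) / Gamma (2 * \<nu> + 2) = of_real (sqrt pi) / (2 * (2 powr \<nu>)\<^sup>2) * rGamma (\<nu> + 3 / 2)"
  proof -
    have e: "2 * (\<nu> + 1) = 2 * \<nu> + 2" "\<nu> + 1 + 1 / 2 = \<nu> + 3 / 2" by simp_all
    show ?thesis using *[OF params(3)] unfolding two_powr_shift(3) unfolding e by simp
  qed
  show "Gamma (- \<nu>) / Gamma (- 2 * \<nu>) = 2 * (2 powr \<nu>)\<^sup>2 * of_real (sqrt pi) * rGamma (1 / 2 - \<nu>)"
  proof -
    have e: "- 2 * \<nu> = 2 * (- \<nu>)" "- \<nu> + 1 / 2 = 1 / 2 - \<nu>" by simp_all
    show ?thesis using *[OF params(4)] unfolding two_powr_shift(4) unfolding e .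
  qed
qed

text \<open>Converts the reciprocal Gamma factors that come with - \<nu> - 1 into those that come
  with \<nu>, so that both terms of the formula acquire the same Gamma product and only sines and
  cosines remain to be compared.\<close>

lemma Gamma_products:
  "rGamma (2 * d) * rGamma (1 - d) * rGamma (1 - a) =
     Gamma (2 * a) * rGamma (a + 1 / 2) * rGamma (d + 1 / 2) * sin (of_real pi * a) * sin (of_real pi * d) / (of_real pi * (2 powr \<nu>)\<^sup>2)"
  "rGamma (2 * d) * rGamma (1 / 2 - d) * rGamma (1 / 2 - a) =
     Gamma (2 * a) * rGamma a * rGamma d * cos (of_real pi * a) * cos (of_real pi * d) / (of_real pi * (2 powr \<nu>)\<^sup>2)"
proof -
  define p where "p = complex_of_real (sqrt pi)"
  have p: "p * p = of_real pi" by (simp add: p_def flip: of_real_mult)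
  have pi: "of_real pi \<noteq> (0 :: complex)" by simp
  define Ea Ed where "Ea = exp ((1 - 2 * a) * complex_of_real (ln 2))" and "Ed = exp ((1 - 2 * d) * complex_of_real (ln 2))"
  have E: "Ea * Ed = 1 / (2 powr \<nu>)\<^sup>2" unfolding Ea_def Ed_def by (rule two_powr_shift)
  \<comment> \<open>A factor 1, inserted below to supply the partners that the reflection formula
    needs at a.\<close>
  have ra: "Gamma (2 * a) * (Ea * p * (rGamma a * rGamma (a + 1 / 2))) = 1"
  proof -
    have "Gamma (2 * a) * rGamma (2 * a) = 1" using a_params by (simp add: rGamma_inverse_Gamma Gamma_eq_zero_iff)
    thus ?thesis unfolding rGamma_duplication [of a] Ea_def p_def .
  qed
  have rd: "rGamma (2 * d) = Ed * p * (rGamma d * rGamma (d + 1 / 2))"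
    unfolding Ed_def p_def by (rule rGamma_duplication)
  have "rGamma (2 * d) * rGamma (1 - d) * rGamma (1 - a) =
      (Ed * p * (rGamma d * rGamma (d + 1 / 2))) * rGamma (1 - d) * rGamma (1 - a) * (Gamma (2 * a) * (Ea * p * (rGamma a * rGamma (a + 1 / 2))))"
    unfolding ra rd by simp
  also have "\<dots> = Gamma (2 * a) * rGamma (a + 1 / 2) * rGamma (d + 1 / 2) * (Ea * Ed) * (p * p) * (rGamma a * rGamma (1 - a)) * (rGamma d * rGamma (1 - d))"
    by (simp only: mult_ac)
  also have "\<dots> = Gamma (2 * a) * rGamma (a + 1 / 2) * rGamma (d + 1 / 2) * sin (of_real pi * a) * sin (of_real pi * d) / (of_real pi * (2 powr \<nu>)\<^sup>2)"
    unfolding E p rGamma_reflect using pi by (simp add: field_simps)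
  finally show "rGamma (2 * d) * rGamma (1 - d) * rGamma (1 - a) =
     Gamma (2 * a) * rGamma (a + 1 / 2) * rGamma (d + 1 / 2) * sin (of_real pi * a) * sin (of_real pi * d) / (of_real pi * (2 powr \<nu>)\<^sup>2)" .
  have "rGamma (2 * d) * rGamma (1 / 2 - d) * rGamma (1 / 2 - a) =
      (Ed * p * (rGamma d * rGamma (d + 1 / 2))) * rGamma (1 / 2 - d) * rGamma (1 / 2 - a) * (Gamma (2 * a) * (Ea * p * (rGamma a * rGamma (a + 1 / 2))))"
    unfolding ra rd by simp
  also have "\<dots> = Gamma (2 * a) * rGamma a * rGamma d * (Ea * Ed) * (p * p) * (rGamma (a + 1 / 2) * rGamma (1 / 2 - a)) * (rGamma (d + 1 / 2) * rGamma (1 / 2 - d))"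
    by (simp only: mult_ac)
  also have "\<dots> = Gamma (2 * a) * rGamma a * rGamma d * cos (of_real pi * a) * cos (of_real pi * d) / (of_real pi * (2 powr \<nu>)\<^sup>2)"
    unfolding E p rGamma_reflect using pi by (simp add: field_simps)
  finally show "rGamma (2 * d) * rGamma (1 / 2 - d) * rGamma (1 / 2 - a) =
     Gamma (2 * a) * rGamma a * rGamma d * cos (of_real pi * a) * cos (of_real pi * d) / (of_real pi * (2 powr \<nu>)\<^sup>2)" .
qed

end

text \<open>The algebraic skeleton shared by the even and the odd comparison. \<open>T\<close> is 2
  powr \<nu>, \<open>P\<close> is \<pi> and \<open>p\<close> its root, \<open>G\<close> is Gamma (2
  a), each \<open>g\<close> and \<open>h\<close> are reciprocal Gamma values, \<open>e\<close>,
  \<open>f\<close>, \<open>k\<close> are phases, and \<open>- q\<close> is cos(\<pi> \<nu>). After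
  cancellation both sides have the common factor P G x1 x2 / (2 T), and what is left is
  \<open>trig\<close> divided by \<open>q\<close>.\<close>

lemma coeff_algebra:
  fixes T P X p :: complex
  assumes "T \<noteq> 0" "P \<noteq> 0" "q \<noteq> 0" "p * p = P" "g1 * h1 = 1" "g2 * h2 = 1" "si * si = -1"
    and e: "e1 * f1 * k1 = u1" "e2 * f2 * k2 = - si * u2"
    and prod: "r2 * t1 * t2 = G * x1 * x2 * y1 * y2 / (P * T\<^sup>2)"
    and trig: "ca * q = u1 * (m * q + si * w) - u2 * (y2 * y1)"
  shows "p * G / (2 * T) * h1 / 2 * (2 * ca * (g1 * p * x1 * x2)) =
     T * e1 * (m + si * (w / q)) * (p / (2 * T\<^sup>2) * h1 * G) * f1 * (k1 * (g1 * p * x1 * x2))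
   + si * P * (1 / (4 * T)) * e2 * (1 / (- q)) * (2 * T\<^sup>2 * p * h2 * r2) * f2 * (k2 * (g2 * p * t1 * t2))"
proof -
  have 1: "p * G / (2 * T) * h1 / 2 * (2 * ca * (g1 * p * x1 * x2)) = (p * p) * (g1 * h1) * (G * x1 * x2) / (2 * T) * ca"
    by simp
  have 2: "T * e1 * (m + si * (w / q)) * (p / (2 * T\<^sup>2) * h1 * G) * f1 * (k1 * (g1 * p * x1 * x2))
     = (e1 * f1 * k1) * (m + si * (w / q)) * (p * p) * (g1 * h1) * (G * x1 * x2) / (2 * T)"
    using assms(1) by (simp add: power2_eq_square)
  have 3: "si * P * (1 / (4 * T)) * e2 * (1 / (- q)) * (2 * T\<^sup>2 * p * h2 * r2) * f2 * (k2 * (g2 * p * t1 * t2))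
     = - (si * P * T * (e2 * f2 * k2) * (p * p) * (g2 * h2) * (r2 * t1 * t2) / (2 * q))"
    using assms(1) by (simp add: power2_eq_square)
  have 4: "- (si * P * T * (- si * u2) * P * 1 * (G * x1 * x2 * y1 * y2 / (P * T\<^sup>2)) / (2 * q))
     = (si * si) * (u2 * (y2 * y1) / q) * (P * (G * x1 * x2) / (2 * T))"
    using assms(1,2) by (simp add: power2_eq_square mult_ac)
  have 5: "ca = u1 * (m + si * (w / q)) - u2 * (y2 * y1) / q"
  proof -
    have "ca = (u1 * (m * q + si * w) - u2 * (y2 * y1)) / q" using trig assms(3) by (simp add: eq_divide_eq)
    also have "\<dots> = u1 * (m + si * (w / q)) - u2 * (y2 * y1) / q" using assms(3) by (simp add: diff_divide_distrib add_divide_distrib algebra_simps)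
    finally show ?thesis .
  qed
  show ?thesis unfolding 1 2 3 e prod assms(4-6) 4 assms(7) by (subst 5) (simp add: algebra_simps)
qed

context ferrers_params begin

lemma trig_\<nu>\<mu>:
  "cos (of_real pi * \<nu>) = - (cos (of_real pi * a) * cos (of_real pi * d) - sin (of_real pi * a) * sin (of_real pi * d))"
  "cos (of_real pi * \<mu>) = cos (of_real pi * a) * cos (of_real pi * d) + sin (of_real pi * a) * sin (of_real pi * d)"
  "sin (of_real pi * (\<mu> - \<nu>)) = 2 * (sin (of_real pi * d) * cos (of_real pi * d))"
proof -
  have "of_real pi * \<nu> = of_real pi * a + of_real pi * d - of_real pi"
    by (simp add: a_def d_def field_simps)
  thus "cos (of_real pi * \<nu>) = - (cos (of_real pi * a) * cos (of_real pi * d) - sin (of_real pi * a) * sin (of_real pi * d))"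
    by (simp only: cos_add cos_diff) (simp add: cos_add)
  have "of_real pi * \<mu> = of_real pi * a - of_real pi * d"
    by (simp add: a_def d_def field_simps)
  thus "cos (of_real pi * \<mu>) = cos (of_real pi * a) * cos (of_real pi * d) + sin (of_real pi * a) * sin (of_real pi * d)"
    by (simp only: cos_diff)
  have "of_real pi * (\<mu> - \<nu>) = of_real pi - (of_real pi * d + of_real pi * d)"
    by (simp add: d_def field_simps)
  thus "sin (of_real pi * (\<mu> - \<nu>)) = 2 * (sin (of_real pi * d) * cos (of_real pi * d))"
    by (simp only: sin_diff sin_add) simp
qed

lemma ferrers_factor_eq:
  "ferrers_factor \<nu> \<mu> = of_real (sqrt pi) * Gamma (2 * a) / (2 * 2 powr \<nu>) * rGamma (\<nu> + 3 / 2)"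
  unfolding ferrers_factor_def two_powr_shift \<nu>\<mu>_eq(1) ..

lemma ferrers_coeff1_eq:
  "ferrers_coeff1 \<nu> \<mu> (of_real r) = 2 powr \<nu> * exp (\<i> * of_real (r * pi) * (- (a + d))) *
     (cos (of_real pi * \<mu>) + of_real r * \<i> * (sin (of_real pi * d) * cos (of_real pi * d) / (- cos (of_real pi * \<nu>)))) *
     (of_real (sqrt pi) / (2 * (2 powr \<nu>)\<^sup>2) * rGamma (\<nu> + 3 / 2) * Gamma (2 * a))"
proof -
  have e: "- of_real r * of_real pi * \<i> * (\<nu> + 1) = \<i> * of_real (r * pi) * (- (a + d))"
    by (simp add: a_def d_def field_simps)
  have g: "Gamma (\<nu> + 1) * Gamma (\<nu> + \<mu> + 1) / Gamma (2 * \<nu> + 2) = Gamma (\<nu> + 1) / Gamma (2 * \<nu> + 2) * Gamma (\<nu> + \<mu> + 1)"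
    by simp
  have c: "cos (of_real pi * \<mu>) - of_real r * \<i> * (2 * x / (2 * y)) = cos (of_real pi * \<mu>) + of_real r * \<i> * (x / - y)" for x y :: complex
    by simp
  show ?thesis unfolding ferrers_coeff1_def e g unfolding Gamma_ratio \<nu>\<mu>_eq(1) trig_\<nu>\<mu>(3) c ..
qed

lemma ferrers_coeff2_eq:
  "ferrers_coeff2 \<nu> \<mu> (of_real r) = of_real r * \<i> * of_real pi * (1 / (4 * 2 powr \<nu>)) * exp (\<i> * of_real (r * pi) * (a + d - 1)) *
     (1 / cos (of_real pi * \<nu>)) * (2 * (2 powr \<nu>)\<^sup>2 * of_real (sqrt pi) * rGamma (1 / 2 - \<nu>) * rGamma (2 * d))"
proof -
  have e: "of_real r * of_real pi * \<i> * \<nu> = \<i> * of_real (r * pi) * (a + d - 1)"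
    by (simp add: a_def d_def field_simps)
  show ?thesis unfolding ferrers_coeff2_def e Gamma_ratio two_powr_shift \<nu>\<mu>_eq(2) ..
qed

lemma conn_eq:
  "conn_even \<nu> \<mu> r = exp (\<i> * of_real (r * pi) * (- a)) * (Gamma (\<nu> + 3 / 2) * of_real (sqrt pi) * rGamma (a + 1 / 2) * rGamma (d + 1 / 2))"
  "conn_even (- \<nu> - 1) \<mu> r = exp (\<i> * of_real (r * pi) * (- (1 / 2 - d))) * (Gamma (1 / 2 - \<nu>) * of_real (sqrt pi) * rGamma (1 - d) * rGamma (1 - a))"
  "conn_odd \<nu> \<mu> r = - 2 * (exp (\<i> * of_real (r * pi) * (- (a + 1 / 2))) * (Gamma (\<nu> + 3 / 2) * of_real (sqrt pi) * rGamma a * rGamma d))"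
  "conn_odd (- \<nu> - 1) \<mu> r = - 2 * (exp (\<i> * of_real (r * pi) * (- (1 - d))) * (Gamma (1 / 2 - \<nu>) * of_real (sqrt pi) * rGamma (1 / 2 - d) * rGamma (1 / 2 - a)))"
proof -
  have "- (\<nu> + \<mu> + 1) * (\<i> * of_real (r * pi / 2)) = \<i> * of_real (r * pi) * (- a)"
     "(\<nu> + \<mu> + 2) / 2 = a + 1 / 2" "(\<nu> - \<mu> + 2) / 2 = d + 1 / 2"
    by (simp_all add: a_def d_def field_simps)
  thus "conn_even \<nu> \<mu> r = exp (\<i> * of_real (r * pi) * (- a)) * (Gamma (\<nu> + 3 / 2) * of_real (sqrt pi) * rGamma (a + 1 / 2) * rGamma (d + 1 / 2))"
    unfolding conn_even_def by (simp only: mult.assoc)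
  have "- (- \<nu> - 1 + \<mu> + 1) * (\<i> * of_real (r * pi / 2)) = \<i> * of_real (r * pi) * (- (1 / 2 - d))"
     "(- \<nu> - 1 + \<mu> + 2) / 2 = 1 - d" "(- \<nu> - 1 - \<mu> + 2) / 2 = 1 - a" "- \<nu> - 1 + 3 / 2 = 1 / 2 - \<nu>"
    by (simp_all add: a_def d_def field_simps)
  thus "conn_even (- \<nu> - 1) \<mu> r = exp (\<i> * of_real (r * pi) * (- (1 / 2 - d))) * (Gamma (1 / 2 - \<nu>) * of_real (sqrt pi) * rGamma (1 - d) * rGamma (1 - a))"
    unfolding conn_even_def by (simp only: mult.assoc)
  have "- (\<nu> + \<mu> + 2) * (\<i> * of_real (r * pi / 2)) = \<i> * of_real (r * pi) * (- (a + 1 / 2))"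
     "(\<nu> + \<mu> + 1) / 2 = a" "(\<nu> - \<mu> + 1) / 2 = d"
    by (simp_all add: a_def d_def field_simps)
  thus "conn_odd \<nu> \<mu> r = - 2 * (exp (\<i> * of_real (r * pi) * (- (a + 1 / 2))) * (Gamma (\<nu> + 3 / 2) * of_real (sqrt pi) * rGamma a * rGamma d))"
    unfolding conn_odd_def by (simp only: mult.assoc)
  have "- (- \<nu> - 1 + \<mu> + 2) * (\<i> * of_real (r * pi / 2)) = \<i> * of_real (r * pi) * (- (1 - d))"
     "(- \<nu> - 1 + \<mu> + 1) / 2 = 1 / 2 - d" "(- \<nu> - 1 - \<mu> + 1) / 2 = 1 / 2 - a" "- \<nu> - 1 + 3 / 2 = 1 / 2 - \<nu>"
    by (simp_all add: a_def d_def field_simps)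
  thus "conn_odd (- \<nu> - 1) \<mu> r = - 2 * (exp (\<i> * of_real (r * pi) * (- (1 - d))) * (Gamma (1 / 2 - \<nu>) * of_real (sqrt pi) * rGamma (1 / 2 - d) * rGamma (1 / 2 - a)))"
    unfolding conn_odd_def by (simp only: mult.assoc)
qed

text \<open>Each product joins three phases: that of the coefficient in the formula, that of passing
  from powers of z to powers of 1 - z, and that of the connection coefficient. They collapse to
  \<open>E (- d)\<close> or \<open>E a\<close>, up to a factor 1, -1 or \<open>- si\<close>.\<close>

lemma exp_products:
  fixes r :: real
  assumes r: "r = 1 \<or> r = -1"
  defines "E \<equiv> \<lambda>w. exp (\<i> * of_real (r * pi) * w)" and "si \<equiv> of_real r * \<i>"
  shows "E (- (a + d)) * E (2 * a) * E (- a) = cos (of_real pi * d) - si * sin (of_real pi * d)"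
    "E (- (a + d)) * E (2 * a) * E (- (a + 1 / 2)) = - si * (cos (of_real pi * d) - si * sin (of_real pi * d))"
    "E (a + d - 1) * E (1 - 2 * d) * E (- (1 / 2 - d)) = - si * (cos (of_real pi * a) + si * sin (of_real pi * a))"
    "E (a + d - 1) * E (1 - 2 * d) * E (- (1 - d)) = - (cos (of_real pi * a) + si * sin (of_real pi * a))"
proof -
  have E: "E w = cos (of_real pi * w) + si * sin (of_real pi * w)" for w
    unfolding E_def si_def by (rule exp_sign_pi[OF r])
  have add: "E v * E w = E (v + w)" for v w by (simp add: E_def ring_distribs exp_add)
  have E1: "E (- 1) = - 1" by (simp add: E)
  have Eh: "E (- (1 / 2)) = - si" by (simp add: E)
  have "E (- (a + d)) * E (2 * a) * E (- a) = E (- d)" by (simp add: add)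
  thus "E (- (a + d)) * E (2 * a) * E (- a) = cos (of_real pi * d) - si * sin (of_real pi * d)"
    by (simp add: E)
  have "E (- (a + d)) * E (2 * a) * E (- (a + 1 / 2)) = E (- (1 / 2)) * E (- d)" unfolding add by (rule arg_cong[of _ _ E]) simp
  thus "E (- (a + d)) * E (2 * a) * E (- (a + 1 / 2)) = - si * (cos (of_real pi * d) - si * sin (of_real pi * d))"
    unfolding Eh by (simp add: E)
  have "E (a + d - 1) * E (1 - 2 * d) * E (- (1 / 2 - d)) = E (- (1 / 2)) * E a" unfolding add by (rule arg_cong[of _ _ E]) simp
  thus "E (a + d - 1) * E (1 - 2 * d) * E (- (1 / 2 - d)) = - si * (cos (of_real pi * a) + si * sin (of_real pi * a))"
    unfolding Eh by (simp add: E)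
  have "E (a + d - 1) * E (1 - 2 * d) * E (- (1 - d)) = E (- 1) * E a" unfolding add by (rule arg_cong[of _ _ E]) simp
  thus "E (a + d - 1) * E (1 - 2 * d) * E (- (1 - d)) = - (cos (of_real pi * a) + si * sin (of_real pi * a))"
    unfolding E1 by (simp add: E)
qed

text \<open>On the left is the mean of the coefficients from the two half planes, which does not
  depend on r; on the right is what the two terms of the formula contribute in the half plane of
  sign r.\<close>

lemma coeff_identities:
  fixes r :: real
  assumes r: "r = 1 \<or> r = -1"
  shows coeff_even: "ferrers_factor \<nu> \<mu> / 2 * (conn_even \<nu> \<mu> 1 + conn_even \<nu> \<mu> (-1)) =
      ferrers_coeff1 \<nu> \<mu> (of_real r) * exp (\<i> * of_real (r * pi) * (\<nu> + \<mu> + 1)) * conn_even \<nu> \<mu> r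
    + ferrers_coeff2 \<nu> \<mu> (of_real r) * exp (\<i> * of_real (r * pi) * (\<mu> - \<nu>)) * conn_even (- \<nu> - 1) \<mu> r"
    and coeff_odd: "ferrers_factor \<nu> \<mu> / 2 * (conn_odd \<nu> \<mu> 1 + conn_odd \<nu> \<mu> (-1)) =
      ferrers_coeff1 \<nu> \<mu> (of_real r) * exp (\<i> * of_real (r * pi) * (\<nu> + \<mu> + 1)) * conn_odd \<nu> \<mu> r
    + ferrers_coeff2 \<nu> \<mu> (of_real r) * exp (\<i> * of_real (r * pi) * (\<mu> - \<nu>)) * conn_odd (- \<nu> - 1) \<mu> r"
proof -
  define ca sa cd sd where "ca = cos (of_real pi * a)" and "sa = sin (of_real pi * a)"
    and "cd = cos (of_real pi * d)" and "sd = sin (of_real pi * d)"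
  note trig_defs = ca_def [symmetric] sa_def [symmetric] cd_def [symmetric] sd_def [symmetric]
  define si where "si = of_real r * \<i>"
  define T where "T = 2 powr \<nu>"
  have T: "T \<noteq> 0" by (simp add: T_def)
  have P: "complex_of_real pi \<noteq> 0" by simp
  have p: "complex_of_real (sqrt pi) * of_real (sqrt pi) = of_real pi" by (simp flip: of_real_mult)
  have si: "si * si = - 1" "si\<^sup>2 = - 1" using r by (auto simp: si_def power2_eq_square)
  have q: "ca * cd - sa * sd \<noteq> 0" using cos_\<nu> unfolding trig_\<nu>\<mu> trig_defs by simp
  have g: "Gamma (\<nu> + 3 / 2) * rGamma (\<nu> + 3 / 2) = 1" "Gamma (1 / 2 - \<nu>) * rGamma (1 / 2 - \<nu>) = 1"
    using params by (simp_all add: rGamma_inverse_Gamma Gamma_eq_zero_iff)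
  have sq: "sa\<^sup>2 + ca\<^sup>2 = 1" "sd\<^sup>2 + cd\<^sup>2 = 1" by (simp_all add: ca_def sa_def cd_def sd_def)
  have sign: "exp (\<i> * of_real (1 * pi) * w) + exp (\<i> * of_real (-1 * pi) * w) = 2 * cos (of_real pi * w)" for w :: complex
    using exp_sign_pi[of 1 w] exp_sign_pi[of "-1" w] by simp
  have sumE: "conn_even \<nu> \<mu> 1 + conn_even \<nu> \<mu> (-1) = 2 * ca * (Gamma (\<nu> + 3 / 2) * of_real (sqrt pi) * rGamma (a + 1 / 2) * rGamma (d + 1 / 2))"
    unfolding conn_eq distrib_right [symmetric] sign by (simp add: ca_def)
  have sumO: "conn_odd \<nu> \<mu> 1 + conn_odd \<nu> \<mu> (-1) = - 2 * (2 * (- sa) * (Gamma (\<nu> + 3 / 2) * of_real (sqrt pi) * rGamma a * rGamma d))"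
    unfolding conn_eq distrib_left [symmetric] distrib_right [symmetric] sign
    by (simp add: sa_def ring_distribs cos_diff cos_add)
  have tE: "ca * (ca * cd - sa * sd) = (cd - si * sd) * ((ca * cd + sa * sd) * (ca * cd - sa * sd) + si * (sd * cd)) - (ca + si * sa) * (sd * sa)"
    by (rule trig_even[OF sq si(2)])
  have tO: "- sa * (ca * cd - sa * sd) = (- si * (cd - si * sd)) * ((ca * cd + sa * sd) * (ca * cd - sa * sd) + si * (sd * cd)) - (- si * (ca + si * sa)) * (cd * ca)"
    using trig_odd[OF sq si(2)] by (simp add: algebra_simps)
  have X: "- (ca + si * sa) = - si * (- si * (ca + si * sa))" using si(1) by (simp flip: mult.assoc)
  show "ferrers_factor \<nu> \<mu> / 2 * (conn_even \<nu> \<mu> 1 + conn_even \<nu> \<mu> (-1)) =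
      ferrers_coeff1 \<nu> \<mu> (of_real r) * exp (\<i> * of_real (r * pi) * (\<nu> + \<mu> + 1)) * conn_even \<nu> \<mu> r
    + ferrers_coeff2 \<nu> \<mu> (of_real r) * exp (\<i> * of_real (r * pi) * (\<mu> - \<nu>)) * conn_even (- \<nu> - 1) \<mu> r"
    unfolding sumE unfolding ferrers_factor_eq ferrers_coeff1_eq ferrers_coeff2_eq conn_eq \<nu>\<mu>_eq(1,3) trig_\<nu>\<mu> minus_minus
      trig_defs si_def [symmetric] T_def [symmetric]
    by (rule coeff_algebra[OF T P q p g si(1) exp_products(1,3)[OF r, folded si_def, unfolded trig_defs]
          Gamma_products(1)[unfolded trig_defs, folded T_def] tE])
  \<comment> \<open>The common factor -2 of the odd connection coefficients is left out here to fit
    \<open>coeff_algebra\<close>, and restored afterwards.\<close>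
  have "ferrers_factor \<nu> \<mu> / 2 * (2 * (- sa) * (Gamma (\<nu> + 3 / 2) * of_real (sqrt pi) * rGamma a * rGamma d)) =
      ferrers_coeff1 \<nu> \<mu> (of_real r) * exp (\<i> * of_real (r * pi) * (\<nu> + \<mu> + 1)) *
        (exp (\<i> * of_real (r * pi) * (- (a + 1 / 2))) * (Gamma (\<nu> + 3 / 2) * of_real (sqrt pi) * rGamma a * rGamma d))
    + ferrers_coeff2 \<nu> \<mu> (of_real r) * exp (\<i> * of_real (r * pi) * (\<mu> - \<nu>)) *
        (exp (\<i> * of_real (r * pi) * (- (1 - d))) * (Gamma (1 / 2 - \<nu>) * of_real (sqrt pi) * rGamma (1 / 2 - d) * rGamma (1 / 2 - a)))"
    unfolding ferrers_factor_eq ferrers_coeff1_eq ferrers_coeff2_eq \<nu>\<mu>_eq(1,3) trig_\<nu>\<mu> minus_minus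
      trig_defs si_def [symmetric] T_def [symmetric]
    by (rule coeff_algebra[OF T P q p g si(1) exp_products(2)[OF r, folded si_def, unfolded trig_defs]
         exp_products(4)[OF r, folded si_def, unfolded trig_defs, unfolded X]
          Gamma_products(2)[unfolded trig_defs, folded T_def] tO])
  moreover have "x * (- 2 * z) = y * (- 2 * z1) + y' * (- 2 * z2)" if "x * z = y * z1 + y' * z2" for x y y' z z1 z2 :: complex
    using that by (metis (no_types, opaque_lifting) distrib_left mult.left_commute)
  ultimately show "ferrers_factor \<nu> \<mu> / 2 * (conn_odd \<nu> \<mu> 1 + conn_odd \<nu> \<mu> (-1)) =
      ferrers_coeff1 \<nu> \<mu> (of_real r) * exp (\<i> * of_real (r * pi) * (\<nu> + \<mu> + 1)) * conn_odd \<nu> \<mu> r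
    + ferrers_coeff2 \<nu> \<mu> (of_real r) * exp (\<i> * of_real (r * pi) * (\<mu> - \<nu>)) * conn_odd (- \<nu> - 1) \<mu> r"
    unfolding sumO unfolding conn_eq by blast
qed

end

subsection \<open>The Ferrers function\<close>

text \<open>For s Im z > 0 the point 1 - z lies in the opposite half plane, so the argument of z - 1
  is that of 1 - z plus s \<pi>.\<close>

lemma powr_minus_one_half_plane:
  assumes s: "s = 1 \<or> s = (-1::real)" and z: "z \<in> half_plane s"
  shows "(z - 1) powr w = exp (\<i> * of_real (s * pi) * w) * (1 - z) powr w"
proof -
  have im: "s * Im z > 0" using z by (simp add: half_plane_def)
  have nz: "1 - z \<noteq> 0" "z - 1 \<noteq> 0" using im by auto
  have "Ln (- (1 - z)) = Ln (1 - z) + \<i> * of_real (s * pi)"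
    using s im by (subst Ln_minus[OF nz(1)]) auto
  thus ?thesis using nz by (simp add: powr_def ring_distribs exp_add mult_ac)
qed

text \<open>\<open>Lim\<close> is a definite description; convergence determines its value only
  along a nontrivial filter.\<close>

lemma half_plane_trivial_limit:
  assumes "s = 1 \<or> s = (-1::real)"
  shows "at (complex_of_real x) within half_plane s \<noteq> bot"
  unfolding trivial_limit_within not_not islimpt_approachable
proof (intro allI impI)
  fix e :: real assume e: "e > 0"
  show "\<exists>z\<in>half_plane s. z \<noteq> of_real x \<and> dist z (of_real x) < e"
    using assms e by (intro bexI[of _ "of_real x + \<i> * of_real (s * (e / 2))"])
      (auto simp: dist_norm norm_mult half_plane_def complex_eq_iff)
qed

context ferrers_params begin

text \<open>On the half plane of sign s this is \<open>legendre_Q\<close> stripped of two phases,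
  but the formula makes sense on the whole doubly cut plane and thus continues
  \<open>legendre_Q\<close> across (-1, 1).\<close>

definition boundary_value :: "real \<Rightarrow> complex \<Rightarrow> complex" where
  "boundary_value s z = ferrers_factor \<nu> \<mu> * ((1 + z) powr (\<mu> / 2) * (1 - z) powr (\<mu> / 2)) *
     (conn_even \<nu> \<mu> s * sol_even \<nu> \<mu> z + conn_odd \<nu> \<mu> s * sol_odd \<nu> \<mu> z)"

lemma boundary_value_holomorphic: "boundary_value s holomorphic_on double_slit_plane"
  unfolding boundary_value_def [abs_def]
  by (intro holomorphic_intros sol_even_odd_holomorphic) (auto simp: double_slit_plane_alt)

text \<open>The first exponential is the one in the definition of \<open>legendre_Q\<close>; the
  second arises from turning the power of z - 1 into a power of 1 - z.\<close>

lemma legendre_Q_half_plane: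
  assumes s: "s = 1 \<or> s = (-1::real)" and z: "z \<in> half_plane s"
  shows "legendre_Q \<nu> \<mu> z = exp (\<i> * of_real pi * \<mu>) * exp (\<i> * of_real (s * pi) * (\<mu> / 2)) * boundary_value s z"
proof -
  have z0: "z \<noteq> 0" by (rule half_plane_notin(2)[OF z])
  have "legendre_Q \<nu> \<mu> z = ferrers_factor \<nu> \<mu> * exp (\<i> * of_real pi * \<mu>) *
       ((z + 1) powr (\<mu> / 2) * (z - 1) powr (\<mu> / 2)) * sol_inf \<nu> \<mu> z"
    unfolding legendre_Q_def ferrers_factor_def sol_inf_def powr_minus by (simp add: divide_simps)
  thus ?thesis
    unfolding boundary_value_def sol_inf_connection[OF params(1) s z] powr_minus_one_half_plane[OF s z]
    by (simp only: mult_ac add.commute[of z 1])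
qed

lemma legendre_Q_Lim:
  assumes s: "s = 1 \<or> s = (-1::real)" and x: "-1 < x" "x < 1"
  shows "Lim (at (complex_of_real x) within half_plane s) (legendre_Q \<nu> \<mu>) =
     exp (\<i> * of_real pi * \<mu>) * exp (\<i> * of_real (s * pi) * (\<mu> / 2)) * boundary_value s (of_real x)"
proof (rule tendsto_Lim[OF half_plane_trivial_limit[OF s]])
  have "of_real x \<in> double_slit_plane" using x by (simp add: double_slit_plane_iff)
  hence "isCont (boundary_value s) (of_real x)"
    using boundary_value_holomorphic holomorphic_on_imp_continuous_on continuous_on_eq_continuous_at open_double_slit_plane by blast
  hence "(boundary_value s \<longlongrightarrow> boundary_value s (of_real x)) (at (of_real x) within half_plane s)"
    using continuous_at_imp_continuous_at_within continuous_within by blast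
  hence "((\<lambda>z. exp (\<i> * of_real pi * \<mu>) * exp (\<i> * of_real (s * pi) * (\<mu> / 2)) * boundary_value s z) \<longlongrightarrow>
     exp (\<i> * of_real pi * \<mu>) * exp (\<i> * of_real (s * pi) * (\<mu> / 2)) * boundary_value s (of_real x)) (at (of_real x) within half_plane s)"
    by (intro tendsto_mult tendsto_const)
  moreover have "eventually (\<lambda>z. z \<in> half_plane s) (at (complex_of_real x) within half_plane s)"
    by (simp add: eventually_at_filter)
  hence "eventually (\<lambda>z. exp (\<i> * of_real pi * \<mu>) * exp (\<i> * of_real (s * pi) * (\<mu> / 2)) * boundary_value s z
       = legendre_Q \<nu> \<mu> z) (at (complex_of_real x) within half_plane s)"
    by eventually_elim (simp only: legendre_Q_half_plane[OF s])
  ultimately show "(legendre_Q \<nu> \<mu> \<longlongrightarrow> exp (\<i> * of_real pi * \<mu>) * exp (\<i> * of_real (s * pi) * (\<mu> / 2)) * boundary_value s (of_real x))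
      (at (of_real x) within half_plane s)"
    by (rule Lim_transform_eventually)
qed

text \<open>The exponentials in the definition of the Ferrers function undo exactly the phases on
  the two sides of the cut, which leaves a plain mean.\<close>

lemma ferrers_Q_real_eq:
  assumes x: "-1 < x" "x < 1"
  shows "ferrers_Q_real \<nu> \<mu> x = (boundary_value 1 (of_real x) + boundary_value (-1) (of_real x)) / 2"
proof -
  have H: "{z. Im z > 0} = half_plane 1" "{z. Im z < 0} = half_plane (-1)" by (auto simp: half_plane_def)
  have L: "Lim (at (complex_of_real x) within half_plane 1) (legendre_Q \<nu> \<mu>) =
       exp (\<i> * of_real pi * \<mu>) * exp (\<i> * of_real (1 * pi) * (\<mu> / 2)) * boundary_value 1 (of_real x)"
     "Lim (at (complex_of_real x) within half_plane (-1)) (legendre_Q \<nu> \<mu>) =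
       exp (\<i> * of_real pi * \<mu>) * exp (\<i> * of_real (- 1 * pi) * (\<mu> / 2)) * boundary_value (-1) (of_real x)"
    using x by (intro legendre_Q_Lim; simp)+
  have e: "exp (- \<i> * of_real pi * \<mu> / 2) * exp (- \<i> * of_real pi * \<mu>) * (exp (\<i> * of_real pi * \<mu>) * exp (\<i> * of_real (1 * pi) * (\<mu> / 2)) * b) = b"
     "exp (\<i> * of_real pi * \<mu> / 2) * exp (- \<i> * of_real pi * \<mu>) * (exp (\<i> * of_real pi * \<mu>) * exp (\<i> * of_real (- 1 * pi) * (\<mu> / 2)) * b) = b" for b
    by (simp_all flip: exp_add mult.assoc)
  show ?thesis unfolding ferrers_Q_real_def H L e ..
qed

text \<open>The mean is holomorphic on the doubly cut plane, so it witnesses the existence behind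
  the choice; as (-1, 1) accumulates at 0, the identity theorem makes the chosen continuation equal
  to it.\<close>

lemma ferrers_Q_eq:
  assumes z: "z \<in> double_slit_plane"
  shows "ferrers_Q \<nu> \<mu> z = (boundary_value 1 z + boundary_value (-1) z) / 2"
proof -
  let ?\<Phi> = "\<lambda>z. (boundary_value 1 z + boundary_value (-1) z) / 2"
  have \<Phi>: "?\<Phi> holomorphic_on double_slit_plane"
    by (intro holomorphic_intros boundary_value_holomorphic) simp
  hence "\<exists>F. F holomorphic_on double_slit_plane \<and> (\<forall>x. -1 < x \<and> x < 1 \<longrightarrow> F (of_real x) = ferrers_Q_real \<nu> \<mu> x)"
    by (intro exI[of _ ?\<Phi>]) (simp add: ferrers_Q_real_eq)
  from someI_ex[OF this] have F: "ferrers_Q \<nu> \<mu> holomorphic_on double_slit_plane"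
      "\<And>x. -1 < x \<Longrightarrow> x < 1 \<Longrightarrow> ferrers_Q \<nu> \<mu> (of_real x) = ferrers_Q_real \<nu> \<mu> x"
    unfolding ferrers_Q_def [symmetric] double_slit_plane_def [symmetric]
    by (simp_all add: ferrers_Q_def double_slit_plane_def)
  have "ferrers_Q \<nu> \<mu> z - ?\<Phi> z = 0"
  proof (rule analytic_continuation[where f = "\<lambda>z. ferrers_Q \<nu> \<mu> z - ?\<Phi> z" and S = double_slit_plane and U = "of_real ` {-1<..<1}" and \<xi> = 0])
    show "(\<lambda>z. ferrers_Q \<nu> \<mu> z - ?\<Phi> z) holomorphic_on double_slit_plane"
      by (intro holomorphic_on_diff F \<Phi>)
    show "0 islimpt complex_of_real ` {-1<..<1}"
      unfolding islimpt_approachable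
    proof (intro allI impI)
      fix e :: real assume e: "e > 0"
      show "\<exists>z\<in>complex_of_real ` {-1<..<1}. z \<noteq> 0 \<and> dist z 0 < e"
        using e by (intro bexI[of _ "of_real (min (e / 2) (1 / 2))"]) (auto simp: min_def)
    qed
  qed (use z in \<open>auto simp: double_slit_plane_iff F ferrers_Q_real_eq\<close>)
  thus ?thesis by simp
qed

text \<open>The reflection merely exchanges the upper parameters of each series. Hence the recessive
  solutions for \<nu> and - \<nu> - 1 expand in one and the same basis.\<close>

lemma sol_reflect: "sol_even (- \<nu> - 1) \<mu> = sol_even \<nu> \<mu>" "sol_odd (- \<nu> - 1) \<mu> = sol_odd \<nu> \<mu>"
proof -
  have 1: "\<mu> - (- \<nu> - 1) = \<nu> + \<mu> + 1" "- \<nu> - 1 + \<mu> + 1 = \<mu> - \<nu>"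
    "\<nu> + \<mu> + 1 + 1 = \<nu> + \<mu> + 2" "- \<nu> - 1 + \<mu> + 2 = \<mu> - \<nu> + 1" by simp_all
  show "sol_even (- \<nu> - 1) \<mu> = sol_even \<nu> \<mu>" "sol_odd (- \<nu> - 1) \<mu> = sol_odd \<nu> \<mu>"
    unfolding sol_even_def [abs_def] sol_odd_def [abs_def] 1
    by (subst hyp2F1_commute, rule refl)+
qed

text \<open>Splitting off (1 - z) powr (\<mu> / 2) leaves the exponents -(\<nu> + \<mu> + 1) and
  -(\<mu> - \<nu>), which are those of \<open>sol_inf_eq_moebius_form\<close> at \<nu> and at -
  \<nu> - 1.\<close>

lemma moebius_terms:
  assumes r: "r = 1 \<or> r = (-1::real)" and z: "z \<in> half_plane r"
  shows "(1 - z) powr (- \<nu> - \<mu> / 2 - 1) * hyp2F1 (\<nu> + \<mu> + 1) (\<nu> + 1) (2 * \<nu> + 2) (2 / (1 - z)) =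
      (1 - z) powr (\<mu> / 2) * (exp (\<i> * of_real (r * pi) * (\<nu> + \<mu> + 1)) *
        (conn_even \<nu> \<mu> r * sol_even \<nu> \<mu> z + conn_odd \<nu> \<mu> r * sol_odd \<nu> \<mu> z))"
    and "(1 - z) powr (\<nu> - \<mu> / 2) * hyp2F1 (- \<nu>) (\<mu> - \<nu>) (- 2 * \<nu>) (2 / (1 - z)) =
      (1 - z) powr (\<mu> / 2) * (exp (\<i> * of_real (r * pi) * (\<mu> - \<nu>)) *
        (conn_even (- \<nu> - 1) \<mu> r * sol_even \<nu> \<mu> z + conn_odd (- \<nu> - 1) \<mu> r * sol_odd \<nu> \<mu> z))"
proof -
  have p: "(1 - z) powr (\<mu> / 2) * ((1 - z) powr v * h) = (1 - z) powr (\<mu> / 2 + v) * h" for v h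
    by (simp add: powr_add)
  have c': "- \<nu> - 1 + 3 / 2 \<notin> \<int>\<^sub>\<le>\<^sub>0" "2 * (- \<nu> - 1) + 2 \<notin> \<int>\<^sub>\<le>\<^sub>0" using params by simp_all
  have "\<mu> / 2 + - (\<nu> + \<mu> + 1) = - \<nu> - \<mu> / 2 - 1" by (simp add: field_simps)
  note eq = this
  show "(1 - z) powr (- \<nu> - \<mu> / 2 - 1) * hyp2F1 (\<nu> + \<mu> + 1) (\<nu> + 1) (2 * \<nu> + 2) (2 / (1 - z)) =
      (1 - z) powr (\<mu> / 2) * (exp (\<i> * of_real (r * pi) * (\<nu> + \<mu> + 1)) *
        (conn_even \<nu> \<mu> r * sol_even \<nu> \<mu> z + conn_odd \<nu> \<mu> r * sol_odd \<nu> \<mu> z))"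
    unfolding sol_inf_connection[OF params(1) r z, symmetric] sol_inf_eq_moebius_form[OF params(1) params(5) r z, symmetric]
    by (simp only: p eq)
  have "- \<nu> - 1 + \<mu> + 1 = \<mu> - \<nu>" "- \<nu> - 1 + 1 = - \<nu>" "2 * (- \<nu> - 1) + 2 = - 2 * \<nu>" by simp_all
  with sol_inf_eq_moebius_form[OF c' r z, of \<mu>] sol_inf_connection[OF c'(1) r z, of \<mu>]
  have h2: "(1 - z) powr (- (\<mu> - \<nu>)) * hyp2F1 (\<mu> - \<nu>) (- \<nu>) (- 2 * \<nu>) (2 / (1 - z)) =
     exp (\<i> * of_real (r * pi) * (\<mu> - \<nu>)) * (conn_even (- \<nu> - 1) \<mu> r * sol_even \<nu> \<mu> z + conn_odd (- \<nu> - 1) \<mu> r * sol_odd \<nu> \<mu> z)"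
    by (simp only: sol_reflect)
  have eq2: "\<mu> / 2 + - (\<mu> - \<nu>) = \<nu> - \<mu> / 2" by (simp add: field_simps)
  show "(1 - z) powr (\<nu> - \<mu> / 2) * hyp2F1 (- \<nu>) (\<mu> - \<nu>) (- 2 * \<nu>) (2 / (1 - z)) =
      (1 - z) powr (\<mu> / 2) * (exp (\<i> * of_real (r * pi) * (\<mu> - \<nu>)) *
        (conn_even (- \<nu> - 1) \<mu> r * sol_even \<nu> \<mu> z + conn_odd (- \<nu> - 1) \<mu> r * sol_odd \<nu> \<mu> z))"
    by (simp only: hyp2F1_commute[of "- \<nu>" "\<mu> - \<nu>"] h2 [symmetric] p eq2)
qed

text \<open>With the common prefactor \<open>B\<close> split off, both sides are combinations of the
  even and the odd solution, and \<open>coeff_identities\<close> equates their coefficients.\<close>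

lemma ferrers_Q_half_plane:
  assumes r: "r = 1 \<or> r = (-1::real)" and z: "z \<in> half_plane r"
  shows "ferrers_Q \<nu> \<mu> z =
     ferrers_coeff1 \<nu> \<mu> (of_real r) * (1 + z) powr (\<mu> / 2) * (1 - z) powr (- \<nu> - \<mu> / 2 - 1) *
       hyp2F1 (\<nu> + \<mu> + 1) (\<nu> + 1) (2 * \<nu> + 2) (2 / (1 - z))
   + ferrers_coeff2 \<nu> \<mu> (of_real r) * (1 + z) powr (\<mu> / 2) * (1 - z) powr (\<nu> - \<mu> / 2) *
       hyp2F1 (- \<nu>) (\<mu> - \<nu>) (- 2 * \<nu>) (2 / (1 - z))"
proof -
  define V0 V1 B where "V0 = sol_even \<nu> \<mu> z" and "V1 = sol_odd \<nu> \<mu> z"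
    and "B = (1 + z) powr (\<mu> / 2) * (1 - z) powr (\<mu> / 2)"
  define X Y where "X = exp (\<i> * of_real (r * pi) * (\<nu> + \<mu> + 1))" and "Y = exp (\<i> * of_real (r * pi) * (\<mu> - \<nu>))"
  have "ferrers_Q \<nu> \<mu> z = B * ((ferrers_factor \<nu> \<mu> / 2 * (conn_even \<nu> \<mu> 1 + conn_even \<nu> \<mu> (-1))) * V0
       + (ferrers_factor \<nu> \<mu> / 2 * (conn_odd \<nu> \<mu> 1 + conn_odd \<nu> \<mu> (-1))) * V1)"
    unfolding ferrers_Q_eq[OF subsetD[OF half_plane_subset z]] boundary_value_def V0_def [symmetric] V1_def [symmetric] B_def [symmetric]
    by (simp add: algebra_simps add_divide_distrib)
  also have "\<dots> = ferrers_coeff1 \<nu> \<mu> (of_real r) * (B * (X * (conn_even \<nu> \<mu> r * V0 + conn_odd \<nu> \<mu> r * V1)))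
     + ferrers_coeff2 \<nu> \<mu> (of_real r) * (B * (Y * (conn_even (- \<nu> - 1) \<mu> r * V0 + conn_odd (- \<nu> - 1) \<mu> r * V1)))"
    unfolding coeff_identities[OF r] X_def [symmetric] Y_def [symmetric] by (simp add: algebra_simps)
  also have "\<dots> = ferrers_coeff1 \<nu> \<mu> (of_real r) * ((1 + z) powr (\<mu> / 2) * ((1 - z) powr (- \<nu> - \<mu> / 2 - 1) *
       hyp2F1 (\<nu> + \<mu> + 1) (\<nu> + 1) (2 * \<nu> + 2) (2 / (1 - z))))
   + ferrers_coeff2 \<nu> \<mu> (of_real r) * ((1 + z) powr (\<mu> / 2) * ((1 - z) powr (\<nu> - \<mu> / 2) *
       hyp2F1 (- \<nu>) (\<mu> - \<nu>) (- 2 * \<nu>) (2 / (1 - z))))"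
    unfolding moebius_terms[OF r z] B_def X_def Y_def V0_def V1_def by (simp only: mult.assoc)
  finally show ?thesis by (simp only: mult.assoc)
qed

end

theorem theorem3p6:
  fixes \<nu> \<mu> x s :: complex
  assumes "\<nu> + \<mu> \<notin> \<int>\<^sub>\<le>\<^sub>0"
    and "2 * \<nu> \<notin> \<int>"
    and "(Im x > 0 \<and> s = 1) \<or> (Im x < 0 \<and> s = -1)"
  shows "ferrers_Q \<nu> \<mu> x =
      2 powr \<nu> * exp (- s * of_real pi * \<i> * (\<nu> + 1)) *
      (cos (of_real pi * \<mu>) - s * \<i> * (sin (of_real pi * (\<mu> - \<nu>)) / (2 * cos (of_real pi * \<nu>)))) *
      (Gamma (\<nu> + 1) * Gamma (\<nu> + \<mu> + 1) / Gamma (2 * \<nu> + 2)) *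
      (1 + x) powr (\<mu> / 2) * (1 - x) powr (- \<nu> - \<mu> / 2 - 1) *
      hyp2F1 (\<nu> + \<mu> + 1) (\<nu> + 1) (2 * \<nu> + 2) (2 / (1 - x))
    + s * \<i> * of_real pi * 2 powr (- \<nu> - 2) * exp (s * of_real pi * \<i> * \<nu>) *
      (1 / cos (of_real pi * \<nu>)) *
      (Gamma (- \<nu>) / Gamma (- 2 * \<nu>) * rGamma (\<nu> - \<mu> + 1)) *
      (1 + x) powr (\<mu> / 2) * (1 - x) powr (\<nu> - \<mu> / 2) *
      hyp2F1 (- \<nu>) (\<mu> - \<nu>) (- 2 * \<nu>) (2 / (1 - x))"
proof -
  interpret ferrers_params \<nu> \<mu> by unfold_locales (rule assms)+
  \<comment> \<open>The sign in the statement is a complex number, that of the half planes a real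
    one.\<close>
  from assms(3) obtain r :: real where r: "r = 1 \<or> r = -1" "x \<in> half_plane r" "s = of_real r"
    by (auto simp: half_plane_def intro: that[of 1] that[of "-1"])
  show ?thesis
    using ferrers_Q_half_plane[OF r(1,2)] unfolding r(3) ferrers_coeff1_def ferrers_coeff2_def .
qed

end
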